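(* Let $K$ be a field and let $A = K[X_1,\ldots,X_d]$ be the standard graded polynomial ring over $K$. Let $I, J$ be monomial ideals in $A$. For $n \geq 0$ let $I_n(J) = (I^n \colon J^\infty)$ be the $n$-th symbolic power of $I$ with respect to $J$, and let $f^I_J(n) = e_0(I_n(J)/I^n)$. The function $f^I_J$ is of quasi-polynomial type, say of period $g$ and degree $c$; write, for $n \gg 0$, $$f^I_J(n) = a_c(n)n^c + a_{c-1}(n)n^{c-1} + \cdots + a_1(n)n + a_0(n),$$ where each $a_i \colon \mathbb{N} \to \mathbb{Q}$ ($0 \le i \le c$) is periodic of period $g$ and $a_c \neq 0$. Assume further that $I$ is generated by some elements of the same degree and that $\operatorname{height} I \geq 2$. Then $a_{c-1}(-)$ is a constant function (for $c = 0$ nothing is asserted).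
   Context: Standard graded means $\deg X_i = 1$ for all $i$. For ideals $I, J$ of $A$, $(I^n \colon J^\infty) = \bigcup_{k \geq 1} (I^n \colon J^k)$. Multiplicity: for a finitely generated graded $A$-module $M = \bigoplus_{m\ge 0} M_m$, the Hilbert series $H_M(z) = \sum_{m \geq 0} (\dim_K M_m) z^m$ can be written as $h_M(z)/(1-z)^{\dim M}$ with $h_M(z) \in \mathbb{Z}[z]$, where $\dim M$ is the Krull dimension of $M$; the multiplicity of $M$ is $e_0(M) = h_M(1)$ (with $e_0(0) = 0$). Quasi-polynomials: a function $f \colon \mathbb{N} \to \mathbb{Z}$ is a quasi-polynomial of period $g$ and degree $c$ if $f(n) = \sum_{i=0}^{c} a_i(n) n^i$ for all $n$, where the $a_i \colon \mathbb{N} \to \mathbb{Q}$ are periodic functions of period $g$ and $a_c \neq 0$. A function is of quasi-polynomial type (of period $g$ and degree $c$) if it coincides with such a quasi-polynomial for all $n \gg 0$. Known background, part of the setting: $\bigoplus_{n \geq 0} I_n(J)$ is a finitely generated $A$-algebra, so $f^I_J$ is of quasi-polynomial type; moreover $\dim I_n(J)/I^n$ is constant for $n \gg 0$ and $a_c(-)$ is a positive constant. If $f^I_J(n) = 0$ for all $n \gg 0$, there is no leading coefficient and nothing is asserted. *)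

theory Defs
  imports
    "HOL-Algebra.Algebra"
    "HOL-Algebra.Algebraic_Closure_Type"
    "HOL-Library.Poly_Mapping"
    "HOL-Library.Extended_Nat"
    "HOL-Computational_Algebra.Polynomial_FPS"
begin

section \<open>Prime chains, Krull dimension and height\<close>

definition prime_chain :: "('a, 'b) ring_scheme \<Rightarrow> nat \<Rightarrow> (nat \<Rightarrow> 'a set) \<Rightarrow> bool" where
  "prime_chain R n C \<longleftrightarrow> (\<forall>i\<le>n. primeideal (C i) R) \<and> (\<forall>i<n. C i \<subset> C (Suc i))"

text \<open>The zero ring gets dimension 0 here instead of a negative value; the multiplicity below
  treats the zero module separately.\<close>

definition krull_dim :: "('a, 'b) ring_scheme \<Rightarrow> enat" where
  "krull_dim R = Sup {enat n | n C. prime_chain R n C}"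

definition prime_height :: "('a, 'b) ring_scheme \<Rightarrow> 'a set \<Rightarrow> enat" where
  "prime_height R P = Sup {enat n | n C. prime_chain R n C \<and> C n = P}"

text \<open>The unit ideal has height \<open>\<infinity>\<close>, as the infimum of the empty set.\<close>

definition height :: "('a, 'b) ring_scheme \<Rightarrow> 'a set \<Rightarrow> enat" where
  "height R I = (INF P \<in> {P. primeideal P R \<and> I \<subseteq> P}. prime_height R P)"


section \<open>Ideal powers, colon ideals and symbolic powers\<close>

abbreviation ideal_power :: "('a, 'b) ring_scheme \<Rightarrow> 'a set \<Rightarrow> nat \<Rightarrow> 'a set" where
  "ideal_power R I n \<equiv> I [^]\<^bsub>ideals_set R\<^esub> n"

definition colon :: "('a, 'b) ring_scheme \<Rightarrow> 'a set \<Rightarrow> 'a set \<Rightarrow> 'a set" where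
  "colon R I J = {a \<in> carrier R. \<forall>b\<in>J. a \<otimes>\<^bsub>R\<^esub> b \<in> I}"

definition saturation :: "('a, 'b) ring_scheme \<Rightarrow> 'a set \<Rightarrow> 'a set \<Rightarrow> 'a set" where
  "saturation R I J = (\<Union>k\<in>{1..}. colon R I (ideal_power R J k))"

definition symbolic_power :: "('a, 'b) ring_scheme \<Rightarrow> 'a set \<Rightarrow> 'a set \<Rightarrow> nat \<Rightarrow> 'a set" where
  "symbolic_power R I J n = saturation R (ideal_power R I n) J"


section \<open>The standard graded polynomial ring\<close>

text \<open>The variables are indexed by the finite type \<open>'n\<close>, so \<open>d = CARD('n)\<close>; elements of
  \<open>'n \<Rightarrow>\<^sub>0 nat\<close> are exponent vectors.\<close>

type_synonym ('n, 'k) mpoly = "('n \<Rightarrow>\<^sub>0 nat) \<Rightarrow>\<^sub>0 'k"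

abbreviation mpoly_ring :: "('n::finite, 'k::field) mpoly ring" where
  "mpoly_ring \<equiv> ring_of_type_algebra"

definition homogeneous_part :: "nat \<Rightarrow> ('n::finite, 'k::field) mpoly set" where
  "homogeneous_part m = {p. \<forall>t\<in>Poly_Mapping.keys p. (\<Sum>i\<in>UNIV. Poly_Mapping.lookup t i) = m}"

definition monomial_ideal :: "('n::finite, 'k::field) mpoly set \<Rightarrow> bool" where
  "monomial_ideal I \<longleftrightarrow> (\<exists>T. I = Idl\<^bsub>mpoly_ring\<^esub> ((\<lambda>t. Poly_Mapping.single t 1) ` T))"

definition generated_in_one_degree :: "('n::finite, 'k::field) mpoly set \<Rightarrow> bool" where
  "generated_in_one_degree I \<longleftrightarrow>
     (\<exists>\<delta>. \<exists>S \<subseteq> homogeneous_part \<delta>. I = Idl\<^bsub>mpoly_ring\<^esub> S)"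


section \<open>Multiplicity of a graded subquotient\<close>

text \<open>For homogeneous ideals \<open>Q \<subseteq> P\<close> of \<open>A\<close>, the graded module \<open>M = P/Q\<close> is an ideal of the ring
  \<open>A/Q\<close>. Its component \<open>M_m\<close> is the image of \<open>P \<inter> A_m\<close>, and the \<open>K\<close>-vector space structure is
  that over the image of the constants in \<open>A/Q\<close>.\<close>

definition const_image :: "('n::finite, 'k::field) mpoly set \<Rightarrow> ('n, 'k) mpoly set set" where
  "const_image Q = range (\<lambda>c. Q +>\<^bsub>mpoly_ring\<^esub> Poly_Mapping.single 0 c)"

definition subquotient_part ::
    "('n::finite, 'k::field) mpoly set \<Rightarrow> ('n, 'k) mpoly set \<Rightarrow> nat \<Rightarrow> ('n, 'k) mpoly set set" where
  "subquotient_part P Q m = (\<lambda>p. Q +>\<^bsub>mpoly_ring\<^esub> p) ` (P \<inter> homogeneous_part m)"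

definition hilbert_series ::
    "('n::finite, 'k::field) mpoly set \<Rightarrow> ('n, 'k) mpoly set \<Rightarrow> int fps" where
  "hilbert_series P Q =
     Abs_fps (\<lambda>m. int (ring.dim (mpoly_ring Quot Q) (const_image Q) (subquotient_part P Q m)))"

text \<open>The dimension of \<open>M\<close> is that of \<open>A/Ann M\<close>, and \<open>Ann (P/Q) = (Q : P)\<close>.\<close>

definition module_dim :: "('n::finite, 'k::field) mpoly set \<Rightarrow> ('n, 'k) mpoly set \<Rightarrow> nat" where
  "module_dim P Q = the_enat (krull_dim (mpoly_ring Quot (colon mpoly_ring Q P)))"

definition h_polynomial ::
    "('n::finite, 'k::field) mpoly set \<Rightarrow> ('n, 'k) mpoly set \<Rightarrow> int poly" where
  "h_polynomial P Q =
     (THE h. hilbert_series P Q * (1 - fps_X) ^ module_dim P Q = fps_of_poly h)"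

definition multiplicity_e0 ::
    "('n::finite, 'k::field) mpoly set \<Rightarrow> ('n, 'k) mpoly set \<Rightarrow> int" where
  "multiplicity_e0 P Q = (if P \<subseteq> Q then 0 else poly (h_polynomial P Q) 1)"

definition f_sym :: "('n::finite, 'k::field) mpoly set \<Rightarrow> ('n, 'k) mpoly set \<Rightarrow> nat \<Rightarrow> int" where
  "f_sym I J n = multiplicity_e0 (symbolic_power mpoly_ring I J n) (ideal_power mpoly_ring I n)"


section \<open>Quasi-polynomial type\<close>

text \<open>The period \<open>g\<close> need not be minimal, and \<open>a c \<noteq> 0\<close> means that \<open>a c\<close> is not the zero function.
  Only the coefficients \<open>a 0, \<dots>, a c\<close> are relevant.\<close>

definition quasi_poly_type ::
    "(nat \<Rightarrow> int) \<Rightarrow> nat \<Rightarrow> nat \<Rightarrow> (nat \<Rightarrow> nat \<Rightarrow> rat) \<Rightarrow> bool" where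
  "quasi_poly_type f g c a \<longleftrightarrow>
     g > 0 \<and> (\<forall>i\<le>c. \<forall>n. a i (n + g) = a i n) \<and> a c \<noteq> (\<lambda>n. 0) \<and>
     (\<forall>\<^sub>F n in sequentially. of_int (f n) = (\<Sum>i\<le>c. a i n * of_nat n ^ i))"

end

theory Submission
  imports Defs "HOL-Library.Fun_Lexorder"
begin

text \<open>Only the minimal primes of maximal dimension contribute to \<open>e\<^sub>0(I_n(J)/I^n)\<close>, so
  \<open>f(n)\<close> is a sum of numbers \<open>e\<^sub>Z(n)\<close>, the lengths of the \<open>\<mm>\<close>-torsion of \<open>A/I^n\<close> after the
  variables in \<open>Z\<close> have been inverted. It suffices that the second difference
  \<open>f(n + 2) - 2 f(n + 1) + f(n)\<close> is at most \<open>M n^(c - 2)\<close> for a constant \<open>M\<close> and large \<open>n\<close>: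
  comparing coefficients, \<open>a\<^sub>c\<close> and then \<open>a\<^sub>c\<^sub>-\<^sub>1\<close> are concave, and a concave
  periodic function is constant.

  Let \<open>r\<close> be the number of variables outside \<open>Z\<close>. If the torsion lies in \<open>I^(n - q)\<close> for a fixed
  \<open>q\<close>, then it is a finitely generated module over the Rees algebra and \<open>e\<^sub>Z\<close> is eventually
  polynomial; otherwise \<open>e\<^sub>Z\<close> grows like \<open>n^r\<close>. In any case \<open>e\<^sub>Z\<close> counts the level \<open>n\<close> points of a
  monoid \<open>T\<close> minus a polynomial. Fix \<open>x\<^sub>0\<close> of level one in \<open>T\<close>. Each facet hyperplane of the cone of
  \<open>T\<close> contains a point of level one, so from a point of \<open>T\<^sub>n\<^sub>+\<^sub>1\<close> outside \<open>x\<^sub>0 + T\<^sub>n\<close>, which is near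
  such a hyperplane, a point of level one can be subtracted along it. Up to the \<open>O(n^(r - 2))\<close>
  points near two hyperplanes this is an injection of \<open>T\<^sub>n\<^sub>+\<^sub>1 - (x\<^sub>0 + T\<^sub>n)\<close> into
  \<open>T\<^sub>n - (x\<^sub>0 + T\<^sub>n\<^sub>-\<^sub>1)\<close>.\<close>

section \<open>Linear functionals and lattice points of a cone\<close>

text \<open>The interpretations in \<open>HOL-Algebra.IntRing\<close> leave transitivity rules with premises \<open>x \<in> UNIV\<close>,
  which calculations with integers would pick.\<close>

declare int.le_trans [trans del] int.lless_trans [trans del]

text \<open>The exponent r - 2 is affordable because of the two kinds of growth. All
  \<open>e_Z\<close> are nonnegative, so each is at most of order n^c, like their sum. If
  \<open>e_Z\<close> grows like n^r, this forces r \<le> c. If it does not, \<open>e_Z\<close> is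
  eventually a polynomial of degree at most c, and its second difference is harmless whatever r is.

  The levels of the powers and of their saturations are infinite, so both are cut at total degree D
  n. For large D the cut removes the same points from both. The cut powers are generated in level
  one and have eventually polynomial counts; the cut saturations form \<open>T\<close>, which is an
  intersection of monoids and need not be generated in level one.

  The injection needs points of level one on the hyperplanes. For the degree bound such a point is a
  padded generator. For a coordinate it is a generator avoiding this variable: without one, and with
  another variable left to invert, all points of level n have distance at least n from the
  hyperplane. For a monoid it is a generator that occurs often.\<close>

definition dot :: "'k set \<Rightarrow> ('k \<Rightarrow> int) \<Rightarrow> ('k \<Rightarrow> int) \<Rightarrow> int" where
  "dot K \<alpha> v = (\<Sum>k\<in>K. \<alpha> k * v k)"

lemma dot_cong: "(\<And>k. k \<in> K \<Longrightarrow> v k = w k) \<Longrightarrow> dot K \<alpha> v = dot K \<alpha> w"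
  by (simp add: dot_def)

lemma dot_add_right: "dot K \<alpha> (\<lambda>k. v k + w k) = dot K \<alpha> v + dot K \<alpha> w"
  by (simp add: dot_def sum.distrib algebra_simps)

lemma dot_diff_right: "dot K \<alpha> (\<lambda>k. v k - w k) = dot K \<alpha> v - dot K \<alpha> w"
  by (simp add: dot_def sum_subtractf algebra_simps)

lemma dot_lincomb_left: "dot K (\<lambda>k. s * \<alpha> k + t * \<beta> k) v = s * dot K \<alpha> v + t * dot K \<beta> v"
  by (simp add: dot_def sum.distrib sum_distrib_left algebra_simps)

lemma dot_lincomb_right: "dot K \<alpha> (\<lambda>k. s * v k + t * w k) = s * dot K \<alpha> v + t * dot K \<alpha> w"
  by (simp add: dot_def sum.distrib sum_distrib_left algebra_simps)

lemma dot_sum_right: "dot K \<alpha> (\<lambda>k. \<Sum>z\<in>Z. c z * z k) = (\<Sum>z\<in>Z. c z * dot K \<alpha> z)"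
proof -
  have "dot K \<alpha> (\<lambda>k. \<Sum>z\<in>Z. c z * z k) = (\<Sum>k\<in>K. \<Sum>z\<in>Z. c z * (\<alpha> k * z k))"
    by (simp add: dot_def sum_distrib_left algebra_simps)
  also have "\<dots> = (\<Sum>z\<in>Z. c z * dot K \<alpha> z)"
    by (subst sum.swap) (simp add: dot_def sum_distrib_left)
  finally show ?thesis .
qed

lemma dot_unit: "finite K \<Longrightarrow> k \<in> K \<Longrightarrow> dot K (\<lambda>j. if j = k then 1 else 0) v = v k"
  by (simp add: dot_def if_distrib [of "\<lambda>x. x * _"] cong: if_cong)

text \<open>Gaussian elimination over the rationals with denominators cleared: the multiplier
  \<open>m\<close> replaces division. The vectors of \<open>Z\<close> are added one at a time, and a
  functional that kills the old ones but not the new one is used to project along the new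
  one.\<close>

lemma integer_linear_alternative:
  assumes "finite K" "finite Z"
  shows "(\<exists>m::int. m > 0 \<and> (\<exists>p. \<forall>k\<in>K. m * x k = (\<Sum>z\<in>Z. p z * z k))) \<or>
    (\<exists>\<alpha>. (\<forall>z\<in>Z. dot K \<alpha> z = 0) \<and> dot K \<alpha> x \<noteq> 0)"
proof -
  have "(\<exists>m::int. m \<noteq> 0 \<and> (\<exists>p. \<forall>k\<in>K. m * x k = (\<Sum>z\<in>Z. p z * z k))) \<or>
    (\<exists>\<alpha>. (\<forall>z\<in>Z. dot K \<alpha> z = 0) \<and> dot K \<alpha> x \<noteq> 0)"
    using assms(2)
  proof (induction Z arbitrary: x rule: finite_induct)
    case empty
    show ?case
    proof (cases "\<forall>k\<in>K. x k = 0")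
      case True
      then show ?thesis by (auto intro!: exI [of _ 1])
    next
      case False
      then obtain k where k: "k \<in> K" "x k \<noteq> 0" by blast
      then have "dot K (\<lambda>j. if j = k then 1 else 0) x \<noteq> 0" using assms(1) by (simp add: dot_unit)
      then show ?thesis by blast
    qed
  next
    case (insert z Z)
    let ?span = "\<lambda>Z x. \<exists>m::int. m \<noteq> 0 \<and> (\<exists>p. \<forall>k\<in>K. m * x k = (\<Sum>z\<in>Z. p z * z k))"
    have mono: "?span (insert z Z) x" if "m \<noteq> 0" "\<forall>k\<in>K. m * x k = (\<Sum>z\<in>Z. p z * z k) + q * z k"
      for m p q
    proof -
      let ?p = "p(z := q)"
      have "\<forall>k\<in>K. m * x k = (\<Sum>z\<in>insert z Z. ?p z * z k)"
      proof
        fix k assume "k \<in> K"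
        have "(\<Sum>y\<in>insert z Z. ?p y * y k) = q * z k + (\<Sum>y\<in>Z. ?p y * y k)"
          using insert.hyps by simp
        also have "(\<Sum>y\<in>Z. ?p y * y k) = (\<Sum>y\<in>Z. p y * y k)"
          by (rule sum.cong) (use insert.hyps in auto)
        finally show "m * x k = (\<Sum>z\<in>insert z Z. ?p z * z k)" using that(2) \<open>k \<in> K\<close> by simp
      qed
      with that(1) show ?thesis by blast
    qed
    show ?case
    proof (cases "?span Z x")
      case True
      then obtain m p where "m \<noteq> 0" "\<forall>k\<in>K. m * x k = (\<Sum>z\<in>Z. p z * z k) + 0 * z k" by auto
      then show ?thesis using mono by blast
    next
      case False
      then obtain \<alpha> where \<alpha>: "\<forall>z\<in>Z. dot K \<alpha> z = 0" "dot K \<alpha> x \<noteq> 0"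
        using insert.IH by blast
      show ?thesis
      proof (cases "dot K \<alpha> z = 0")
        case True
        then show ?thesis using \<alpha> by blast
      next
        case nz: False
        \<comment> \<open>A multiple of \<open>x\<close>, shifted along \<open>z\<close> into the
          kernel of \<open>\<alpha>\<close>. If \<open>y\<close> is in the span of \<open>Z\<close>,
          one can solve for \<open>x\<close> since \<open>dot K \<alpha> z\<close> is not
          zero.\<close>
        define y where "y = (\<lambda>k. dot K \<alpha> z * x k + (- dot K \<alpha> x) * z k)"
        show ?thesis
        proof (cases "?span Z y")
          case True
          then obtain m p where m: "m \<noteq> 0" "\<forall>k\<in>K. m * y k = (\<Sum>z\<in>Z. p z * z k)" by blast
          have "\<forall>k\<in>K. (m * dot K \<alpha> z) * x k = (\<Sum>z\<in>Z. p z * z k) + (m * dot K \<alpha> x) * z k"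
            using m(2) by (simp add: y_def algebra_simps)
          then show ?thesis using mono [of "m * dot K \<alpha> z" p "m * dot K \<alpha> x"] m(1) nz by simp
        next
          case False
          then obtain \<beta> where \<beta>: "\<forall>z\<in>Z. dot K \<beta> z = 0" "dot K \<beta> y \<noteq> 0"
            using insert.IH by blast
          \<comment> \<open>A multiple of \<open>\<alpha>\<close> corrects \<open>\<beta>\<close> so
            that \<open>z\<close> is killed too; \<open>Z\<close> stays killed and the value at
            \<open>x\<close> is \<open>dot K \<beta> y\<close>.\<close>
          let ?\<gamma> = "\<lambda>k. dot K \<alpha> z * \<beta> k + (- dot K \<beta> z) * \<alpha> k"
          have "dot K ?\<gamma> x = dot K \<beta> y"
            unfolding dot_lincomb_left y_def dot_lincomb_right by simp
          then have "dot K ?\<gamma> x \<noteq> 0" using \<beta> by simp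
          moreover have "\<forall>w\<in>insert z Z. dot K ?\<gamma> w = 0"
            unfolding dot_lincomb_left using \<alpha> \<beta> by auto
          ultimately show ?thesis by blast
        qed
      qed
    qed
  qed
  then show ?thesis
  proof
    assume "\<exists>m::int. m \<noteq> 0 \<and> (\<exists>p. \<forall>k\<in>K. m * x k = (\<Sum>z\<in>Z. p z * z k))"
    then obtain m p where m: "m \<noteq> 0" "\<forall>k\<in>K. m * x k = (\<Sum>z\<in>Z. p z * z k)" by blast
    have "\<bar>m\<bar> > 0" using m by simp
    moreover have "\<forall>k\<in>K. \<bar>m\<bar> * x k = (\<Sum>z\<in>Z. (sgn m * p z) * z k)"
    proof
      fix k assume "k \<in> K"
      have "\<bar>m\<bar> * x k = sgn m * (m * x k)" by (simp add: abs_sgn)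
      also have "\<dots> = (\<Sum>z\<in>Z. (sgn m * p z) * z k)"
        using m(2) \<open>k \<in> K\<close> by (simp add: sum_distrib_left mult.assoc)
      finally show "\<bar>m\<bar> * x k = (\<Sum>z\<in>Z. (sgn m * p z) * z k)" .
    qed
    ultimately show ?thesis
      by (intro disjI1 exI [of _ "\<bar>m\<bar>"] conjI exI [of _ "\<lambda>z. sgn m * p z"])
  qed simp
qed

section \<open>Subtraction in finitely generated monoids\<close>

definition in_monoid :: "'k set \<Rightarrow> ('k \<Rightarrow> int) set \<Rightarrow> ('k \<Rightarrow> int) \<Rightarrow> bool" where
  "in_monoid K \<Gamma> v \<longleftrightarrow> (\<exists>a :: ('k \<Rightarrow> int) \<Rightarrow> nat. \<forall>k\<in>K. v k = (\<Sum>z\<in>\<Gamma>. int (a z) * z k))"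

lemma in_monoidI_int:
  assumes "\<And>z. z \<in> \<Gamma> \<Longrightarrow> p z \<ge> 0" "\<And>k. k \<in> K \<Longrightarrow> v k = (\<Sum>z\<in>\<Gamma>. p z * z k)"
  shows "in_monoid K \<Gamma> v"
  unfolding in_monoid_def using assms by (intro exI [of _ "\<lambda>z. nat (p z)"]) simp

lemma in_monoid_add:
  assumes "in_monoid K \<Gamma> v" "in_monoid K \<Gamma> w"
  shows "in_monoid K \<Gamma> (\<lambda>k. v k + w k)"
proof -
  from assms obtain a b where "\<forall>k\<in>K. v k = (\<Sum>z\<in>\<Gamma>. int (a z) * z k)"
    "\<forall>k\<in>K. w k = (\<Sum>z\<in>\<Gamma>. int (b z) * z k)" unfolding in_monoid_def by blast
  then show ?thesis
    by (intro in_monoidI_int [where p = "\<lambda>z. int (a z) + int (b z)"])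
      (auto simp: sum.distrib algebra_simps)
qed

text \<open>If \<open>x\<close> lies in the rational span of the generators that occur in \<open>v\<close> with a large
  coefficient, then \<open>v - x = (m - 1) x + (v - m x)\<close> shows that \<open>x\<close> may be subtracted;
  otherwise a functional separates \<open>x\<close> from this span and is bounded on \<open>v\<close>.\<close>

lemma subtract_or_near:
  fixes \<Gamma> Xs :: "('k \<Rightarrow> int) set"
  assumes fin: "finite K" "finite \<Gamma>" "finite Xs" and Xs: "\<And>x. x \<in> Xs \<Longrightarrow> in_monoid K \<Gamma> x"
  obtains A :: "('k \<Rightarrow> int) set" and B c :: int
  where "finite A"
    "\<And>v a x. x \<in> Xs \<Longrightarrow> (\<And>k. k \<in> K \<Longrightarrow> v k = (\<Sum>z\<in>\<Gamma>. int (a z) * z k)) \<Longrightarrow>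
       in_monoid K \<Gamma> (\<lambda>k. v k - x k) \<or>
       (\<exists>\<alpha>\<in>A. dot K \<alpha> x \<noteq> 0 \<and> \<bar>dot K \<alpha> v\<bar> \<le> B \<and> (\<forall>z\<in>\<Gamma>. int (a z) \<ge> c \<longrightarrow> dot K \<alpha> z = 0))"
proof -
  let ?sp = "\<lambda>Z x m p. m > 0 \<and> (\<forall>k\<in>K. m * x k = (\<Sum>z\<in>Z. p z * z k))"
  let ?sep = "\<lambda>Z x \<alpha>. (\<forall>z\<in>Z. dot K \<alpha> z = 0) \<and> dot K \<alpha> x \<noteq> 0"
  \<comment> \<open>These choices depend on \<open>Z\<close> and \<open>x\<close> alone. There are
    finitely many such pairs, so \<open>c\<close>, \<open>A\<close> and \<open>B\<close> below do
    not depend on \<open>v\<close>.\<close>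
  define m where "m Z x = (SOME m::int. \<exists>p. ?sp Z x m p)" for Z x
  define p where "p Z x = (SOME p. ?sp Z x (m Z x) p)" for Z x
  define \<alpha> where "\<alpha> Z x = (SOME \<alpha>. ?sep Z x \<alpha>)" for Z x
  have alt: "?sp Z x (m Z x) (p Z x) \<or> ?sep Z x (\<alpha> Z x)" if "Z \<subseteq> \<Gamma>" for Z x
  proof -
    have "finite Z" using that fin(2) finite_subset by blast
    from integer_linear_alternative [OF fin(1) this, of x] show ?thesis
    proof
      assume "\<exists>m::int. m > 0 \<and> (\<exists>p. \<forall>k\<in>K. m * x k = (\<Sum>z\<in>Z. p z * z k))"
      then have "\<exists>m. \<exists>p. ?sp Z x m p" by blast
      then have "\<exists>p. ?sp Z x (m Z x) p" unfolding m_def by (rule someI_ex)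
      then have "?sp Z x (m Z x) (p Z x)" unfolding p_def by (rule someI_ex)
      then show ?thesis ..
    next
      assume "\<exists>\<alpha>. ?sep Z x \<alpha>"
      then have "?sep Z x (\<alpha> Z x)" unfolding \<alpha>_def by (rule someI_ex)
      then show ?thesis ..
    qed
  qed
  define c where "c = (\<Sum>Z\<in>Pow \<Gamma>. \<Sum>x\<in>Xs. \<Sum>z\<in>\<Gamma>. \<bar>p Z x z\<bar>)"
  define A where "A = (\<lambda>(Z, x). \<alpha> Z x) ` (Pow \<Gamma> \<times> Xs)"
  \<comment> \<open>In \<open>dot K \<alpha> v\<close> the generators with coefficient at least
    \<open>c\<close> contribute nothing, each of the others at most \<open>c\<close> times its
    absolute value.\<close>
  define B where "B = (\<Sum>\<alpha>\<in>A. \<Sum>z\<in>\<Gamma>. c * \<bar>dot K \<alpha> z\<bar>)"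
  have finA: "finite A" using fin by (simp add: A_def)
  have c0: "c \<ge> 0" unfolding c_def by (intro sum_nonneg) auto
  have pc: "\<bar>p Z x z\<bar> \<le> c" if "Z \<subseteq> \<Gamma>" "x \<in> Xs" "z \<in> \<Gamma>" for Z x z
  proof -
    have "\<bar>p Z x z\<bar> \<le> (\<Sum>z\<in>\<Gamma>. \<bar>p Z x z\<bar>)"
      using that fin by (intro member_le_sum) auto
    also have "\<dots> \<le> (\<Sum>x\<in>Xs. \<Sum>z\<in>\<Gamma>. \<bar>p Z x z\<bar>)"
      using that fin by (intro member_le_sum [of x Xs "\<lambda>x. \<Sum>z\<in>\<Gamma>. \<bar>p Z x z\<bar>"]) (auto intro: sum_nonneg)
    also have "\<dots> \<le> c"
      unfolding c_def using that fin
      by (intro member_le_sum [of Z _ "\<lambda>Z. \<Sum>x\<in>Xs. \<Sum>z\<in>\<Gamma>. \<bar>p Z x z\<bar>"]) (auto intro!: sum_nonneg)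
    finally show ?thesis .
  qed
  show ?thesis
  proof (rule that [OF finA, of B c])
    fix v a x assume x: "x \<in> Xs" and v: "\<And>k. k \<in> K \<Longrightarrow> v k = (\<Sum>z\<in>\<Gamma>. int (a z) * z k)"
    define Z where "Z = {z \<in> \<Gamma>. int (a z) \<ge> c}"
    have Z: "Z \<subseteq> \<Gamma>" by (auto simp: Z_def)
    from alt [OF Z, of x]
    show "in_monoid K \<Gamma> (\<lambda>k. v k - x k) \<or>
       (\<exists>\<alpha>\<in>A. dot K \<alpha> x \<noteq> 0 \<and> \<bar>dot K \<alpha> v\<bar> \<le> B \<and> (\<forall>z\<in>\<Gamma>. int (a z) \<ge> c \<longrightarrow> dot K \<alpha> z = 0))"
    proof
      assume sp: "?sp Z x (m Z x) (p Z x)"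
      from Xs [OF x] obtain b where b: "\<And>k. k \<in> K \<Longrightarrow> x k = (\<Sum>z\<in>\<Gamma>. int (b z) * z k)"
        unfolding in_monoid_def by blast
      \<comment> \<open>Coefficients of v + (m - 1) x - m x. The middle term uses the representation
        of \<open>x\<close> in the monoid. The last one uses the relation \<open>p\<close>, which
        touches only coefficients that are at least \<open>c\<close> and hence stay
        nonnegative.\<close>
      let ?q = "\<lambda>z. int (a z) + (m Z x - 1) * int (b z) - (if z \<in> Z then p Z x z else 0)"
      have "in_monoid K \<Gamma> (\<lambda>k. v k - x k)"
      proof (rule in_monoidI_int [where p = ?q])
        fix z assume z: "z \<in> \<Gamma>"
        have "0 \<le> (m Z x - 1) * int (b z)" using sp by simp
        moreover have "int (a z) - (if z \<in> Z then p Z x z else 0) \<ge> 0"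
          using pc [OF Z x z] z by (auto simp: Z_def)
        ultimately show "?q z \<ge> 0" by linarith
      next
        fix k assume k: "k \<in> K"
        have pz: "(\<Sum>z\<in>\<Gamma>. (if z \<in> Z then p Z x z else 0) * z k) = (\<Sum>z\<in>Z. p Z x z * z k)"
          by (rule sum.mono_neutral_cong_right [OF fin(2) Z]) auto
        have "(\<Sum>z\<in>\<Gamma>. ?q z * z k) = (\<Sum>z\<in>\<Gamma>. int (a z) * z k)
            + (m Z x - 1) * (\<Sum>z\<in>\<Gamma>. int (b z) * z k)
            - (\<Sum>z\<in>\<Gamma>. (if z \<in> Z then p Z x z else 0) * z k)"
          unfolding left_diff_distrib distrib_right sum.distrib sum_subtractf sum_distrib_left mult.assoc ..
        also have "\<dots> = v k + (m Z x - 1) * x k - m Z x * x k"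
          unfolding pz using sp k v [OF k, symmetric] b [OF k, symmetric] by simp
        also have "\<dots> = v k - x k" by (simp add: algebra_simps)
        finally show "v k - x k = (\<Sum>z\<in>\<Gamma>. ?q z * z k)" ..
      qed
      then show ?thesis ..
    next
      assume \<alpha>: "(\<forall>z\<in>Z. dot K (\<alpha> Z x) z = 0) \<and> dot K (\<alpha> Z x) x \<noteq> 0"
      let ?\<alpha> = "\<alpha> Z x"
      have mem: "?\<alpha> \<in> A" using Z x by (auto simp: A_def)
      have "dot K ?\<alpha> v = dot K ?\<alpha> (\<lambda>k. \<Sum>z\<in>\<Gamma>. int (a z) * z k)"
        by (rule dot_cong) (simp add: v)
      then have "dot K ?\<alpha> v = (\<Sum>z\<in>\<Gamma>. int (a z) * dot K ?\<alpha> z)"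
        by (simp add: dot_sum_right)
      then have "\<bar>dot K ?\<alpha> v\<bar> \<le> (\<Sum>z\<in>\<Gamma>. \<bar>int (a z) * dot K ?\<alpha> z\<bar>)"
        by simp
      also have "\<dots> \<le> (\<Sum>z\<in>\<Gamma>. c * \<bar>dot K ?\<alpha> z\<bar>)"
      proof (rule sum_mono)
        fix z assume "z \<in> \<Gamma>"
        then show "\<bar>int (a z) * dot K ?\<alpha> z\<bar> \<le> c * \<bar>dot K ?\<alpha> z\<bar>"
          using \<alpha> by (cases "z \<in> Z") (auto simp: Z_def abs_mult intro: mult_right_mono)
      qed
      also have "\<dots> \<le> B"
        unfolding B_def using mem finA c0
        by (intro member_le_sum [of ?\<alpha> A "\<lambda>\<alpha>. \<Sum>z\<in>\<Gamma>. c * \<bar>dot K \<alpha> z\<bar>"]) (auto intro!: sum_nonneg)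
      finally have "\<bar>dot K ?\<alpha> v\<bar> \<le> B" .
      then show ?thesis using mem \<alpha> by (auto simp: Z_def)
    qed
  qed
qed

text \<open>That is, \<open>N n = O(n ^ (e - 1))\<close>; for \<open>e = 0\<close> it forces \<open>N n = 0\<close> for large \<open>n\<close>.\<close>

definition small :: "nat \<Rightarrow> (nat \<Rightarrow> nat) \<Rightarrow> bool" where
  "small e N \<longleftrightarrow> (\<exists>M. \<forall>\<^sub>F n in sequentially. real (N n) * real n \<le> M * real n ^ e)"

lemma small_sum:
  assumes "finite A" "\<And>i. i \<in> A \<Longrightarrow> small e (N i)"
  shows "small e (\<lambda>n. \<Sum>i\<in>A. N i n)"
  using assms
proof (induction A rule: finite_induct)
  case empty
  show ?case unfolding small_def by (intro exI [of _ 0]) simp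
next
  case (insert i A)
  from insert.prems [of i] obtain M where
    M: "\<forall>\<^sub>F n in sequentially. real (N i n) * real n \<le> M * real n ^ e"
    unfolding small_def by auto
  have "small e (\<lambda>n. \<Sum>i\<in>A. N i n)" using insert by simp
  then obtain M' where
    M': "\<forall>\<^sub>F n in sequentially. real (\<Sum>i\<in>A. N i n) * real n \<le> M' * real n ^ e"
    unfolding small_def by auto
  from M M' have "\<forall>\<^sub>F n in sequentially. real (\<Sum>i\<in>insert i A. N i n) * real n \<le> (M + M') * real n ^ e"
    by eventually_elim (use insert.hyps in \<open>simp add: algebra_simps\<close>)
  then show ?case unfolding small_def by blast
qed

lemma inj_on_restrict_support:
  "inj_on (\<lambda>v. restrict v K) {v. \<forall>k. k \<notin> K \<longrightarrow> v k = (0::int)}"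
proof (rule inj_onI, rule ext)
  fix v w k
  assume v: "v \<in> {v. \<forall>k. k \<notin> K \<longrightarrow> v k = (0::int)}" and w: "w \<in> {v. \<forall>k. k \<notin> K \<longrightarrow> v k = (0::int)}"
    and eq: "restrict v K = restrict w K"
  show "v k = w k" using fun_cong [OF eq, of k] v w by (cases "k \<in> K") auto
qed

text \<open>The hypotheses on \<open>x\<close> and \<open>y\<close> make \<open>\<alpha>\<close> and
  \<open>\<beta>\<close> linearly independent. If they stay independent off the level coordinate,
  the level and the two equations fix three coordinates, and card K - 3 remain free. Otherwise some
  combination sees the level only, so the equations allow at most one level.\<close>

lemma small_card_two_functionals:
  fixes K :: "'k set" and C :: nat
  assumes fin: "finite K" and \<kappa>: "\<kappa> \<in> K"
    and x: "dot K \<alpha> x = 0" "dot K \<beta> x \<noteq> 0" and y: "dot K \<alpha> y \<noteq> 0"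
  shows "small (card K - 2) (\<lambda>n. card {v. (\<forall>k. k \<notin> K \<longrightarrow> v k = 0) \<and> v \<kappa> = int n \<and>
    (\<forall>k\<in>K. \<bar>v k\<bar> \<le> int (C * n)) \<and> dot K \<alpha> v = p \<and> dot K \<beta> v = q})"
    (is "small _ (\<lambda>n. card (?N n))")
proof -
  let ?K = "K - {\<kappa>}"
  show ?thesis
  proof (cases "\<exists>i\<in>?K. \<exists>j\<in>?K. \<alpha> i * \<beta> j \<noteq> \<alpha> j * \<beta> i")
    case True
    then obtain i j where ij: "i \<in> ?K" "j \<in> ?K" "\<alpha> i * \<beta> j \<noteq> \<alpha> j * \<beta> i" by blast
    then have ne: "i \<noteq> j" by auto
    let ?L = "?K - {i, j}"
    have cK: "card K = card ?L + 3"
    proof -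
      have "card {\<kappa>, i, j} = 3" using ij ne by auto
      moreover have "?L = K - {\<kappa>, i, j}" by auto
      moreover have "{\<kappa>, i, j} \<subseteq> K" using ij \<kappa> by auto
      ultimately show ?thesis using card_Diff_subset [of "{\<kappa>, i, j}" K] card_mono [OF fin, of "{\<kappa>, i, j}"]
        by simp
    qed
    have bound: "card (?N n) \<le> (2 * C * n + 1) ^ card ?L" for n
    proof -
      let ?P = "PiE ?L (\<lambda>_. {- int (C * n)..int (C * n)})"
      have finL: "finite ?L" using fin by simp
      have "inj_on (\<lambda>v. restrict v ?L) (?N n)"
      proof (rule inj_onI)
        fix v w assume v: "v \<in> ?N n" and w: "w \<in> ?N n" and eq: "restrict v ?L = restrict w ?L"
        let ?d = "\<lambda>k. v k - w k"
        have d0: "?d k = 0" if "k \<noteq> i" "k \<noteq> j" for k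
        proof (cases "k \<in> ?L")
          case True
          then show ?thesis using fun_cong [OF eq, of k] by simp
        next
          case False
          then show ?thesis using that v w by (cases "k \<in> K") auto
        qed
        have sub: "dot K \<gamma> ?d = \<gamma> i * ?d i + \<gamma> j * ?d j" for \<gamma>
        proof -
          have "dot K \<gamma> ?d = (\<Sum>k\<in>{i, j}. \<gamma> k * ?d k)"
            unfolding dot_def by (rule sum.mono_neutral_right) (use ij fin d0 in auto)
          then show ?thesis using ne by simp
        qed
        have 1: "\<alpha> i * ?d i + \<alpha> j * ?d j = 0" and 2: "\<beta> i * ?d i + \<beta> j * ?d j = 0"
          using v w by (simp_all add: sub [symmetric] dot_diff_right)
        \<comment> \<open>Cramer's rule: the minor for \<open>i\<close> and \<open>j\<close> is not
          zero.\<close>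
        have "(\<alpha> i * \<beta> j - \<alpha> j * \<beta> i) * ?d i
          = \<beta> j * (\<alpha> i * ?d i + \<alpha> j * ?d j) - \<alpha> j * (\<beta> i * ?d i + \<beta> j * ?d j)"
          by (simp add: algebra_simps)
        then have di: "?d i = 0" unfolding 1 2 using ij(3) by simp
        have "(\<alpha> i * \<beta> j - \<alpha> j * \<beta> i) * ?d j
          = \<alpha> i * (\<beta> i * ?d i + \<beta> j * ?d j) - \<beta> i * (\<alpha> i * ?d i + \<alpha> j * ?d j)"
          by (simp add: algebra_simps)
        then have dj: "?d j = 0" unfolding 1 2 using ij(3) by simp
        show "v = w" using d0 di dj by (metis eq_iff_diff_eq_0 ext)
      qed
      moreover have "(\<lambda>v. restrict v ?L) ` ?N n \<subseteq> ?P"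
        by (rule image_subsetI) (force simp: PiE_def Pi_def abs_le_iff)
      moreover have "finite ?P" using finL by (intro finite_PiE) auto
      ultimately have "card (?N n) \<le> card ?P" by (rule card_inj_on_le)
      also have "\<dots> = nat (2 * int (C * n) + 1) ^ card ?L"
        using finL by (simp add: card_PiE)
      also have "nat (2 * int (C * n) + 1) = 2 * C * n + 1"
        by (simp add: nat_eq_iff)
      finally show ?thesis .
    qed
    have "real (card (?N n)) * real n \<le> real (2 * C + 1) ^ card ?L * real n ^ (card K - 2)"
      if "n \<ge> 1" for n
    proof -
      have "real (card (?N n)) \<le> real (2 * C * n + 1) ^ card ?L"
        using of_nat_mono [OF bound [of n], where 'a = real] by (simp only: of_nat_power)
      also have "\<dots> \<le> (real (2 * C + 1) * real n) ^ card ?L"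
        by (rule power_mono) (use that in \<open>auto simp: algebra_simps\<close>)
      finally have "real (card (?N n)) * real n \<le> (real (2 * C + 1) * real n) ^ card ?L * real n"
        by (rule mult_right_mono) simp
      also have "\<dots> = real (2 * C + 1) ^ card ?L * real n ^ (card K - 2)"
        by (simp add: cK power_mult_distrib)
      finally show ?thesis .
    qed
    then show ?thesis unfolding small_def eventually_sequentially by blast
  next
    case False
    then have min0: "\<alpha> i * \<beta> j = \<alpha> j * \<beta> i" if "i \<in> ?K" "j \<in> ?K" for i j
      using that by blast
    obtain s t where st: "s \<noteq> 0 \<or> t \<noteq> 0" "\<And>k. k \<in> ?K \<Longrightarrow> s * \<alpha> k + t * \<beta> k = 0"
    proof (cases "\<forall>k\<in>?K. \<alpha> k = 0")
      case True
      then show ?thesis using that [of 1 0] by simp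
    next
      case False
      then obtain i where "i \<in> ?K" "\<alpha> i \<noteq> 0" by blast
      then show ?thesis using that [of "\<beta> i" "- \<alpha> i"] min0 [of i] by (simp add: algebra_simps)
    qed
    let ?\<gamma> = "\<lambda>k. s * \<alpha> k + t * \<beta> k"
    have \<gamma>: "dot K ?\<gamma> v = ?\<gamma> \<kappa> * v \<kappa>" for v
    proof -
      have "dot K ?\<gamma> v = (\<Sum>k\<in>{\<kappa>}. ?\<gamma> k * v k)"
        unfolding dot_def by (rule sum.mono_neutral_right) (use fin \<kappa> st in auto)
      then show ?thesis by simp
    qed
    \<comment> \<open>A combination that vanishes at \<open>\<kappa>\<close> too would be a linear
      relation between \<open>\<alpha>\<close> and \<open>\<beta>\<close>; evaluation at
      \<open>x\<close> and then at \<open>y\<close> excludes this.\<close>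
    have \<gamma>0: "?\<gamma> \<kappa> \<noteq> 0"
    proof
      assume "?\<gamma> \<kappa> = 0"
      then have 0: "s * dot K \<alpha> v + t * dot K \<beta> v = 0" for v
        using \<gamma> [of v] unfolding dot_lincomb_left by simp
      from 0 [of x] x have "t = 0" by simp
      with 0 [of y] y have "s = 0" by simp
      with \<open>t = 0\<close> st show False by simp
    qed
    have empty: "card (?N n) = 0" if "int n > \<bar>s * p + t * q\<bar>" for n
    proof -
      have "?N n = {}"
      proof (rule ccontr)
        assume "?N n \<noteq> {}"
        then obtain v where v: "v \<in> ?N n" by blast
        then have "?\<gamma> \<kappa> * int n = s * p + t * q"
          using \<gamma> [of v] unfolding dot_lincomb_left by simp
        then have "\<bar>?\<gamma> \<kappa> * int n\<bar> = \<bar>s * p + t * q\<bar>" by (rule arg_cong)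
        then have "\<bar>s * p + t * q\<bar> = \<bar>?\<gamma> \<kappa>\<bar> * int n" by (simp only: abs_mult abs_of_nat)
        moreover have "1 * int n \<le> \<bar>?\<gamma> \<kappa>\<bar> * int n" using \<gamma>0 by (intro mult_right_mono) auto
        ultimately show False using that by linarith
      qed
      then show ?thesis by (simp only: card.empty)
    qed
    have "real (card (?N n)) * real n \<le> 0 * real n ^ (card K - 2)"
      if "n \<ge> Suc (nat \<bar>s * p + t * q\<bar>)" for n
    proof -
      have "int n > \<bar>s * p + t * q\<bar>" using that by linarith
      then show ?thesis using empty by simp
    qed
    then show ?thesis unfolding small_def eventually_sequentially by blast
  qed
qed

text \<open>The coordinate \<open>\<kappa>\<close> is the level. Vanishing off \<open>K\<close>
  makes a point determined by its coordinates in \<open>K\<close>, so that bounded levels are finite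
  and can be counted.\<close>

definition cone_level ::
    "'k set \<Rightarrow> 'k \<Rightarrow> ('k \<Rightarrow> int) set \<Rightarrow> ('k \<Rightarrow> int) set set \<Rightarrow> nat \<Rightarrow> ('k \<Rightarrow> int) set" where
  "cone_level K \<kappa> Hs \<Gamma>s n = {v. (\<forall>k. k \<notin> K \<longrightarrow> v k = 0) \<and> v \<kappa> = int n \<and>
     (\<forall>h\<in>Hs. dot K h v \<ge> 0) \<and> (\<forall>\<Gamma>\<in>\<Gamma>s. in_monoid K \<Gamma> v)}"

lemma cone_level_add:
  "v \<in> cone_level K \<kappa> Hs \<Gamma>s m \<Longrightarrow> w \<in> cone_level K \<kappa> Hs \<Gamma>s n \<Longrightarrow>
    (\<lambda>k. v k + w k) \<in> cone_level K \<kappa> Hs \<Gamma>s (m + n)"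
  by (auto simp: cone_level_def dot_add_right intro: in_monoid_add)

text \<open>A point \<open>v\<close> from which \<open>x\<close> cannot be subtracted is near a hyperplane that contains some
  element of level one. Near two different hyperplanes there are few points; near only one, an
  element of this hyperplane can be subtracted.\<close>

lemma near_hyperplane:
  fixes K :: "'k set" and \<kappa> :: 'k and Hs and \<Gamma>s
  defines "T \<equiv> cone_level K \<kappa> Hs \<Gamma>s"
  assumes fin: "finite K" "finite Hs" "finite \<Gamma>s" "\<And>\<Gamma>. \<Gamma> \<in> \<Gamma>s \<Longrightarrow> finite \<Gamma>" and \<kappa>: "\<kappa> \<in> K"
    and finT: "finite (T 1)"
    and Hs: "\<And>h B. h \<in> Hs \<Longrightarrow> \<exists>n0. \<forall>n\<ge>n0. \<forall>v\<in>T n. dot K h v \<le> B \<longrightarrow> (\<exists>x\<in>T 1. dot K h x = 0)"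
    and \<Gamma>s: "\<And>\<Gamma> z. \<Gamma> \<in> \<Gamma>s \<Longrightarrow> z \<in> \<Gamma> \<Longrightarrow> z \<kappa> = 0 \<or> z \<kappa> = 1 \<and> z \<in> T 1"
  obtains A :: "('k \<Rightarrow> int) set" and B :: int and n0 :: nat
  where "finite A"
    "\<And>\<alpha>. \<alpha> \<in> A \<Longrightarrow> (\<exists>x\<in>T 1. dot K \<alpha> x = 0) \<and> (\<exists>x. dot K \<alpha> x \<noteq> 0)"
    "\<And>n v x. n \<ge> n0 \<Longrightarrow> v \<in> T (Suc n) \<Longrightarrow> x \<in> T 1 \<Longrightarrow>
      (\<lambda>k. v k - x k) \<in> T n \<or> (\<exists>\<alpha>\<in>A. dot K \<alpha> x \<noteq> 0 \<and> \<bar>dot K \<alpha> v\<bar> \<le> B)"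
proof -
  have "\<forall>\<Gamma>\<in>\<Gamma>s. \<exists>A B c. finite A \<and> (\<forall>v a x. x \<in> T 1 \<longrightarrow> (\<forall>k\<in>K. v k = (\<Sum>z\<in>\<Gamma>. int (a z) * z k)) \<longrightarrow>
       in_monoid K \<Gamma> (\<lambda>k. v k - x k) \<or>
       (\<exists>\<alpha>\<in>A. dot K \<alpha> x \<noteq> 0 \<and> \<bar>dot K \<alpha> v\<bar> \<le> B \<and> (\<forall>z\<in>\<Gamma>. int (a z) \<ge> c \<longrightarrow> dot K \<alpha> z = 0)))"
    (is "\<forall>\<Gamma>\<in>\<Gamma>s. \<exists>A B c. ?Q \<Gamma> A B c")
  proof
    fix \<Gamma> assume \<Gamma>: "\<Gamma> \<in> \<Gamma>s"
    have "in_monoid K \<Gamma> x" if "x \<in> T 1" for x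
      using that \<Gamma> by (auto simp: T_def cone_level_def)
    from subtract_or_near [OF fin(1) fin(4) [OF \<Gamma>] finT this]
    obtain A B c where 1: "finite A" "\<And>v a x. x \<in> T 1 \<Longrightarrow> (\<And>k. k \<in> K \<Longrightarrow> v k = (\<Sum>z\<in>\<Gamma>. int (a z) * z k)) \<Longrightarrow>
       in_monoid K \<Gamma> (\<lambda>k. v k - x k) \<or>
       (\<exists>\<alpha>\<in>A. dot K \<alpha> x \<noteq> 0 \<and> \<bar>dot K \<alpha> v\<bar> \<le> B \<and> (\<forall>z\<in>\<Gamma>. int (a z) \<ge> c \<longrightarrow> dot K \<alpha> z = 0))"
      by blast
    then show "\<exists>A B c. ?Q \<Gamma> A B c" 
      by (intro exI [of _ A] exI [of _ B] exI [of _ c] conjI 1(1) allI impI)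
        (rule 1(2), assumption, erule bspec, assumption)
  qed
  from bchoice [OF this] obtain A where "\<forall>\<Gamma>\<in>\<Gamma>s. \<exists>B c. ?Q \<Gamma> (A \<Gamma>) B c" ..
  from bchoice [OF this] obtain B where "\<forall>\<Gamma>\<in>\<Gamma>s. \<exists>c. ?Q \<Gamma> (A \<Gamma>) (B \<Gamma>) c" ..
  from bchoice [OF this] obtain c where "\<forall>\<Gamma>\<in>\<Gamma>s. ?Q \<Gamma> (A \<Gamma>) (B \<Gamma>) (c \<Gamma>)" ..
  then have AB: "?Q \<Gamma> (A \<Gamma>) (B \<Gamma>) (c \<Gamma>)" if "\<Gamma> \<in> \<Gamma>s" for \<Gamma> using that by (rule bspec)
  define Bh where "Bh = (\<Sum>h\<in>Hs. \<Sum>x\<in>T 1. \<bar>dot K h x\<bar>)"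
  define BB where "BB = Bh + (\<Sum>\<Gamma>\<in>\<Gamma>s. \<bar>B \<Gamma>\<bar>)"
  have Bh0: "Bh \<ge> 0" unfolding Bh_def by (intro sum_nonneg) auto
  have BBh: "Bh \<le> BB" unfolding BB_def by (simp add: sum_nonneg)
  have BB\<Gamma>: "B \<Gamma> \<le> BB" if "\<Gamma> \<in> \<Gamma>s" for \<Gamma>
  proof -
    have "\<bar>B \<Gamma>\<bar> \<le> (\<Sum>\<Gamma>\<in>\<Gamma>s. \<bar>B \<Gamma>\<bar>)" using that fin by (intro member_le_sum) auto
    then show ?thesis using Bh0 by (simp add: BB_def)
  qed
  \<comment> \<open>Only functionals with a zero among the points of level one are kept. Below, a
    large level forces every functional that obstructs a subtraction into this set.\<close>
  define AA where "AA = {\<alpha> \<in> Hs \<union> (\<Union>\<Gamma>\<in>\<Gamma>s. A \<Gamma>). (\<exists>x\<in>T 1. dot K \<alpha> x = 0) \<and> (\<exists>x. dot K \<alpha> x \<noteq> 0)}"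
  have finAA: "finite AA"
    unfolding AA_def using fin AB by (intro finite_Collect_conjI) auto
  from Hs have "\<forall>h\<in>Hs. \<exists>n0. \<forall>n\<ge>n0. \<forall>v\<in>T n. dot K h v \<le> BB \<longrightarrow> (\<exists>x\<in>T 1. dot K h x = 0)" by blast
  from bchoice [OF this] obtain nh
    where "\<forall>h\<in>Hs. \<forall>n\<ge>nh h. \<forall>v\<in>T n. dot K h v \<le> BB \<longrightarrow> (\<exists>x\<in>T 1. dot K h x = 0)" ..
  then have nh: "\<And>h n v. h \<in> Hs \<Longrightarrow> n \<ge> nh h \<Longrightarrow> v \<in> T n \<Longrightarrow> dot K h v \<le> BB \<Longrightarrow>
      \<exists>x\<in>T 1. dot K h x = 0" by blast
  \<comment> \<open>The first sum passes all thresholds \<open>nh\<close>. The second makes the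
    level too large to be reached if all generators of level one had coefficients below
    \<open>c \<Gamma>\<close>.\<close>
  define n0 where "n0 = (\<Sum>h\<in>Hs. nh h) + (\<Sum>\<Gamma>\<in>\<Gamma>s. nat \<bar>c \<Gamma>\<bar> * card \<Gamma>)"
  show ?thesis
  proof (rule that [OF finAA, of n0 BB])
    show "(\<exists>x\<in>T 1. dot K \<alpha> x = 0) \<and> (\<exists>x. dot K \<alpha> x \<noteq> 0)" if "\<alpha> \<in> AA" for \<alpha>
      using that by (auto simp: AA_def)
  next
    fix n v x assume n: "n \<ge> n0" and v: "v \<in> T (Suc n)" and x: "x \<in> T 1"
    show "(\<lambda>k. v k - x k) \<in> T n \<or> (\<exists>\<alpha>\<in>AA. dot K \<alpha> x \<noteq> 0 \<and> \<bar>dot K \<alpha> v\<bar> \<le> BB)"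
    proof (rule disjCI)
      assume neg: "\<not> (\<exists>\<alpha>\<in>AA. dot K \<alpha> x \<noteq> 0 \<and> \<bar>dot K \<alpha> v\<bar> \<le> BB)"
      have "dot K h (\<lambda>k. v k - x k) \<ge> 0" if h: "h \<in> Hs" for h
      proof (rule ccontr)
        assume "\<not> dot K h (\<lambda>k. v k - x k) \<ge> 0"
        then have lt: "dot K h v < dot K h x" by (simp add: dot_diff_right)
        have v0: "dot K h v \<ge> 0" using v h by (auto simp: T_def cone_level_def)
        have "\<bar>dot K h x\<bar> \<le> (\<Sum>x\<in>T 1. \<bar>dot K h x\<bar>)" using x finT by (intro member_le_sum) auto
        also have "\<dots> \<le> Bh" unfolding Bh_def
          using h fin by (intro member_le_sum [of h Hs "\<lambda>h. \<Sum>x\<in>T 1. \<bar>dot K h x\<bar>"]) (auto intro: sum_nonneg)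
        finally have le: "dot K h v \<le> BB" using lt BBh by linarith
        have "nh h \<le> (\<Sum>h\<in>Hs. nh h)" using h fin by (intro member_le_sum) auto
        then have "nh h \<le> Suc n" using n by (simp add: n0_def)
        moreover have "\<exists>x. dot K h x \<noteq> 0" using lt v0 by (intro exI [of _ x]) auto
        ultimately have "h \<in> AA" using h nh [OF h _ v le] by (simp add: AA_def)
        moreover have "dot K h x \<noteq> 0" "\<bar>dot K h v\<bar> \<le> BB" using lt v0 le by auto
        ultimately show False using neg by blast
      qed
      moreover have "in_monoid K \<Gamma> (\<lambda>k. v k - x k)" if \<Gamma>: "\<Gamma> \<in> \<Gamma>s" for \<Gamma>
      proof (rule ccontr)
        assume not: "\<not> in_monoid K \<Gamma> (\<lambda>k. v k - x k)"
        from v \<Gamma> have "in_monoid K \<Gamma> v" by (simp add: T_def cone_level_def)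
        then obtain a where a: "\<forall>k\<in>K. v k = (\<Sum>z\<in>\<Gamma>. int (a z) * z k)" unfolding in_monoid_def ..
        from conjunct2 [OF AB [OF \<Gamma>], THEN spec [of _ v], THEN spec [of _ a], THEN spec [of _ x],
          THEN mp, OF x, THEN mp, OF a] not
        obtain \<alpha> where \<alpha>: "\<alpha> \<in> A \<Gamma>" "dot K \<alpha> x \<noteq> 0" "\<bar>dot K \<alpha> v\<bar> \<le> B \<Gamma>"
          "\<forall>z\<in>\<Gamma>. int (a z) \<ge> c \<Gamma> \<longrightarrow> dot K \<alpha> z = 0" by auto
        \<comment> \<open>A generator of level one with a large coefficient is killed by
          \<open>\<alpha>\<close> and lies in \<open>T 1\<close>: it is the required point on the
          hyperplane.\<close>
        have "\<exists>z\<in>\<Gamma>. z \<kappa> = 1 \<and> int (a z) \<ge> c \<Gamma>"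
        proof (rule ccontr)
          assume no: "\<not> (\<exists>z\<in>\<Gamma>. z \<kappa> = 1 \<and> int (a z) \<ge> c \<Gamma>)"
          have "int (Suc n) = (\<Sum>z\<in>\<Gamma>. int (a z) * z \<kappa>)"
            using a \<kappa> v by (auto simp: T_def cone_level_def)
          also have "\<dots> \<le> (\<Sum>z\<in>\<Gamma>. \<bar>c \<Gamma>\<bar>)"
          proof (rule sum_mono)
            fix z assume "z \<in> \<Gamma>"
            then show "int (a z) * z \<kappa> \<le> \<bar>c \<Gamma>\<bar>" using \<Gamma>s [OF \<Gamma>, of z] no by force
          qed
          also have "\<dots> = int (nat \<bar>c \<Gamma>\<bar> * card \<Gamma>)" by simp
          also have "\<dots> \<le> int (\<Sum>\<Gamma>\<in>\<Gamma>s. nat \<bar>c \<Gamma>\<bar> * card \<Gamma>)"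
            using \<Gamma> fin by (intro of_nat_mono member_le_sum) auto
          also have "\<dots> \<le> int n" using n by (intro of_nat_mono) (simp add: n0_def)
          finally show False by simp
        qed
        then obtain z where z: "z \<in> \<Gamma>" "z \<kappa> = 1" "int (a z) \<ge> c \<Gamma>" by blast
        then have "z \<in> T 1" "dot K \<alpha> z = 0" using \<Gamma>s [OF \<Gamma>, of z] \<alpha>(4) by auto
        then have "\<alpha> \<in> AA" using \<alpha>(1,2) \<Gamma> unfolding AA_def by blast
        moreover have "\<bar>dot K \<alpha> v\<bar> \<le> BB" using \<alpha>(3) BB\<Gamma> [OF \<Gamma>] by linarith
        ultimately show False using neg \<alpha>(2) by blast
      qed
      ultimately show "(\<lambda>k. v k - x k) \<in> T n"
        using v x unfolding T_def cone_level_def by auto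
    qed
  qed
qed

theorem second_difference_cone_level:
  fixes K :: "'k set" and \<kappa> :: 'k and Hs and \<Gamma>s and C :: nat
  defines "T \<equiv> cone_level K \<kappa> Hs \<Gamma>s"
  assumes fin: "finite K" "finite Hs" "finite \<Gamma>s" "\<And>\<Gamma>. \<Gamma> \<in> \<Gamma>s \<Longrightarrow> finite \<Gamma>" and \<kappa>: "\<kappa> \<in> K"
    and bounded: "\<And>n v k. v \<in> T n \<Longrightarrow> k \<in> K \<Longrightarrow> \<bar>v k\<bar> \<le> int (C * n)"
    and ne: "T 1 \<noteq> {}"
    and Hs: "\<And>h B. h \<in> Hs \<Longrightarrow> \<exists>n0. \<forall>n\<ge>n0. \<forall>v\<in>T n. dot K h v \<le> B \<longrightarrow> (\<exists>x\<in>T 1. dot K h x = 0)"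
    and \<Gamma>s: "\<And>\<Gamma> z. \<Gamma> \<in> \<Gamma>s \<Longrightarrow> z \<in> \<Gamma> \<Longrightarrow> z \<kappa> = 0 \<or> z \<kappa> = 1 \<and> z \<in> T 1"
  obtains b where "small (card K - 2) b"
    "\<forall>\<^sub>F n in sequentially. card (T (n + 2)) + card (T n) \<le> 2 * card (T (n + 1)) + b (n + 2)"
proof -
  have finT: "finite (T n)" for n
  proof -
    let ?P = "PiE K (\<lambda>_. {- int (C * n)..int (C * n)})"
    have "inj_on (\<lambda>v. restrict v K) (T n)"
      by (rule inj_on_subset [OF inj_on_restrict_support]) (auto simp: T_def cone_level_def)
    moreover have "(\<lambda>v. restrict v K) ` T n \<subseteq> ?P"
      using bounded by (intro image_subsetI) (force simp: PiE_def Pi_def abs_le_iff)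
    moreover have "finite ?P" using fin by (intro finite_PiE) auto
    ultimately show ?thesis by (rule inj_on_finite)
  qed
  obtain A B n0 where finA: "finite A"
    and A: "\<And>\<alpha>. \<alpha> \<in> A \<Longrightarrow> (\<exists>x\<in>T 1. dot K \<alpha> x = 0) \<and> (\<exists>x. dot K \<alpha> x \<noteq> 0)"
    and near: "\<And>n v x. n \<ge> n0 \<Longrightarrow> v \<in> T (Suc n) \<Longrightarrow> x \<in> T 1 \<Longrightarrow>
      (\<lambda>k. v k - x k) \<in> T n \<or> (\<exists>\<alpha>\<in>A. dot K \<alpha> x \<noteq> 0 \<and> \<bar>dot K \<alpha> v\<bar> \<le> B)"
    apply (rule near_hyperplane [OF fin(1-3) _ \<kappa>, folded T_def])
        apply (rule fin(4), assumption)
       apply (rule finT)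
      apply (rule Hs, assumption)
     apply (rule \<Gamma>s, assumption, assumption)
    apply (rule that; assumption)
    done
  \<comment> \<open>Two points with the same image under the injection below differ by a difference
    of two points of level one; \<open>B'\<close> absorbs the resulting change in the value of a
    functional.\<close>
  define B' where "B' = \<bar>B\<bar> + (\<Sum>\<alpha>\<in>A. \<Sum>x\<in>T 1. 2 * \<bar>dot K \<alpha> x\<bar>)"
  have B': "\<bar>dot K \<alpha> (\<lambda>k. v k + x k - y k)\<bar> \<le> B'"
    if "\<alpha> \<in> A" "x \<in> T 1" "y \<in> T 1" "\<bar>dot K \<alpha> v\<bar> \<le> B" for \<alpha> v x y
  proof -
    have *: "2 * \<bar>dot K \<alpha> x\<bar> \<le> B' - \<bar>B\<bar>" if x: "x \<in> T 1" for x
    proof -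
      have "2 * \<bar>dot K \<alpha> x\<bar> \<le> (\<Sum>x\<in>T 1. 2 * \<bar>dot K \<alpha> x\<bar>)"
        using x finT by (intro member_le_sum) auto
      also have "\<dots> \<le> (\<Sum>\<alpha>\<in>A. \<Sum>x\<in>T 1. 2 * \<bar>dot K \<alpha> x\<bar>)"
        using \<open>\<alpha> \<in> A\<close> finA
        by (intro member_le_sum [of \<alpha> A "\<lambda>\<alpha>. \<Sum>x\<in>T 1. 2 * \<bar>dot K \<alpha> x\<bar>"]) (auto intro: sum_nonneg)
      also have "\<dots> = B' - \<bar>B\<bar>" by (simp add: B'_def)
      finally show ?thesis .
    qed
    show ?thesis using * [OF that(2)] * [OF that(3)] that(4)
      by (simp add: dot_diff_right dot_add_right)
  qed
  have B'0: "\<bar>B\<bar> \<le> B'" unfolding B'_def by (simp add: sum_nonneg)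
  let ?N = "\<lambda>\<alpha> \<beta> p q n. {v. (\<forall>k. k \<notin> K \<longrightarrow> v k = 0) \<and> v \<kappa> = int n \<and>
    (\<forall>k\<in>K. \<bar>v k\<bar> \<le> int (C * n)) \<and> dot K \<alpha> v = p \<and> dot K \<beta> v = q}"
  \<comment> \<open>Hyperplanes count as different only if they contain different points of level
    one. Then \<open>\<alpha>\<close> and \<open>\<beta>\<close> are independent and the points near
    both are few.\<close>
  define PP where "PP = {(\<alpha>, \<beta>) \<in> A \<times> A. \<exists>x\<in>T 1. dot K \<alpha> x = 0 \<and> dot K \<beta> x \<noteq> 0}"
  define I where "I = PP \<times> ({-B'..B'} \<times> {-B'..B'})"
  define F where "F = (\<lambda>((\<alpha>, \<beta>), (p, q)) n. card (?N \<alpha> \<beta> p q n))"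
  define b where "b n = (\<Sum>i\<in>I. F i n)" for n
  have finPP: "finite PP" unfolding PP_def by (rule finite_subset [of _ "A \<times> A"]) (use finA in auto)
  have finI: "finite I" using finPP by (simp add: I_def)
  have small: "small (card K - 2) b"
    unfolding b_def
  proof (rule small_sum [OF finI])
    fix i assume "i \<in> I"
    then obtain \<alpha> \<beta> p q where i: "i = ((\<alpha>, \<beta>), (p, q))" "(\<alpha>, \<beta>) \<in> PP" by (auto simp: I_def)
    then have "\<alpha> \<in> A" "\<exists>x\<in>T 1. dot K \<alpha> x = 0 \<and> dot K \<beta> x \<noteq> 0" by (auto simp: PP_def)
    then obtain x y where "dot K \<alpha> x = 0" "dot K \<beta> x \<noteq> 0" "dot K \<alpha> y \<noteq> 0"
      using A [of \<alpha>] by blast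
    from small_card_two_functionals [OF fin(1) \<kappa> this, of C p q]
    show "small (card K - 2) (F i)"
      by (simp add: i F_def)
  qed
  define G where "G = (\<lambda>((\<alpha>, \<beta>), (p, q)) n. ?N \<alpha> \<beta> p q n \<inter> T n)"
  define bad where "bad n = (\<Union>i\<in>I. G i n)" for n
  have cbad: "card (bad n) \<le> b n" for n
  proof -
    have "card (bad n) \<le> (\<Sum>i\<in>I. card (G i n))"
      unfolding bad_def by (rule card_UN_le [OF finI])
    also have "\<dots> \<le> b n"
      unfolding b_def
    proof (rule sum_mono)
      fix i assume "i \<in> I"
      obtain \<alpha> \<beta> p q where i: "i = ((\<alpha>, \<beta>), (p, q))" by (metis surj_pair)
      let ?P = "PiE K (\<lambda>_. {- int (C * n)..int (C * n)})"
      have "inj_on (\<lambda>v. restrict v K) (?N \<alpha> \<beta> p q n)"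
        by (rule inj_on_subset [OF inj_on_restrict_support]) auto
      moreover have "(\<lambda>v. restrict v K) ` ?N \<alpha> \<beta> p q n \<subseteq> ?P"
        by (intro image_subsetI) (force simp: PiE_def Pi_def abs_le_iff)
      moreover have "finite ?P" using fin by (intro finite_PiE) auto
      ultimately have "finite (?N \<alpha> \<beta> p q n)" by (rule inj_on_finite)
      then have "card (?N \<alpha> \<beta> p q n \<inter> T n) \<le> card (?N \<alpha> \<beta> p q n)"
        by (intro card_mono) auto
      then show "card (G i n) \<le> F i n"
        by (simp add: i F_def G_def)
    qed
    finally show ?thesis .
  qed
  have nonbad: "dot K \<alpha> x = 0 \<longleftrightarrow> dot K \<beta> x = 0"
    if "v \<in> T n" "v \<notin> bad n" "\<alpha> \<in> A" "\<beta> \<in> A" "\<bar>dot K \<alpha> v\<bar> \<le> B'" "\<bar>dot K \<beta> v\<bar> \<le> B'" "x \<in> T 1"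
    for v n \<alpha> \<beta> x
  proof -
    have False if c: "dot K \<alpha> x = 0" "dot K \<beta> x \<noteq> 0" "\<alpha> \<in> A" "\<beta> \<in> A" "\<bar>dot K \<alpha> v\<bar> \<le> B'" "\<bar>dot K \<beta> v\<bar> \<le> B'"
      for \<alpha> \<beta>
    proof -
      have I: "((\<alpha>, \<beta>), (dot K \<alpha> v, dot K \<beta> v)) \<in> I"
        using c \<open>x \<in> T 1\<close> by (auto simp: I_def PP_def)
      have "v \<in> ?N \<alpha> \<beta> (dot K \<alpha> v) (dot K \<beta> v) n \<inter> T n"
        using \<open>v \<in> T n\<close> bounded by (auto simp: T_def cone_level_def)
      then have "v \<in> G ((\<alpha>, \<beta>), (dot K \<alpha> v, dot K \<beta> v)) n" by (simp add: G_def)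
      then have "v \<in> bad n" using I unfolding bad_def by blast
      then show False using \<open>v \<notin> bad n\<close> by simp
    qed
    then show ?thesis using that by blast
  qed
  obtain x0 where x0: "x0 \<in> T 1" using ne by blast
  define D where "D n = T (Suc n) - (\<lambda>v k. v k + x0 k) ` T n" for n
  have add: "(\<lambda>k. v k + x k) \<in> T (Suc n)" if "v \<in> T n" "x \<in> T 1" for v x n
    using cone_level_add [of v K \<kappa> Hs \<Gamma>s n x 1] that by (simp add: T_def)
  have cardD: "card (D n) + card (T n) = card (T (Suc n))" for n
  proof -
    have "inj_on (\<lambda>v k. v k + x0 k) (T n)" by (rule inj_onI) (auto simp: fun_eq_iff)
    then have "card ((\<lambda>v k. v k + x0 k) ` T n) = card (T n)" by (rule card_image)
    moreover have "(\<lambda>v k. v k + x0 k) ` T n \<subseteq> T (Suc n)" using add x0 by blast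
    ultimately show ?thesis unfolding D_def
      using card_Diff_subset [of "(\<lambda>v k. v k + x0 k) ` T n" "T (Suc n)"]
        card_mono [of "T (Suc n)" "(\<lambda>v k. v k + x0 k) ` T n"] finT by simp
  qed
  have step: "card (D (Suc n)) \<le> card (D n) + b (n + 2)" if n: "n \<ge> n0" for n
  proof -
    let ?E = "D (Suc n) - bad (Suc (Suc n))"
    have ex\<alpha>: "\<exists>\<alpha>\<in>A. \<bar>dot K \<alpha> v\<bar> \<le> B" if "v \<in> D (Suc n)" for v
    proof -
      have v: "v \<in> T (Suc (Suc n))" "v \<notin> (\<lambda>v k. v k + x0 k) ` T (Suc n)" using that by (auto simp: D_def)
      have "(\<lambda>k. v k - x0 k) \<notin> T (Suc n)"
      proof
        assume "(\<lambda>k. v k - x0 k) \<in> T (Suc n)"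
        then have "(\<lambda>k. (v k - x0 k) + x0 k) \<in> (\<lambda>v k. v k + x0 k) ` T (Suc n)" by (rule image_eqI [rotated]) simp
        then show False using v(2) by simp
      qed
      then show ?thesis using near [of "Suc n" v x0] n v(1) x0 by auto
    qed
    define \<alpha> where "\<alpha> v = (SOME \<alpha>. \<alpha> \<in> A \<and> \<bar>dot K \<alpha> v\<bar> \<le> B)" for v
    have \<alpha>: "\<alpha> v \<in> A" "\<bar>dot K (\<alpha> v) v\<bar> \<le> B" if "v \<in> D (Suc n)" for v
      using someI_ex [of "\<lambda>\<alpha>. \<alpha> \<in> A \<and> \<bar>dot K \<alpha> v\<bar> \<le> B"] ex\<alpha> [OF that] unfolding \<alpha>_def by blast+
    \<comment> \<open>\<open>\<xi> v\<close> depends on \<open>v\<close> only through the set of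
      points of level one on its hyperplane. Different functionals with the same such set therefore
      select the same point, as injectivity requires.\<close>
    define \<xi> where "\<xi> v = (SOME x. x \<in> {x \<in> T 1. dot K (\<alpha> v) x = 0})" for v
    have \<xi>: "\<xi> v \<in> T 1" "dot K (\<alpha> v) (\<xi> v) = 0" if "v \<in> D (Suc n)" for v
      using someI_ex [of "\<lambda>x. x \<in> {x \<in> T 1. dot K (\<alpha> v) x = 0}"] A [OF \<alpha>(1) [OF that]]
      unfolding \<xi>_def by blast+
    let ?f = "\<lambda>v k. v k - \<xi> v k"
    have maps: "?f v \<in> D n" if v: "v \<in> ?E" for v
    proof -
      have vT: "v \<in> T (Suc (Suc n))" and vD: "v \<in> D (Suc n)" and vb: "v \<notin> bad (Suc (Suc n))"
        using v by (auto simp: D_def)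
      \<comment> \<open>An obstruction would be a nearby functional that does not vanish at
        \<open>\<xi> v\<close>, whereas \<open>\<alpha> v\<close> does; outside \<open>bad\<close>
        this cannot happen.\<close>
      have "?f v \<in> T (Suc n)"
      proof (rule ccontr)
        assume "?f v \<notin> T (Suc n)"
        then obtain \<beta> where \<beta>: "\<beta> \<in> A" "dot K \<beta> (\<xi> v) \<noteq> 0" "\<bar>dot K \<beta> v\<bar> \<le> B"
          using near [of "Suc n" v "\<xi> v"] n vT \<xi> [OF vD] by auto
        have "dot K (\<alpha> v) (\<xi> v) = 0 \<longleftrightarrow> dot K \<beta> (\<xi> v) = 0"
          using \<alpha> [OF vD] \<beta> B'0 \<xi> [OF vD] by (intro nonbad [OF vT vb]) auto
        then show False using \<beta> \<xi> [OF vD] by simp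
      qed
      \<comment> \<open>If \<open>x0\<close> could be subtracted after \<open>\<xi> v\<close>, it
        could be subtracted from \<open>v\<close> itself.\<close>
      moreover have "?f v \<notin> (\<lambda>v k. v k + x0 k) ` T n"
      proof
        assume "?f v \<in> (\<lambda>v k. v k + x0 k) ` T n"
        then obtain w where w: "w \<in> T n" "?f v = (\<lambda>k. w k + x0 k)" by blast
        have "v = (\<lambda>k. (w k + \<xi> v k) + x0 k)"
        proof
          fix k
          show "v k = (w k + \<xi> v k) + x0 k" using fun_cong [OF w(2), of k] by simp
        qed
        moreover have "(\<lambda>k. w k + \<xi> v k) \<in> T (Suc n)" using add w(1) \<xi> [OF vD] by blast
        ultimately have "v \<in> (\<lambda>v k. v k + x0 k) ` T (Suc n)" by (rule image_eqI)
        then show False using vD by (simp add: D_def)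
      qed
      ultimately show ?thesis by (simp add: D_def)
    qed
    have inj: "inj_on ?f ?E"
    proof (rule inj_onI)
      fix v w assume v: "v \<in> ?E" and w: "w \<in> ?E" and eq: "?f v = ?f w"
      have vD: "v \<in> D (Suc n)" and wD: "w \<in> D (Suc n)" using v w by auto
      have weq: "w = (\<lambda>k. v k + \<xi> w k - \<xi> v k)"
      proof
        fix k
        show "w k = v k + \<xi> w k - \<xi> v k" using fun_cong [OF eq, of k] by simp
      qed
      \<comment> \<open>\<open>w\<close> is near the hyperplane of \<open>v\<close> as well, so
        outside \<open>bad\<close> both hyperplanes contain the same points of level one.\<close>
      have "\<bar>dot K (\<alpha> v) w\<bar> \<le> B'"
        by (subst weq) (intro B' \<alpha> \<xi> vD wD)
      then have "dot K (\<alpha> v) x = 0 \<longleftrightarrow> dot K (\<alpha> w) x = 0" if "x \<in> T 1" for x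
        using w \<alpha> [OF vD] \<alpha> [OF wD] B'0 that
        by (intro nonbad [of w "Suc (Suc n)"]) (auto simp: D_def)
      then have "{x \<in> T 1. dot K (\<alpha> v) x = 0} = {x \<in> T 1. dot K (\<alpha> w) x = 0}" by blast
      then have "\<xi> v = \<xi> w" unfolding \<xi>_def by simp
      then show "v = w" using weq by auto
    qed
    have finD: "finite (D m)" for m using finT by (simp add: D_def)
    have "card ?E \<le> card (D n)"
      using maps by (intro card_inj_on_le [OF inj] finD) blast
    moreover have "card (D (Suc n)) \<le> card ?E + card (bad (Suc (Suc n)))"
    proof -
      have "bad (Suc (Suc n)) \<subseteq> T (Suc (Suc n))" by (auto simp: bad_def G_def)
      then have "finite (bad (Suc (Suc n)))" using finT finite_subset by blast
      then have "card (D (Suc n)) \<le> card (?E \<union> bad (Suc (Suc n)))"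
        using finD by (intro card_mono) auto
      then show ?thesis using card_Un_le [of ?E "bad (Suc (Suc n))"] by linarith
    qed
    ultimately show ?thesis using cbad [of "n + 2"] by simp
  qed
  show ?thesis
  proof (rule that [OF small])
    show "\<forall>\<^sub>F n in sequentially. card (T (n + 2)) + card (T n) \<le> 2 * card (T (n + 1)) + b (n + 2)"
      unfolding eventually_sequentially
    proof (intro exI [of _ n0] allI impI)
      fix n assume "n \<ge> n0"
      from step [OF this] cardD [of n] cardD [of "Suc n"]
      show "card (T (n + 2)) + card (T n) \<le> 2 * card (T (n + 1)) + b (n + 2)" by simp
    qed
  qed
qed

section \<open>Upsets and Hilbert functions\<close>

lemma nondecreasing_subsequence:
  fixes f :: "nat \<Rightarrow> nat"
  obtains \<phi> :: "nat \<Rightarrow> nat" where "strict_mono \<phi>" "\<And>i j. i \<le> j \<Longrightarrow> f (\<phi> i) \<le> f (\<phi> j)"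
proof -
  obtain g :: "nat \<Rightarrow> nat" where g: "strict_mono g" "monoseq (\<lambda>n. f (g n))" using seq_monosub by blast
  show ?thesis
  proof (cases "\<forall>m n. m \<le> n \<longrightarrow> f (g m) \<le> f (g n)")
    case True
    then show ?thesis using that g(1) by blast
  next
    case False
    then have dec: "f (g n) \<le> f (g m)" if "m \<le> n" for m n using g(2) that by (auto simp: monoseq_def)
    \<comment> \<open>A nonincreasing sequence of naturals is constant from the point on where its
      minimum is attained.\<close>
    define v where "v = (LEAST v. v \<in> range (\<lambda>n. f (g n)))"
    have "v \<in> range (\<lambda>n. f (g n))" unfolding v_def by (rule LeastI [of _ "f (g 0)"]) simp
    then obtain N where N: "v = f (g N)" by blast
    have "v \<le> f (g n)" for n unfolding v_def by (rule Least_le) simp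
    then have const: "f (g n) = v" if "n \<ge> N" for n using dec [OF that] N by (simp add: antisym)
    show ?thesis
    proof (rule that)
      show "strict_mono (\<lambda>n. g (n + N))" using g(1) by (simp add: strict_mono_def)
      show "f (g (i + N)) \<le> f (g (j + N))" if "i \<le> j" for i j using const [of "i + N"] const [of "j + N"] by simp
    qed
  qed
qed

lemma dickson_sequence:
  fixes f :: "nat \<Rightarrow> 'k \<Rightarrow> nat"
  assumes "finite K"
  shows "\<exists>\<phi> :: nat \<Rightarrow> nat. strict_mono \<phi> \<and> (\<forall>k\<in>K. \<forall>i j. i \<le> j \<longrightarrow> f (\<phi> i) k \<le> f (\<phi> j) k)"
  using assms
proof (induction K rule: finite_induct)
  case empty
  show ?case by (intro exI [of _ "\<lambda>i. i"]) (simp add: strict_mono_def)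
next
  case (insert k K)
  from insert.IH obtain \<phi> :: "nat \<Rightarrow> nat"
    where "strict_mono \<phi> \<and> (\<forall>k\<in>K. \<forall>i j. i \<le> j \<longrightarrow> f (\<phi> i) k \<le> f (\<phi> j) k)" ..
  then have \<phi>: "strict_mono \<phi>" "\<forall>k\<in>K. \<forall>i j. i \<le> j \<longrightarrow> f (\<phi> i) k \<le> f (\<phi> j) k" by simp_all
  obtain \<psi> :: "nat \<Rightarrow> nat" where \<psi>: "strict_mono \<psi>" "\<And>i j. i \<le> j \<Longrightarrow> f (\<phi> (\<psi> i)) k \<le> f (\<phi> (\<psi> j)) k"
    by (rule nondecreasing_subsequence [of "\<lambda>i. f (\<phi> i) k"]) (rule that)
  have "strict_mono (\<lambda>i. \<phi> (\<psi> i))" using \<phi>(1) \<psi>(1) by (simp add: strict_mono_def)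
  moreover have "\<psi> i \<le> \<psi> j" if "i \<le> j" for i j
    using \<psi>(1) that by (simp add: strict_mono_less_eq)
  ultimately show ?case using \<phi>(2) \<psi>(2) by (intro exI [of _ "\<lambda>i. \<phi> (\<psi> i)"]) simp
qed

text \<open>If no finite part suffices, elements can be picked forever such that none dominates an
  earlier one. A subsequence that is nondecreasing in every coordinate of \<open>K\<close>
  contradicts this.\<close>

lemma dickson:
  fixes U :: "('k \<Rightarrow> nat) set"
  assumes "finite K"
  obtains F where "F \<subseteq> U" "finite F" "\<And>u. u \<in> U \<Longrightarrow> \<exists>v\<in>F. \<forall>k\<in>K. v k \<le> u k"
proof (rule ccontr)
  note found = that
  assume not: "\<not> thesis"
  have no: "\<exists>u\<in>U. \<forall>v\<in>F. \<not> (\<forall>k\<in>K. v k \<le> u k)" if F: "F \<subseteq> U" "finite F" for F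
  proof (rule ccontr)
    assume neg: "\<not> (\<exists>u\<in>U. \<forall>v\<in>F. \<not> (\<forall>k\<in>K. v k \<le> u k))"
    have thesis
    proof (rule found [OF F])
      fix u assume "u \<in> U"
      then show "\<exists>v\<in>F. \<forall>k\<in>K. v k \<le> u k" using neg by auto
    qed
    then show False using not by contradiction
  qed
  define c where "c F = (SOME u. u \<in> U \<and> (\<forall>v\<in>F. \<not> (\<forall>k\<in>K. v k \<le> u k)))" for F
  have c: "c F \<in> U \<and> (\<forall>v\<in>F. \<not> (\<forall>k\<in>K. v k \<le> c F k))" if "F \<subseteq> U" "finite F" for F
  proof -
    from no [OF that] have "\<exists>u. u \<in> U \<and> (\<forall>v\<in>F. \<not> (\<forall>k\<in>K. v k \<le> u k))" by (simp only: Bex_def)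
    then show ?thesis unfolding c_def by (rule someI_ex)
  qed
  \<comment> \<open>\<open>L n\<close> collects the first \<open>n\<close> picks, and
    \<open>c (L n)\<close> is the next one.\<close>
  define L where "L = rec_nat {} (\<lambda>_ F. insert (c F) F)"
  have L0: "L 0 = {}" and LS: "L (Suc n) = insert (c (L n)) (L n)" for n by (simp_all add: L_def)
  have L: "L n \<subseteq> U \<and> finite (L n)" for n
    by (induction n) (use c in \<open>auto simp: L0 LS\<close>)
  have mem: "c (L i) \<in> L j" if "i < j" for i j
    using that by (induction j) (auto simp: LS less_Suc_eq)
  from dickson_sequence [OF assms, of "\<lambda>i. c (L i)"] obtain \<phi> :: "nat \<Rightarrow> nat" where
    "strict_mono \<phi> \<and> (\<forall>k\<in>K. \<forall>i j. i \<le> j \<longrightarrow> c (L (\<phi> i)) k \<le> c (L (\<phi> j)) k)" ..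
  then have \<phi>: "strict_mono \<phi>" "\<forall>k\<in>K. \<forall>i j. i \<le> j \<longrightarrow> c (L (\<phi> i)) k \<le> c (L (\<phi> j)) k"
    by simp_all
  have "\<phi> 0 < \<phi> 1" using \<phi>(1) by (simp add: strict_mono_def)
  then have "c (L (\<phi> 0)) \<in> L (\<phi> 1)" by (rule mem)
  then have "\<not> (\<forall>k\<in>K. c (L (\<phi> 0)) k \<le> c (L (\<phi> 1)) k)" using c [of "L (\<phi> 1)"] L [of "\<phi> 1"] by simp
  moreover have "\<forall>k\<in>K. c (L (\<phi> 0)) k \<le> c (L (\<phi> 1)) k" using \<phi>(2) by simp
  ultimately show False by blast
qed

definition upset_on :: "'k set \<Rightarrow> ('k \<Rightarrow> nat) set \<Rightarrow> bool" where
  "upset_on K U \<longleftrightarrow> (\<forall>u\<in>U. \<forall>v. (\<forall>k\<in>K. u k \<le> v k) \<longrightarrow> v \<in> U)"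

lemma upset_onD: "upset_on K U \<Longrightarrow> u \<in> U \<Longrightarrow> (\<And>k. k \<in> K \<Longrightarrow> u k \<le> v k) \<Longrightarrow> v \<in> U"
  by (auto simp: upset_on_def)

text \<open>An upset is determined by finitely many of its elements. Once \<open>B\<close> is at
  least as large as all their entries, cutting at \<open>B\<close> does not change which of them are
  dominated.\<close>

lemma upset_box:
  assumes "finite K" "upset_on K U"
  obtains B0 where "\<And>B u. B \<ge> B0 \<Longrightarrow> (\<lambda>k. min (u k) B) \<in> U \<longleftrightarrow> u \<in> U"
proof -
  obtain F where F: "F \<subseteq> U" "finite F" "\<And>u. u \<in> U \<Longrightarrow> \<exists>v\<in>F. \<forall>k\<in>K. v k \<le> u k"
    by (rule dickson [OF assms(1), of U]) (rule that)
  define B0 where "B0 = (\<Sum>v\<in>F. \<Sum>k\<in>K. v k)"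
  have B0: "v k \<le> B0" if "v \<in> F" "k \<in> K" for v k
  proof -
    have "v k \<le> (\<Sum>k\<in>K. v k)" using that assms by (intro member_le_sum) auto
    also have "\<dots> \<le> B0" unfolding B0_def
      using that F by (intro member_le_sum [of v F "\<lambda>v. \<Sum>k\<in>K. v k"]) auto
    finally show ?thesis .
  qed
  show ?thesis
  proof (rule that)
    fix B :: nat and u assume B: "B \<ge> B0"
    show "(\<lambda>k. min (u k) B) \<in> U \<longleftrightarrow> u \<in> U"
    proof
      assume "(\<lambda>k. min (u k) B) \<in> U"
      then show "u \<in> U" by (rule upset_onD [OF assms(2)]) simp
    next
      assume "u \<in> U"
      then obtain v where v: "v \<in> F" "\<forall>k\<in>K. v k \<le> u k" using F(3) by blast
      show "(\<lambda>k. min (u k) B) \<in> U"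
      proof (rule upset_onD [OF assms(2)])
        show "v \<in> U" using v(1) F(1) by blast
        show "v k \<le> min (u k) B" if "k \<in> K" for k using B0 [OF v(1) that] B v(2) that by simp
      qed
    qed
  qed
qed

section \<open>Compositions and Stanley decompositions\<close>

definition compositions :: "'k set \<Rightarrow> nat \<Rightarrow> ('k \<Rightarrow> nat) set" where
  "compositions Z n = {a. (\<forall>k. k \<notin> Z \<longrightarrow> a k = 0) \<and> sum a Z = n}"

lemma compositions_empty: "compositions {} n = (if n = 0 then {\<lambda>_. 0} else {})"
  by (auto simp: compositions_def)

lemma compositions_insert:
  assumes "finite Z" "z \<notin> Z"
  shows "bij_betw (\<lambda>(j, a). a(z := n - j)) (SIGMA j:{..n}. compositions Z j) (compositions (insert z Z) n)"
proof (rule bij_betw_byWitness [where f' = "\<lambda>a. (n - a z, a(z := 0))"])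
  have s: "(\<Sum>y\<in>Z. if y = z then x else a y) = sum a Z" for a :: "'a \<Rightarrow> nat" and x
    by (rule sum.cong) (use assms in auto)
  show "\<forall>p\<in>SIGMA j:{..n}. compositions Z j.
      (n - (case p of (j, a) \<Rightarrow> a(z := n - j)) z, (case p of (j, a) \<Rightarrow> a(z := n - j))(z := 0)) = p"
    using assms by (auto simp: compositions_def fun_eq_iff)
  show "\<forall>a\<in>compositions (insert z Z) n. (case (n - a z, a(z := 0)) of (j, a) \<Rightarrow> a(z := n - j)) = a"
    using assms by (auto simp: compositions_def)
  show "(\<lambda>(j, a). a(z := n - j)) ` (SIGMA j:{..n}. compositions Z j) \<subseteq> compositions (insert z Z) n"
    using assms by (auto simp: compositions_def s fun_upd_def)
  show "(\<lambda>a. (n - a z, a(z := 0))) ` compositions (insert z Z) n \<subseteq> (SIGMA j:{..n}. compositions Z j)"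
    using assms by (auto simp: compositions_def s fun_upd_def)
qed

lemma finite_compositions: "finite Z \<Longrightarrow> finite (compositions Z n)"
proof (induction Z arbitrary: n rule: finite_induct)
  case empty
  show ?case by (simp add: compositions_empty)
next
  case (insert z Z)
  then have "finite (SIGMA j:{..n}. compositions Z j)" by auto
  then show ?case using bij_betw_finite [OF compositions_insert [OF insert.hyps]] by blast
qed

lemma card_compositions_insert:
  assumes "finite Z" "z \<notin> Z"
  shows "card (compositions (insert z Z) n) = (\<Sum>j\<le>n. card (compositions Z j))"
  using bij_betw_same_card [OF compositions_insert [OF assms, of n]] assms
  by (simp add: finite_compositions)

lemma card_compositions:
  assumes "finite Z"
  shows "card (compositions Z n) = (if Z = {} then (if n = 0 then 1 else 0) else (n + card Z - 1) choose (card Z - 1))"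
  using assms
proof (induction Z arbitrary: n rule: finite_induct)
  case empty
  show ?case by (simp add: compositions_empty)
next
  case (insert z Z)
  show ?case
  proof (cases "Z = {}")
    case True
    then show ?thesis using insert.hyps by (simp add: card_compositions_insert compositions_empty if_distrib [of card] cong: if_cong)
  next
    case False
    then obtain m where m: "card Z = Suc m" using insert.hyps by (metis card_eq_0_iff not0_implies_Suc)
    have "(\<Sum>j\<le>n. (j + m) choose m) = (n + Suc m) choose (Suc m)" by (induction n) simp_all
    then show ?thesis using insert False m by (simp add: card_compositions_insert)
  qed
qed

text \<open>The Hilbert series of a polynomial ring: adjoining a variable replaces the coefficients
  by their partial sums, and multiplication by 1 - X undoes this.\<close>

lemma compositions_fps:
  assumes "finite Z"
  shows "Abs_fps (\<lambda>n. int (card (compositions Z n))) * (1 - fps_X) ^ card Z = 1"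
  using assms
proof (induction Z rule: finite_induct)
  case empty
  show ?case by (rule fps_ext) (simp add: compositions_empty)
next
  case (insert z Z)
  let ?F = "\<lambda>Z. Abs_fps (\<lambda>n. int (card (compositions Z n)))"
  have "?F (insert z Z) * (1 - fps_X) = ?F Z"
  proof (rule fps_ext)
    fix n
    show "(?F (insert z Z) * (1 - fps_X)) $ n = ?F Z $ n"
      using insert.hyps
      by (cases n) (simp_all add: right_diff_distrib card_compositions_insert)
  qed
  then have "?F (insert z Z) * (1 - fps_X) ^ Suc (card Z) = ?F Z * (1 - fps_X) ^ card Z"
    by (simp only: power_Suc mult.assoc [symmetric])
  then show ?case using insert by simp
qed

text \<open>Membership in \<open>V\<close> can be tested after cutting all coordinates at
  \<open>B\<close>, as for differences of upsets when \<open>B\<close> is large. Then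
  \<open>V\<close> is the disjoint union of the sets w + N^F, where \<open>w\<close> runs over
  \<open>corner\<close> and F = \<open>free w\<close> consists of the coordinates at which
  \<open>w\<close> has reached \<open>B\<close>: a Stanley decomposition. Degrees are counted by the
  coordinates in \<open>K1\<close>; the others have degree zero.\<close>

locale boxed =
  fixes K K1 :: "'k set" and V :: "('k \<Rightarrow> nat) set" and B :: nat
  assumes finK: "finite K" and K1: "K1 \<subseteq> K"
    and supp: "\<And>u k. u \<in> V \<Longrightarrow> k \<notin> K \<Longrightarrow> u k = 0"
    and box: "\<And>u. (\<And>k. k \<notin> K \<Longrightarrow> u k = 0) \<Longrightarrow> (\<lambda>k. min (u k) B) \<in> V \<longleftrightarrow> u \<in> V"
begin

definition corner :: "('k \<Rightarrow> nat) set" where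
  "corner = {w \<in> V. \<forall>k. w k \<le> B}"

definition free :: "('k \<Rightarrow> nat) \<Rightarrow> 'k set" where
  "free w = {k \<in> K. w k = B}"

definition level :: "nat \<Rightarrow> ('k \<Rightarrow> nat) set" where
  "level n = {u \<in> V. sum u K1 = n}"

lemma finite_corner: "finite corner"
proof -
  have "corner \<subseteq> {w. \<forall>k. (k \<in> K \<longrightarrow> w k \<in> {..B}) \<and> (k \<notin> K \<longrightarrow> w k = 0)}"
    using supp by (auto simp: corner_def)
  then show ?thesis using finite_set_of_finite_funs [OF finK, of "{..B}" 0] finite_subset by blast
qed

lemma free_subset: "free w \<subseteq> K" by (auto simp: free_def)

lemma finite_free: "finite (free w)"
  using free_subset finK finite_subset by blast

lemma add_free_in:
  assumes "w \<in> corner" "\<And>k. k \<notin> free w \<Longrightarrow> a k = 0"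
  shows "(\<lambda>k. w k + a k) \<in> V" "(\<lambda>k. min (w k + a k) B) = w"
proof -
  have w: "w \<in> V" "\<And>k. w k \<le> B" using assms(1) by (auto simp: corner_def)
  show eq: "(\<lambda>k. min (w k + a k) B) = w"
  proof
    fix k
    show "min (w k + a k) B = w k"
      using assms(2) [of k] w(2) [of k] by (cases "k \<in> free w") (auto simp: free_def)
  qed
  have "w k + a k = 0" if "k \<notin> K" for k
    using that supp [OF w(1) that] assms(2) [of k] free_subset by auto
  then show "(\<lambda>k. w k + a k) \<in> V" using box [of "\<lambda>k. w k + a k"] eq w(1) by simp
qed

lemma truncate_corner:
  assumes "u \<in> V"
  shows "(\<lambda>k. min (u k) B) \<in> corner" "u k = min (u k) B + (u k - B)"
    "k \<notin> free (\<lambda>k. min (u k) B) \<Longrightarrow> u k - B = 0"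
proof -
  show "(\<lambda>k. min (u k) B) \<in> corner" using box [of u] assms supp by (auto simp: corner_def)
  show "u k = min (u k) B + (u k - B)" by simp
  show "k \<notin> free (\<lambda>k. min (u k) B) \<Longrightarrow> u k - B = 0" using supp [OF assms] by (auto simp: free_def)
qed

text \<open>Cutting at \<open>B\<close> and keeping the excess inverts the addition. The hypothesis
  gives every free coordinate degree one, so the excess is a composition of what is left of
  \<open>n\<close>.\<close>

lemma level_bij:
  assumes free: "\<And>w. w \<in> corner \<Longrightarrow> free w \<subseteq> K1"
  shows "bij_betw (\<lambda>(w, a) k. w k + a k)
    (SIGMA w:{w \<in> corner. sum w K1 \<le> n}. compositions (free w) (n - sum w K1)) (level n)"
    (is "bij_betw ?f ?S _")
proof (rule bij_betw_byWitness [where f' = "\<lambda>u. ((\<lambda>k. min (u k) B), (\<lambda>k. u k - B))"])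
  have finK1: "finite K1" using finK K1 finite_subset by blast
  have sums: "sum a K1 = sum a (free w)" if "w \<in> corner" "\<And>k. k \<notin> free w \<Longrightarrow> a k = 0" for w and a :: "'k \<Rightarrow> nat"
    by (rule sum.mono_neutral_right) (use free [OF that(1)] finK1 that in auto)
  show "\<forall>p\<in>?S. ((\<lambda>k. min (?f p k) B), (\<lambda>k. ?f p k - B)) = p"
  proof
    fix p assume "p \<in> ?S"
    then obtain w a where p: "p = (w, a)" "w \<in> corner" "\<And>k. k \<notin> free w \<Longrightarrow> a k = 0"
      by (auto simp: compositions_def)
    have "(\<lambda>k. w k + a k - B) = a"
    proof
      fix k
      show "w k + a k - B = a k" using p(2) p(3) [of k] by (cases "k \<in> free w") (auto simp: free_def corner_def)
    qed
    then show "((\<lambda>k. min (?f p k) B), (\<lambda>k. ?f p k - B)) = p"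
      using add_free_in(2) [OF p(2,3)] p(1) by simp
  qed
  show "\<forall>u\<in>level n. ?f ((\<lambda>k. min (u k) B), (\<lambda>k. u k - B)) = u"
    by (auto simp: fun_eq_iff)
  show "?f ` ?S \<subseteq> level n"
  proof
    fix u assume "u \<in> ?f ` ?S"
    then obtain w a where p: "u = (\<lambda>k. w k + a k)" "w \<in> corner" "\<And>k. k \<notin> free w \<Longrightarrow> a k = 0"
      "sum w K1 \<le> n" "sum a (free w) = n - sum w K1"
      by (auto simp: compositions_def)
    have "sum u K1 = n" using p(4,5) sums [OF p(2,3)] by (simp add: p(1) sum.distrib)
    then show "u \<in> level n" using add_free_in(1) [OF p(2,3)] by (simp add: level_def p(1))
  qed
  show "(\<lambda>u. ((\<lambda>k. min (u k) B), (\<lambda>k. u k - B))) ` level n \<subseteq> ?S"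
  proof
    fix p assume "p \<in> (\<lambda>u. ((\<lambda>k. min (u k) B), (\<lambda>k. u k - B))) ` level n"
    then obtain u where u: "p = ((\<lambda>k. min (u k) B), (\<lambda>k. u k - B))" "u \<in> V" "sum u K1 = n"
      by (auto simp: level_def)
    let ?w = "\<lambda>k. min (u k) B" and ?a = "\<lambda>k. u k - B"
    have w: "?w \<in> corner" and a: "\<And>k. k \<notin> free ?w \<Longrightarrow> ?a k = 0" using truncate_corner [OF u(2)] by auto
    have "sum u K1 = sum ?w K1 + sum ?a K1"
      unfolding sum.distrib [symmetric] by (rule sum.cong) auto
    then have "sum ?w K1 \<le> n" "sum ?a (free ?w) = n - sum ?w K1"
      using u(3) sums [OF w a] by auto
    then show "p \<in> ?S" using w a u(1) by (auto simp: compositions_def)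
  qed
qed

lemma card_level:
  assumes "\<And>w. w \<in> corner \<Longrightarrow> free w \<subseteq> K1"
  shows "card (level n) = (\<Sum>w\<in>corner. if sum w K1 \<le> n then card (compositions (free w) (n - sum w K1)) else 0)"
proof -
  have "card (level n) = (\<Sum>w\<in>{w \<in> corner. sum w K1 \<le> n}. card (compositions (free w) (n - sum w K1)))"
  proof -
    have "card (level n) = card (SIGMA w:{w \<in> corner. sum w K1 \<le> n}. compositions (free w) (n - sum w K1))"
      by (rule sym, rule bij_betw_same_card, rule level_bij, rule assms)
    also have "\<dots> = (\<Sum>w\<in>{w \<in> corner. sum w K1 \<le> n}. card (compositions (free w) (n - sum w K1)))"
      using finite_corner by (intro card_SigmaI) (auto intro: finite_compositions finite_free)
    finally show ?thesis .
  qed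
  also have "\<dots> = (\<Sum>w\<in>corner. if sum w K1 \<le> n then card (compositions (free w) (n - sum w K1)) else 0)"
    using finite_corner by (simp add: sum.inter_filter)
  finally show ?thesis .
qed

text \<open>Each piece of the decomposition contributes X^(sum w K1) / (1 - X)^(card (free w)), and
  \<open>N\<close> is a common exponent for the denominators.\<close>

lemma level_fps:
  assumes free: "\<And>w. w \<in> corner \<Longrightarrow> free w \<subseteq> K1" and N: "\<And>w. w \<in> corner \<Longrightarrow> card (free w) \<le> N"
  shows "Abs_fps (\<lambda>n. int (card (level n))) * (1 - fps_X) ^ N =
    fps_of_poly (\<Sum>w\<in>corner. monom 1 (sum w K1) * [:1, -1:] ^ (N - card (free w)))"
proof -
  let ?C = "\<lambda>Z. Abs_fps (\<lambda>n. int (card (compositions Z n)))"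
  have "Abs_fps (\<lambda>n. int (card (level n))) = (\<Sum>w\<in>corner. fps_X ^ sum w K1 * ?C (free w))"
    by (rule fps_ext) (auto simp: card_level [OF free] fps_sum_nth fps_X_power_mult_nth intro!: sum.cong)
  then have "Abs_fps (\<lambda>n. int (card (level n))) * (1 - fps_X) ^ N
      = (\<Sum>w\<in>corner. fps_X ^ sum w K1 * ?C (free w) * (1 - fps_X) ^ N)"
    by (simp only: sum_distrib_right)
  also have "\<dots> = (\<Sum>w\<in>corner. fps_X ^ sum w K1 * (1 - fps_X) ^ (N - card (free w)))"
  proof (rule sum.cong [OF refl])
    fix w assume w: "w \<in> corner"
    have "(1 - fps_X :: int fps) ^ N = (1 - fps_X) ^ card (free w) * (1 - fps_X) ^ (N - card (free w))"
      using N [OF w] by (simp flip: power_add)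
    then have "fps_X ^ sum w K1 * ?C (free w) * (1 - fps_X) ^ N
      = fps_X ^ sum w K1 * (?C (free w) * (1 - fps_X) ^ card (free w)) * (1 - fps_X) ^ (N - card (free w))"
      by (simp only: mult.assoc)
    then show "fps_X ^ sum w K1 * ?C (free w) * (1 - fps_X) ^ N = fps_X ^ sum w K1 * (1 - fps_X) ^ (N - card (free w))"
      using compositions_fps [OF finite_free, of w] by simp
  qed
  also have "\<dots> = fps_of_poly (\<Sum>w\<in>corner. monom 1 (sum w K1) * [:1, -1:] ^ (N - card (free w)))"
  proof -
    have "fps_of_poly [:1, -1:] = (1 - fps_X :: int fps)"
      by (rule fps_ext) (auto simp: fps_X_def coeff_pCons split: nat.splits)
    then show ?thesis
      by (simp only: fps_of_poly_sum fps_of_poly_mult fps_of_poly_power fps_of_poly_monom fps_const_1_eq_1 mult_1_left)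
  qed
  finally show ?thesis .
qed

end

section \<open>Functions that are eventually polynomial\<close>

definition eventually_poly :: "(nat \<Rightarrow> nat) \<Rightarrow> bool" where
  "eventually_poly f \<longleftrightarrow> (\<exists>p :: real poly. \<forall>\<^sub>F n in sequentially. real (f n) = poly p (real n))"

lemma eventually_polyI:
  "(\<And>n. n \<ge> N \<Longrightarrow> real (f n) = poly p (real n)) \<Longrightarrow> eventually_poly f"
  unfolding eventually_poly_def eventually_sequentially by blast

lemma eventually_poly_sum:
  assumes "finite A" "\<And>i. i \<in> A \<Longrightarrow> eventually_poly (f i)"
  shows "eventually_poly (\<lambda>n. \<Sum>i\<in>A. f i n)"
  using assms
proof (induction A rule: finite_induct)
  case empty
  show ?case by (rule eventually_polyI [of 0 _ 0]) simp
next
  case (insert i A)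
  have "eventually_poly (f i)" using insert.prems by simp
  then obtain p where p: "\<forall>\<^sub>F n in sequentially. real (f i n) = poly p (real n)"
    unfolding eventually_poly_def ..
  have "eventually_poly (\<lambda>n. \<Sum>i\<in>A. f i n)" using insert by simp
  then obtain q where q: "\<forall>\<^sub>F n in sequentially. real (\<Sum>i\<in>A. f i n) = poly q (real n)"
    unfolding eventually_poly_def ..
  from p q have "\<forall>\<^sub>F n in sequentially. real (\<Sum>i\<in>insert i A. f i n) = poly (p + q) (real n)"
    by eventually_elim (use insert.hyps in simp)
  then show ?case unfolding eventually_poly_def ..
qed

lemma eventually_poly_shift:
  assumes "eventually_poly (\<lambda>n. f (n + q))"
  shows "eventually_poly f"
proof -
  from assms obtain p where "\<forall>\<^sub>F n in sequentially. real (f (n + q)) = poly p (real n)"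
    unfolding eventually_poly_def ..
  then obtain N where N: "\<forall>n\<ge>N. real (f (n + q)) = poly p (real n)"
    unfolding eventually_sequentially ..
  show ?thesis
  proof (rule eventually_polyI)
    fix n assume n: "n \<ge> N + q"
    then have "real (f ((n - q) + q)) = poly p (real (n - q))" by (intro N [rule_format]) simp
    then show "real (f n) = poly (pcompose p [:- real q, 1:]) (real n)"
      using n by (simp add: poly_pcompose of_nat_diff)
  qed
qed

lemma eventually_poly_card_compositions:
  assumes "finite Z"
  shows "eventually_poly (\<lambda>n. card (compositions Z n))"
proof (cases "Z = {}")
  case True
  \<comment> \<open>The count at level zero is one, so the zero polynomial is right only from level
    one on.\<close>
  show ?thesis
    by (rule eventually_polyI [of 1 _ 0]) (use True in \<open>simp add: compositions_empty\<close>)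
next
  case False
  then obtain m where m: "card Z = Suc m" using assms by (metis card_eq_0_iff not0_implies_Suc)
  show ?thesis
  proof (rule eventually_polyI [of 0])
    fix n
    have "real (card (compositions Z n)) = real (n + m) gchoose m"
      using assms False m by (simp add: card_compositions binomial_gbinomial)
    also have "\<dots> = (\<Prod>i = 0..<m. real (n + m) - real i) / fact m"
      by (simp add: gbinomial_prod_rev)
    also have "\<dots> = poly (smult (1 / fact m) (\<Prod>i = 0..<m. [:real m - real i, 1:])) (real n)"
      by (simp add: poly_prod algebra_simps)
    finally show "real (card (compositions Z n))
      = poly (smult (1 / fact m) (\<Prod>i = 0..<m. [:real m - real i, 1:])) (real n)" .
  qed
qed

lemma (in boxed) eventually_poly_card_level:
  assumes "\<And>w. w \<in> corner \<Longrightarrow> free w \<subseteq> K1"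
  shows "eventually_poly (\<lambda>n. card (level n))"
proof -
  have "eventually_poly (\<lambda>n. if sum w K1 \<le> n then card (compositions (free w) (n - sum w K1)) else 0)" for w
    by (rule eventually_poly_shift [where q = "sum w K1"])
      (simp add: eventually_poly_card_compositions finite_free)
  then have "eventually_poly (\<lambda>n. \<Sum>w\<in>corner. if sum w K1 \<le> n then card (compositions (free w) (n - sum w K1)) else 0)"
    by (intro eventually_poly_sum [OF finite_corner])
  moreover have "card (level n) = (\<Sum>w\<in>corner. if sum w K1 \<le> n then card (compositions (free w) (n - sum w K1)) else 0)"
    for n by (rule card_level) (rule assms)
  ultimately show ?thesis by simp
qed

lemma eventually_poly_sign:
  assumes "eventually_poly f"
  shows "(\<forall>\<^sub>F n in sequentially. f n = 0) \<or> (\<forall>\<^sub>F n in sequentially. f n > 0)"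
proof -
  from assms obtain p where p: "\<forall>\<^sub>F n in sequentially. real (f n) = poly p (real n)"
    unfolding eventually_poly_def ..
  show ?thesis
  proof (cases "p = 0")
    case True
    from p have "\<forall>\<^sub>F n in sequentially. f n = 0" by eventually_elim (use True in simp)
    then show ?thesis ..
  next
    case False
    have "finite (real -` {x. poly p x = 0})"
      by (rule finite_vimageI [OF poly_roots_finite [OF False]]) simp
    then obtain N where N: "\<forall>n\<in>real -` {x. poly p x = 0}. n < N"
      using finite_nat_set_iff_bounded by blast
    have "\<forall>\<^sub>F n in sequentially. n \<ge> N" by (rule eventually_ge_at_top)
    with p have "\<forall>\<^sub>F n in sequentially. f n > 0"
    proof eventually_elim
      case (elim n)
      then have "n \<notin> real -` {x. poly p x = 0}" using N by force
      then have "real (f n) \<noteq> 0" using elim by simp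
      then show ?case by simp
    qed
    then show ?thesis ..
  qed
qed

lemma poly_difference:
  fixes p :: "'a :: comm_ring_1 poly"
  obtains q where "q = 0 \<or> degree q < degree p" "\<And>x. poly q x = poly p (x + 1) - poly p x"
proof -
  have "\<exists>q. (q = 0 \<or> degree q < degree p) \<and> (\<forall>x. poly q x = poly p (x + 1) - poly p x)"
  proof (induction p rule: pCons_induct)
    case 0
    show ?case by (intro exI [of _ 0]) simp
  next
    case (pCons a p)
    then obtain q where q: "q = 0 \<or> degree q < degree p" "\<forall>x. poly q x = poly p (x + 1) - poly p x"
      by blast
    show ?case
    proof (cases "p = 0")
      case True
      then show ?thesis by (intro exI [of _ 0]) simp
    next
      case False
      have "degree (pCons 0 q) \<le> degree p" using q(1) by (auto simp: degree_pCons_eq_if)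
      moreover have "degree q \<le> degree p" using q(1) by auto
      ultimately have "degree (pCons 0 q + p + q) \<le> degree p" by (simp add: degree_add_le)
      moreover have "poly (pCons 0 q + p + q) x = poly (pCons a p) (x + 1) - poly (pCons a p) x" for x
      proof -
        have qx: "poly p (x + 1) = poly q x + poly p x" using q(2) by simp
        show ?thesis unfolding poly_pCons poly_add qx by (simp add: algebra_simps)
      qed
      ultimately show ?thesis using False
        by (intro exI [of _ "pCons 0 q + p + q"]) (auto simp: degree_pCons_eq_if)
    qed
  qed
  then show ?thesis using that by blast
qed

lemma poly_power_bound:
  fixes p :: "real poly"
  assumes "degree p \<le> d"
  obtains M where "\<And>x. x \<ge> 1 \<Longrightarrow> \<bar>poly p x\<bar> \<le> M * x ^ d"
proof
  fix x :: real assume x: "x \<ge> 1"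
  have "\<bar>poly p x\<bar> \<le> (\<Sum>i\<le>degree p. \<bar>coeff p i * x ^ i\<bar>)"
    unfolding poly_altdef by (rule sum_abs)
  also have "\<dots> \<le> (\<Sum>i\<le>degree p. \<bar>coeff p i\<bar> * x ^ d)"
  proof (rule sum_mono)
    fix i assume "i \<in> {..degree p}"
    then have "x ^ i \<le> x ^ d" using x assms by (intro power_increasing) auto
    then show "\<bar>coeff p i * x ^ i\<bar> \<le> \<bar>coeff p i\<bar> * x ^ d"
      using x by (simp add: abs_mult mult_left_mono)
  qed
  finally show "\<bar>poly p x\<bar> \<le> (\<Sum>i\<le>degree p. \<bar>coeff p i\<bar>) * x ^ d" by (simp add: sum_distrib_right)
qed

text \<open>Divided by n^(degree p), the values tend to the leading coefficient; a bound with a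
  smaller exponent would make them tend to zero.\<close>

lemma degree_le_of_growth:
  fixes p :: "real poly"
  assumes "\<forall>\<^sub>F n in sequentially. \<bar>poly p (real n)\<bar> \<le> C * real n ^ k"
  shows "degree p \<le> k"
proof (rule ccontr)
  assume "\<not> degree p \<le> k"
  then have k: "k < degree p" by simp
  then have p0: "p \<noteq> 0" by auto
  have "((\<lambda>x. poly p x / x ^ degree p) \<longlongrightarrow> lead_coeff p) at_top"
    using poly_divide_tendsto_aux [of p] by (rule tendsto_mono [OF at_top_le_at_infinity])
  then have l: "(\<lambda>n. poly p (real n) / real n ^ degree p) \<longlonglongrightarrow> lead_coeff p"
    by (rule filterlim_compose [OF _ filterlim_real_sequentially])
  have "(\<lambda>n. \<bar>C\<bar> * inverse (real n)) \<longlonglongrightarrow> \<bar>C\<bar> * 0"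
    by (intro tendsto_mult tendsto_const lim_inverse_n)
  then have z: "(\<lambda>n. \<bar>C\<bar> * inverse (real n)) \<longlonglongrightarrow> 0" by simp
  have "\<forall>\<^sub>F n in sequentially. norm (poly p (real n) / real n ^ degree p) \<le> \<bar>C\<bar> * inverse (real n)"
    using assms eventually_ge_at_top [of 1]
  proof eventually_elim
    case (elim n)
    have n: "real n \<ge> 1" using elim by simp
    have "real n ^ k * real n \<le> real n ^ degree p"
      using power_increasing [of "Suc k" "degree p" "real n"] k n by (simp add: mult.commute)
    then have "\<bar>C\<bar> * (real n ^ k * real n) \<le> \<bar>C\<bar> * real n ^ degree p" by (rule mult_left_mono) simp
    moreover have "\<bar>poly p (real n)\<bar> * real n \<le> \<bar>C\<bar> * (real n ^ k * real n)"
    proof -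
      have "C * real n ^ k \<le> \<bar>C\<bar> * real n ^ k" by (rule mult_right_mono) auto
      then have "\<bar>poly p (real n)\<bar> \<le> \<bar>C\<bar> * real n ^ k" using elim by linarith
      then show ?thesis using mult_right_mono [of "\<bar>poly p (real n)\<bar>" "\<bar>C\<bar> * real n ^ k" "real n"]
        by (simp add: mult.assoc)
    qed
    ultimately have "\<bar>poly p (real n)\<bar> * real n \<le> \<bar>C\<bar> * real n ^ degree p" by linarith
    then show ?case using n by (simp add: field_simps)
  qed
  then have "\<forall>\<^sub>F n in sequentially. norm (poly p (real n) / real n ^ degree p) \<le> norm (\<bar>C\<bar> * inverse (real n)) * 1"
    by eventually_elim (simp add: abs_mult)
  from tendsto_0_le [OF z this] have "(\<lambda>n. poly p (real n) / real n ^ degree p) \<longlonglongrightarrow> 0" .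
  then have "lead_coeff p = 0" using l LIMSEQ_unique by blast
  then show False using p0 by simp
qed

text \<open>The factor n on the left stands for an exponent k - 2 on the right. This form is also
  right for k = 1, where the second difference has to vanish; truncated subtraction would only say
  that it is bounded.\<close>

lemma eventually_poly_second_difference:
  assumes "eventually_poly f" "\<forall>\<^sub>F n in sequentially. real (f n) \<le> C * real n ^ k" "k \<ge> 1"
  obtains M where "\<forall>\<^sub>F n in sequentially.
    \<bar>real (f (n + 2)) + real (f n) - 2 * real (f (n + 1))\<bar> * real n \<le> M * real n ^ (k - 1)"
proof -
  from assms(1) obtain p where p: "\<forall>\<^sub>F n in sequentially. real (f n) = poly p (real n)"
    unfolding eventually_poly_def ..
  have "\<forall>\<^sub>F n in sequentially. \<bar>poly p (real n)\<bar> \<le> C * real n ^ k"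
    using p assms(2) by eventually_elim simp
  then have deg: "degree p \<le> k" by (rule degree_le_of_growth)
  obtain q where q: "q = 0 \<or> degree q < degree p" "\<And>x. poly q x = poly p (x + 1) - poly p x"
    by (rule poly_difference [of p]) (rule that)
  obtain r where r: "r = 0 \<or> degree r < degree q" "\<And>x. poly r x = poly q (x + 1) - poly q x"
    by (rule poly_difference [of q]) (rule that)
  have rp: "poly r x = poly p (x + 2) + poly p x - 2 * poly p (x + 1)" for x
    unfolding r(2) q(2) by (simp add: algebra_simps)
  obtain M where M: "\<And>x. x \<ge> 1 \<Longrightarrow> \<bar>poly r x\<bar> * x \<le> M * x ^ (k - 1)"
  proof (cases "r = 0")
    case True
    then show ?thesis using that [of 0] by simp
  next
    case False
    then have "q \<noteq> 0" using r(2) r(1) by auto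
    then have k: "degree r \<le> k - 2" "k \<ge> 2" using False r(1) q(1) deg by auto
    obtain M where M: "\<And>x. x \<ge> 1 \<Longrightarrow> \<bar>poly r x\<bar> \<le> M * x ^ (k - 2)"
      by (rule poly_power_bound [OF k(1)]) (rule that)
    have "\<bar>poly r x\<bar> * x \<le> M * x ^ (k - 1)" if "x \<ge> 1" for x
    proof -
      have "\<bar>poly r x\<bar> * x \<le> M * x ^ (k - 2) * x" using M [OF that] that by (intro mult_right_mono) auto
      also have "\<dots> = M * x ^ (k - 1)"
        using k(2) by (simp flip: power_Suc2 add: mult.assoc Suc_diff_Suc numeral_2_eq_2)
      finally show ?thesis .
    qed
    then show ?thesis by (rule that)
  qed
  from p have "\<forall>\<^sub>F n in sequentially. real (f (n + 1)) = poly p (real (n + 1))"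
    by (rule eventually_compose_filterlim [OF _ filterlim_add_const_nat_at_top])
  moreover from p have "\<forall>\<^sub>F n in sequentially. real (f (n + 2)) = poly p (real (n + 2))"
    by (rule eventually_compose_filterlim [OF _ filterlim_add_const_nat_at_top])
  ultimately have "\<forall>\<^sub>F n in sequentially.
    \<bar>real (f (n + 2)) + real (f n) - 2 * real (f (n + 1))\<bar> * real n \<le> M * real n ^ (k - 1)"
    using p eventually_ge_at_top [of 1]
  proof eventually_elim
    case (elim n)
    then show ?case using M [of "real n"] by (simp add: rp add.commute)
  qed
  then show ?thesis by (rule that)
qed

text \<open>Khovanskii's argument: the elements of level \<open>n\<close> correspond to their lexicographically least
  representations, and these form the complement of an upset.\<close>

lemma wf_less_fun_finite_support:
  fixes k :: nat
  shows "wf {(b, a). less_fun b a \<and> (\<forall>i\<ge>k. a i = (0 :: nat)) \<and> (\<forall>i\<ge>k. b i = 0)}"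
  unfolding wf_iff_no_infinite_down_chain
proof (rule notI, elim exE)
  fix f :: "nat \<Rightarrow> nat \<Rightarrow> nat"
  assume f: "\<forall>i. (f (Suc i), f i) \<in> {(b, a). less_fun b a \<and> (\<forall>i\<ge>k. a i = 0) \<and> (\<forall>i\<ge>k. b i = 0)}"
  have less: "less_fun (f j) (f i)" if "i < j" for i j
    using that
  proof (induction j)
    case (Suc j)
    have "less_fun (f (Suc j)) (f j)" using f by simp
    then show ?case using Suc less_fun_trans less_antisym by (metis less_SucE)
  qed simp
  \<comment> \<open>A descending chain would contain two members of which the later dominates the
    earlier, against the lexicographic decrease.\<close>
  from dickson_sequence [of "{..<k}" f] obtain \<phi> :: "nat \<Rightarrow> nat" where
    "strict_mono \<phi> \<and> (\<forall>l\<in>{..<k}. \<forall>i j. i \<le> j \<longrightarrow> f (\<phi> i) l \<le> f (\<phi> j) l)" by auto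
  then have \<phi>: "\<phi> 0 < \<phi> 1" "\<And>l. l < k \<Longrightarrow> f (\<phi> 0) l \<le> f (\<phi> 1) l" by (auto simp: strict_mono_def)
  from less [OF \<phi>(1)] obtain l where l: "f (\<phi> 1) l < f (\<phi> 0) l" by (rule less_funE)
  then have "l < k" using f [rule_format, of "\<phi> 0"] by (metis (mono_tags, lifting) case_prodD mem_Collect_eq not_le not_less_zero)
  then show False using \<phi>(2) [of l] l by simp
qed

lemma less_fun_add:
  assumes "less_fun a (b :: 'a :: linorder \<Rightarrow> nat)"
  shows "less_fun (\<lambda>i. a i + c i) (\<lambda>i. b i + c i)"
proof -
  from assms obtain k where "a k < b k" "\<And>k'. k' < k \<Longrightarrow> a k' = b k'" by (rule less_funE) (rule that)
  then show ?thesis by (intro less_funI exI [of _ k]) simp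
qed

text \<open>\<open>\<phi>\<close> acts as a monomial presentation over a polynomial ring in
  \<open>k\<close> variables, of degree one below \<open>l\<close> and of degree zero from
  \<open>l\<close> on. \<open>W1\<close> and \<open>W2\<close> are stable under the variables, so
  the function counted is the Hilbert function of a subquotient.\<close>

theorem eventually_poly_card_image:
  fixes \<phi> :: "(nat \<Rightarrow> nat) \<Rightarrow> 'y" and k l :: nat
  defines "S \<equiv> {a. \<forall>i\<ge>k. a i = 0}"
  assumes l: "l \<le> k"
    and cong: "\<And>a a' c. a \<in> S \<Longrightarrow> a' \<in> S \<Longrightarrow> c \<in> S \<Longrightarrow> \<phi> a = \<phi> a' \<Longrightarrow>
      \<phi> (\<lambda>i. a i + c i) = \<phi> (\<lambda>i. a' i + c i)"
    and lev: "\<And>a a'. a \<in> S \<Longrightarrow> a' \<in> S \<Longrightarrow> \<phi> a = \<phi> a' \<Longrightarrow> sum a {..<l} = sum a' {..<l}"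
    and W1: "\<And>a c. a \<in> S \<Longrightarrow> c \<in> S \<Longrightarrow> \<phi> a \<in> W1 \<Longrightarrow> \<phi> (\<lambda>i. a i + c i) \<in> W1"
    and W2: "\<And>a c. a \<in> S \<Longrightarrow> c \<in> S \<Longrightarrow> \<phi> a \<in> W2 \<Longrightarrow> \<phi> (\<lambda>i. a i + c i) \<in> W2"
    and fin: "\<And>n. finite (\<phi> ` {a \<in> S. sum a {..<l} = n} \<inter> (W1 - W2))"
  shows "eventually_poly (\<lambda>n. card (\<phi> ` {a \<in> S. sum a {..<l} = n} \<inter> (W1 - W2)))"
proof -
  define cut where "cut a = (\<lambda>i. if i < k then a i else 0)" for a :: "nat \<Rightarrow> nat"
  have cutS: "cut a \<in> S" for a by (simp add: cut_def S_def)
  have cut_id: "cut a = a" if "a \<in> S" for a using that by (auto simp: cut_def S_def fun_eq_iff)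
  have add_S: "(\<lambda>i. a i + c i) \<in> S" if "a \<in> S" "c \<in> S" for a c using that by (simp add: S_def)
  have cut_split: "\<exists>c\<in>S. cut v = (\<lambda>i. cut u i + c i)" if "\<And>i. i \<in> {..<k} \<Longrightarrow> u i \<le> v i" for u v
    by (rule bexI [of _ "\<lambda>i. cut v i - cut u i"]) (use that in \<open>auto simp: cut_def S_def\<close>)
  define U1 where "U1 = {a. \<phi> (cut a) \<in> W1}"
  define U2 where "U2 = {a. \<phi> (cut a) \<in> W2}"
  \<comment> \<open>Tuples with a lexicographically smaller one in their fibre. Fibres and order are
    both compatible with addition, so this is an upset.\<close>
  define U3 where "U3 = {a. \<exists>b\<in>S. less_fun b (cut a) \<and> \<phi> b = \<phi> (cut a)}"
  have up1: "upset_on {..<k} U1"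
    unfolding upset_on_def
  proof (intro ballI allI impI)
    fix u v assume u: "u \<in> U1" and uv: "\<forall>i\<in>{..<k}. u i \<le> v i"
    from cut_split [of u v] uv obtain c where "c \<in> S" "cut v = (\<lambda>i. cut u i + c i)" by blast
    then show "v \<in> U1" using u W1 [OF cutS] by (simp add: U1_def)
  qed
  have up2: "upset_on {..<k} U2"
    unfolding upset_on_def
  proof (intro ballI allI impI)
    fix u v assume u: "u \<in> U2" and uv: "\<forall>i\<in>{..<k}. u i \<le> v i"
    from cut_split [of u v] uv obtain c where "c \<in> S" "cut v = (\<lambda>i. cut u i + c i)" by blast
    then show "v \<in> U2" using u W2 [OF cutS] by (simp add: U2_def)
  qed
  have up3: "upset_on {..<k} U3"
    unfolding upset_on_def
  proof (intro ballI allI impI)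
    fix u v assume u: "u \<in> U3" and uv: "\<forall>i\<in>{..<k}. u i \<le> v i"
    from cut_split [of u v] uv obtain c where c: "c \<in> S" "cut v = (\<lambda>i. cut u i + c i)" by blast
    from u obtain b where b: "b \<in> S" "less_fun b (cut u)" "\<phi> b = \<phi> (cut u)" by (auto simp: U3_def)
    have "(\<lambda>i. b i + c i) \<in> S" using b c add_S by blast
    moreover have "less_fun (\<lambda>i. b i + c i) (cut v)" unfolding c(2) by (rule less_fun_add [OF b(2)])
    moreover have "\<phi> (\<lambda>i. b i + c i) = \<phi> (cut v)" unfolding c(2) by (rule cong [OF b(1) cutS c(1) b(3)])
    ultimately show "v \<in> U3" by (auto simp: U3_def)
  qed
  obtain B1 where B1: "\<And>B u. B \<ge> B1 \<Longrightarrow> (\<lambda>k. min (u k) B) \<in> U1 \<longleftrightarrow> u \<in> U1"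
    by (rule upset_box [OF finite_lessThan up1]) (rule that)
  obtain B2 where B2: "\<And>B u. B \<ge> B2 \<Longrightarrow> (\<lambda>k. min (u k) B) \<in> U2 \<longleftrightarrow> u \<in> U2"
    by (rule upset_box [OF finite_lessThan up2]) (rule that)
  obtain B3 where B3: "\<And>B u. B \<ge> B3 \<Longrightarrow> (\<lambda>k. min (u k) B) \<in> U3 \<longleftrightarrow> u \<in> U3"
    by (rule upset_box [OF finite_lessThan up3]) (rule that)
  define B where "B = B1 + B2 + B3"
  define V where "V = {a \<in> S. a \<in> U1 \<and> a \<notin> U2 \<and> a \<notin> U3}"
  interpret boxed "{..<k}" "{..<l}" V B
  proof
    show "finite {..<k}" "{..<l} \<subseteq> {..<k}" using l by auto
    show "u i = 0" if "u \<in> V" "i \<notin> {..<k}" for u i using that by (auto simp: V_def S_def)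
    fix u :: "nat \<Rightarrow> nat" assume u: "\<And>i. i \<notin> {..<k} \<Longrightarrow> u i = 0"
    then have "u \<in> S" "(\<lambda>i. min (u i) B) \<in> S" by (auto simp: S_def)
    then show "(\<lambda>i. min (u i) B) \<in> V \<longleftrightarrow> u \<in> V"
      using B1 [of B u] B2 [of B u] B3 [of B u] by (simp add: V_def B_def)
  qed
  have "inj_on \<phi> V"
  proof (rule inj_onI, rule ccontr)
    fix a b assume a: "a \<in> V" and b: "b \<in> V" and eq: "\<phi> a = \<phi> b" and ne: "a \<noteq> b"
    have aS: "a \<in> S" and bS: "b \<in> S" using a b by (auto simp: V_def)
    have "{i. a i \<noteq> b i} \<subseteq> {..<k}" using aS bS by (auto simp: S_def) (metis not_le)
    then have "finite {i. a i \<noteq> b i}" using finite_subset by blast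
    from less_fun_trichotomy [OF this] ne have "less_fun a b \<or> less_fun b a" by simp
    then show False
    proof
      assume "less_fun a b"
      then have "b \<in> U3" using aS bS eq by (auto simp: U3_def cut_id)
      then show False using b by (simp add: V_def)
    next
      assume "less_fun b a"
      then have "a \<in> U3" using aS bS eq by (auto simp: U3_def cut_id)
      then show False using a by (simp add: V_def)
    qed
  qed
  then have inj: "inj_on \<phi> (level n)" for n by (rule inj_on_subset) (auto simp: level_def)
  have in_level: "a \<in> level n \<longleftrightarrow> a \<in> S \<and> \<phi> a \<in> W1 \<and> \<phi> a \<notin> W2 \<and> a \<notin> U3 \<and> sum a {..<l} = n" for a n
    unfolding level_def by (auto simp: V_def U1_def U2_def cut_id)
  have img: "\<phi> ` level n = \<phi> ` {a \<in> S. sum a {..<l} = n} \<inter> (W1 - W2)" for n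
  proof
    show "\<phi> ` level n \<subseteq> \<phi> ` {a \<in> S. sum a {..<l} = n} \<inter> (W1 - W2)"
      by (auto simp: in_level)
    show "\<phi> ` {a \<in> S. sum a {..<l} = n} \<inter> (W1 - W2) \<subseteq> \<phi> ` level n"
    proof
      fix y assume y: "y \<in> \<phi> ` {a \<in> S. sum a {..<l} = n} \<inter> (W1 - W2)"
      then obtain a0 where a0: "a0 \<in> S" "sum a0 {..<l} = n" "y = \<phi> a0" by blast
      define Q where "Q = {a \<in> S. \<phi> a = y}"
      have "a0 \<in> Q" using a0 by (simp add: Q_def)
      from wfE_min [OF wf_less_fun_finite_support [of k] this] obtain a where a: "a \<in> Q"
        "\<And>b. (b, a) \<in> {(b, a). less_fun b a \<and> (\<forall>i\<ge>k. a i = 0) \<and> (\<forall>i\<ge>k. b i = 0)} \<Longrightarrow> b \<notin> Q" by auto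
      have aS: "a \<in> S" and \<phi>a: "\<phi> a = y" using a(1) by (auto simp: Q_def)
      have "a \<notin> U3"
      proof
        assume "a \<in> U3"
        then obtain b where b: "b \<in> S" "less_fun b a" "\<phi> b = \<phi> a" using aS by (auto simp: U3_def cut_id)
        then have "b \<in> Q" by (simp add: Q_def \<phi>a)
        then show False using a(2) [of b] b aS by (simp add: S_def)
      qed
      moreover have "sum a {..<l} = n" using lev [OF aS a0(1)] \<phi>a a0 by simp
      ultimately have "a \<in> level n" using y aS \<phi>a by (simp add: in_level)
      then show "y \<in> \<phi> ` level n" using \<phi>a by blast
    qed
  qed
  \<comment> \<open>A free coordinate of degree zero would put infinitely many elements into one
    level, against \<open>fin\<close>.\<close>
  have "free w \<subseteq> {..<l}" if w: "w \<in> corner" for w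
  proof (rule ccontr)
    assume "\<not> free w \<subseteq> {..<l}"
    then obtain j where j: "j \<in> free w" "j \<notin> {..<l}" by blast
    let ?g = "\<lambda>m i. w i + (if i = j then m else 0)"
    have "?g m \<in> level (sum w {..<l})" for m
    proof -
      have "(\<lambda>i. w i + (if i = j then m else 0)) \<in> V"
        by (rule add_free_in(1) [OF w]) (use j in auto)
      moreover have "sum (?g m) {..<l} = sum w {..<l}" by (rule sum.cong) (use j in auto)
      ultimately show ?thesis by (simp add: level_def)
    qed
    then have sub: "range ?g \<subseteq> level (sum w {..<l})" by (rule image_subsetI)
    have inj_g: "inj ?g"
    proof (rule injI)
      fix m m' assume "?g m = ?g m'"
      from fun_cong [OF this, of j] show "m = m'" by simp
    qed
    have "finite (level (sum w {..<l}))"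
      using fin [of "sum w {..<l}"] unfolding img [symmetric] by (rule finite_imageD) (rule inj)
    with sub have "finite (range ?g)" by (rule finite_subset)
    then have "finite (UNIV :: nat set)" using inj_g by (rule finite_imageD)
    then show False by simp
  qed
  then have "eventually_poly (\<lambda>n. card (level n))" by (rule eventually_poly_card_level)
  moreover have "card (level n) = card (\<phi> ` {a \<in> S. sum a {..<l} = n} \<inter> (W1 - W2))" for n
    unfolding img [symmetric] by (rule card_image [OF inj, symmetric])
  ultimately show ?thesis by simp
qed

section \<open>Powers of a localised monomial ideal\<close>

text \<open>\<open>pw G Z n\<close> consists of the exponents of the monomials in the \<open>n\<close>-th power of the monomial
  ideal generated by \<open>G\<close>, after the variables in \<open>Z\<close> have been inverted.\<close>

definition pw :: "('n::finite \<Rightarrow> nat) set \<Rightarrow> 'n set \<Rightarrow> nat \<Rightarrow> ('n \<Rightarrow> nat) set" where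
  "pw G Z n = {u. \<exists>a :: ('n \<Rightarrow> nat) \<Rightarrow> nat. sum a G = n \<and> (\<forall>i. i \<notin> Z \<longrightarrow> (\<Sum>g\<in>G. a g * g i) \<le> u i)}"

text \<open>The saturation by the ideal of the variables outside \<open>Z\<close>: some power of
  each of these variables has to carry the monomial into the power of the ideal, which is tested by
  inverting them one at a time.\<close>

definition sat :: "('n::finite \<Rightarrow> nat) set \<Rightarrow> 'n set \<Rightarrow> nat \<Rightarrow> ('n \<Rightarrow> nat) set" where
  "sat G Z n = {u. \<forall>i. i \<notin> Z \<longrightarrow> u \<in> pw G (insert i Z) n}"

text \<open>A monomial basis of the torsion. Exponents of inverted variables are normalised to zero,
  so that every class has one representative and the length is a cardinality.\<close>

definition loc_tor :: "('n::finite \<Rightarrow> nat) set \<Rightarrow> 'n set \<Rightarrow> nat \<Rightarrow> ('n \<Rightarrow> nat) set" where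
  "loc_tor G Z n = {u. (\<forall>i\<in>Z. u i = 0) \<and> u \<in> sat G Z n \<and> u \<notin> pw G Z n}"

lemma pwI: "sum a G = n \<Longrightarrow> (\<And>i. i \<notin> Z \<Longrightarrow> (\<Sum>g\<in>G. a g * g i) \<le> u i) \<Longrightarrow> u \<in> pw G Z n"
  by (auto simp: pw_def)

lemma pwE:
  assumes "u \<in> pw G Z n"
  obtains a where "sum a G = n" "\<And>i. i \<notin> Z \<Longrightarrow> (\<Sum>g\<in>G. a g * g i) \<le> u i"
  using assms by (auto simp: pw_def)

lemma pw_upset: "u \<in> pw G Z n \<Longrightarrow> (\<And>i. i \<notin> Z \<Longrightarrow> u i \<le> v i) \<Longrightarrow> v \<in> pw G Z n"
  by (erule pwE, rule pwI) (auto intro: order_trans)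

lemma pw_mono: "u \<in> pw G Z n \<Longrightarrow> Z \<subseteq> Z' \<Longrightarrow> u \<in> pw G Z' n"
  by (erule pwE, rule pwI) auto

lemma pw_add:
  assumes "u \<in> pw G Z m" "v \<in> pw G Z n"
  shows "(\<lambda>i. u i + v i) \<in> pw G Z (m + n)"
proof -
  obtain a where a: "sum a G = m" "\<And>i. i \<notin> Z \<Longrightarrow> (\<Sum>g\<in>G. a g * g i) \<le> u i"
    by (rule pwE [OF assms(1)]) (rule that)
  obtain b where b: "sum b G = n" "\<And>i. i \<notin> Z \<Longrightarrow> (\<Sum>g\<in>G. b g * g i) \<le> v i"
    by (rule pwE [OF assms(2)]) (rule that)
  show ?thesis
  proof (rule pwI)
    show "(\<Sum>g\<in>G. a g + b g) = m + n" using a b by (simp add: sum.distrib)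
    show "(\<Sum>g\<in>G. (a g + b g) * g i) \<le> u i + v i" if "i \<notin> Z" for i
      using a(2) [OF that] b(2) [OF that] by (simp add: distrib_right sum.distrib)
  qed
qed

lemma pw_0: "u \<in> pw G Z 0"
  by (rule pwI [of "\<lambda>_. 0"]) auto

lemma pw_scale: "u \<in> pw G Z n \<Longrightarrow> (\<lambda>i. k * u i) \<in> pw G Z (k * n)"
  by (induction k) (use pw_add [of u G Z n] in \<open>auto simp: pw_0\<close>)

lemma pw_gen:
  assumes "finite G" "g \<in> G"
  shows "g \<in> pw G Z 1"
  by (rule pwI [of "\<lambda>h. if h = g then 1 else 0"])
    (use assms in \<open>auto simp: if_distrib [of "\<lambda>x. x * _"] cong: if_cong\<close>)

lemma pw_sum:
  assumes "finite A" "\<And>j. j \<in> A \<Longrightarrow> v j \<in> pw G Z (d j)"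
  shows "(\<lambda>i. \<Sum>j\<in>A. c j * v j i) \<in> pw G Z (\<Sum>j\<in>A. c j * d j)"
  using assms
proof (induction A rule: finite_induct)
  case empty
  show ?case by (simp add: pw_0)
next
  case (insert j A)
  then have "(\<lambda>i. c j * v j i + (\<Sum>j\<in>A. c j * v j i)) \<in> pw G Z (c j * d j + (\<Sum>j\<in>A. c j * d j))"
    by (intro pw_add pw_scale) auto
  then show ?case using insert.hyps by simp
qed

lemma sum_reduce:
  fixes a :: "'a \<Rightarrow> nat"
  assumes "finite G" "n \<le> sum a G"
  shows "\<exists>b. (\<forall>g. b g \<le> a g) \<and> sum b G = n"
  using assms
proof (induction G arbitrary: n rule: finite_induct)
  case empty
  then show ?case by (intro exI [of _ "\<lambda>_. 0"]) simp
next
  case (insert x G)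
  have "n - min n (a x) \<le> sum a G" using insert by auto
  from insert.IH [OF this] obtain b where b: "\<forall>g. b g \<le> a g" "sum b G = n - min n (a x)" by blast
  let ?b = "b(x := min n (a x))"
  have "sum ?b G = sum b G" by (rule sum.cong) (use insert.hyps in auto)
  then have "sum ?b (insert x G) = n" using insert.hyps b(2) by simp
  then show ?case using b(1) by (intro exI [of _ ?b]) auto
qed

lemma pw_antimono:
  assumes "finite G" "u \<in> pw G Z m" "n \<le> m"
  shows "u \<in> pw G Z n"
proof -
  obtain a where a: "sum a G = m" "\<And>i. i \<notin> Z \<Longrightarrow> (\<Sum>g\<in>G. a g * g i) \<le> u i"
    by (rule pwE [OF assms(2)]) (rule that)
  from sum_reduce [OF assms(1), of n a] a(1) assms(3)
  obtain b where b: "\<forall>g. b g \<le> a g" "sum b G = n" by auto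
  show ?thesis
  proof (rule pwI [OF b(2)])
    fix i assume "i \<notin> Z"
    have "(\<Sum>g\<in>G. b g * g i) \<le> (\<Sum>g\<in>G. a g * g i)" by (rule sum_mono) (use b(1) in simp)
    then show "(\<Sum>g\<in>G. b g * g i) \<le> u i" using a(2) [OF \<open>i \<notin> Z\<close>] by simp
  qed
qed

lemma sat_upset: "u \<in> sat G Z n \<Longrightarrow> (\<And>i. i \<notin> Z \<Longrightarrow> u i \<le> v i) \<Longrightarrow> v \<in> sat G Z n"
  unfolding sat_def by (auto intro: pw_upset)

lemma sat_add: "u \<in> sat G Z m \<Longrightarrow> v \<in> sat G Z n \<Longrightarrow> (\<lambda>i. u i + v i) \<in> sat G Z (m + n)"
  unfolding sat_def by (auto intro: pw_add)

lemma sat_scale: "u \<in> sat G Z n \<Longrightarrow> (\<lambda>i. k * u i) \<in> sat G Z (k * n)"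
  unfolding sat_def by (auto intro: pw_scale)

lemma pw_sat: "u \<in> pw G Z n \<Longrightarrow> u \<in> sat G Z n"
  unfolding sat_def by (auto intro: pw_mono)

definition gen_bound :: "('n::finite \<Rightarrow> nat) set \<Rightarrow> nat" where
  "gen_bound G = (\<Sum>g\<in>G. \<Sum>i\<in>UNIV. g i)"

lemma sum_le_gen_bound:
  assumes "finite G" "g \<in> G"
  shows "sum g A \<le> gen_bound G"
proof -
  have "sum g A \<le> sum g UNIV" by (rule sum_mono2) auto
  also have "\<dots> \<le> gen_bound G"
    unfolding gen_bound_def using assms by (intro member_le_sum [of g G "\<lambda>g. sum g UNIV"]) auto
  finally show ?thesis .
qed

lemma le_gen_bound: "finite G \<Longrightarrow> g \<in> G \<Longrightarrow> g i \<le> gen_bound G"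
  using sum_le_gen_bound [of G g "{i}"] by simp

text \<open>No sum of \<open>n\<close> generators exceeds \<open>gen_bound G * n\<close> in a
  coordinate. Where \<open>u\<close> is that large, inverting the variable changes nothing, so
  \<open>u\<close> would already be in the power.\<close>

lemma loc_tor_bound:
  assumes "finite G" "u \<in> loc_tor G Z n" "i \<notin> Z"
  shows "u i < gen_bound G * n"
proof (rule ccontr)
  assume "\<not> u i < gen_bound G * n"
  then have le: "gen_bound G * n \<le> u i" by simp
  have "u \<in> pw G (insert i Z) n" using assms by (auto simp: loc_tor_def sat_def)
  then obtain a where a: "sum a G = n" "\<And>j. j \<notin> insert i Z \<Longrightarrow> (\<Sum>g\<in>G. a g * g j) \<le> u j"
    by (rule pwE) (rule that)
  have "(\<Sum>g\<in>G. a g * g i) \<le> (\<Sum>g\<in>G. a g * gen_bound G)"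
    by (rule sum_mono) (use assms(1) le_gen_bound in auto)
  also have "\<dots> = gen_bound G * n" using a(1) by (simp flip: sum_distrib_right)
  finally have i: "(\<Sum>g\<in>G. a g * g i) \<le> u i" using le by simp
  have "u \<in> pw G Z n"
  proof (rule pwI [OF a(1)])
    fix j assume "j \<notin> Z"
    then show "(\<Sum>g\<in>G. a g * g j) \<le> u j" using a(2) [of j] i by (cases "j = i") auto
  qed
  then show False using assms(2) by (simp add: loc_tor_def)
qed

lemma card_box_le:
  fixes S :: "('n::finite \<Rightarrow> nat) set"
  assumes "\<And>u i. u \<in> S \<Longrightarrow> i \<in> Z \<Longrightarrow> u i = 0" "\<And>u i. u \<in> S \<Longrightarrow> i \<notin> Z \<Longrightarrow> u i < c"
  shows "finite S \<and> card S \<le> c ^ card (- Z)"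
proof -
  let ?P = "PiE (- Z) (\<lambda>_. {..<c})"
  have inj: "inj_on (\<lambda>u. restrict u (- Z)) S"
  proof (rule inj_onI, rule ext)
    fix u v i assume u: "u \<in> S" and v: "v \<in> S" and eq: "restrict u (- Z) = restrict v (- Z)"
    show "u i = v i" using fun_cong [OF eq, of i] assms(1) [OF u, of i] assms(1) [OF v, of i]
      by (cases "i \<in> Z") auto
  qed
  have sub: "(\<lambda>u. restrict u (- Z)) ` S \<subseteq> ?P" using assms(2) by (intro image_subsetI) auto
  have fin: "finite ?P" by (intro finite_PiE) auto
  have "finite S" using inj sub fin by (rule inj_on_finite)
  moreover have "card S \<le> card ?P" using inj sub fin by (rule card_inj_on_le)
  ultimately show ?thesis by (simp add: card_PiE)
qed

lemma loc_tor_card: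
  assumes "finite G"
  shows "finite (loc_tor G Z n)" "card (loc_tor G Z n) \<le> (gen_bound G * n) ^ card (- Z)"
proof -
  have "finite (loc_tor G Z n) \<and> card (loc_tor G Z n) \<le> (gen_bound G * n) ^ card (- Z)"
    by (rule card_box_le) (use loc_tor_bound [OF assms] in \<open>auto simp: loc_tor_def\<close>)
  then show "finite (loc_tor G Z n)" "card (loc_tor G Z n) \<le> (gen_bound G * n) ^ card (- Z)" by auto
qed

text \<open>If \<open>u\<close> is not even in a lower power, rounding the coefficients down shows that a box of
  volume of order \<open>N ^ card (- Z)\<close> next to a multiple of \<open>u\<close> avoids the \<open>N\<close>-th power.\<close>

lemma loc_tor_growth:
  assumes G: "finite G" "G \<noteq> {}" and n: "n \<ge> card G"
    and u: "u \<in> sat G Z n" "u \<notin> pw G Z (n - card G)"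
  shows "\<exists>c>0. \<forall>\<^sub>F N in sequentially. c * real N ^ card (- Z) \<le> real (card (loc_tor G Z N))"
proof -
  let ?q = "card G" and ?m = "gen_bound G" and ?r = "card (- Z)"
  have q: "?q \<ge> 1" using G by (simp add: Suc_le_eq card_gt_0_iff)
  then have n1: "n \<ge> 1" using n by simp
  from G obtain g0 where g0: "g0 \<in> G" by blast
  have main: "(N div n - n * ?m) ^ ?r \<le> card (loc_tor G Z N)" if k1: "N div n \<ge> 1" for N
  proof -
    define k l where "k = N div n" and "l = N mod n"
    have N: "N = k * n + l" and l: "l < n" using n1 by (auto simp: k_def l_def)
    have k: "k \<ge> 1" using k1 by (simp add: k_def)
    \<comment> \<open>\<open>k * u\<close> is saturated of level k n, and \<open>l\<close> copies of
      \<open>g0\<close> supply the missing level. The side of the box for \<open>w\<close> keeps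
      each coordinate below k u + k.\<close>
    let ?f = "\<lambda>w i. if i \<in> Z then 0 else k * u i + l * g0 i + w i"
    let ?P = "PiE (- Z) (\<lambda>_. {..<k - n * ?m})"
    have inj: "inj_on ?f ?P"
    proof (rule inj_onI)
      fix v w assume v: "v \<in> ?P" and w: "w \<in> ?P" and eq: "?f v = ?f w"
      show "v = w"
      proof (rule PiE_ext [OF v w])
        fix i assume "i \<in> - Z"
        then show "v i = w i" using fun_cong [OF eq, of i] by simp
      qed
    qed
    have maps: "?f w \<in> loc_tor G Z N" if w: "w \<in> ?P" for w
    proof -
      have "(\<lambda>i. k * u i + l * g0 i) \<in> sat G Z (k * n + l * 1)"
        by (intro sat_add sat_scale u pw_sat [OF pw_gen] G g0)
      then have "(\<lambda>i. k * u i + l * g0 i) \<in> sat G Z N" by (simp add: N)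
      then have s: "?f w \<in> sat G Z N" by (rule sat_upset) auto
      have "?f w \<notin> pw G Z N"
      proof
        assume "?f w \<in> pw G Z N"
        then obtain a where a: "sum a G = N" "\<And>i. i \<notin> Z \<Longrightarrow> (\<Sum>g\<in>G. a g * g i) \<le> ?f w i"
          by (rule pwE) (rule that)
        \<comment> \<open>Rounding down costs less than one unit per generator, hence at most
          \<open>card G\<close> in level, while the strict bound k u + k still yields at most
          \<open>u\<close> after division by \<open>k\<close>.\<close>
        define b where "b g = a g div k" for g
        have "u \<in> pw G Z (sum b G)"
        proof (rule pwI [OF refl])
          fix i assume i: "i \<notin> Z"
          have "l * g0 i \<le> n * ?m" using l le_gen_bound [OF G(1) g0, of i] by (intro mult_mono) auto
          moreover have "w i < k - n * ?m" using w i by auto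
          ultimately have lt: "?f w i < k * u i + k" using i by simp
          have "k * (\<Sum>g\<in>G. b g * g i) = (\<Sum>g\<in>G. (k * b g) * g i)"
            by (simp add: sum_distrib_left mult.assoc)
          also have "\<dots> \<le> (\<Sum>g\<in>G. a g * g i)" by (rule sum_mono) (simp add: b_def)
          also have "\<dots> \<le> ?f w i" by (rule a(2) [OF i])
          finally have "k * (\<Sum>g\<in>G. b g * g i) < k * (u i + 1)" using lt by simp
          then have "(\<Sum>g\<in>G. b g * g i) < u i + 1" by (rule mult_left_less_imp_less) simp
          then show "(\<Sum>g\<in>G. b g * g i) \<le> u i" by simp
        qed
        moreover have "n - ?q \<le> sum b G"
        proof -
          have "a g \<le> k * b g + (k - 1)" for g
          proof -
            have "a g = k * b g + a g mod k" by (simp add: b_def)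
            moreover have "a g mod k \<le> k - 1" using k by (metis Suc_pred' less_Suc_eq_le mod_less_divisor zero_less_one order_less_le_trans)
            ultimately show ?thesis by linarith
          qed
          then have "sum a G \<le> (\<Sum>g\<in>G. k * b g + (k - 1))" by (intro sum_mono)
          also have "\<dots> = k * sum b G + ?q * (k - 1)" by (simp add: sum.distrib sum_distrib_left)
          also have "\<dots> \<le> k * (sum b G + ?q)" by (simp add: distrib_left mult.commute)
          finally have "k * n \<le> k * (sum b G + ?q)" using a(1) N by linarith
          then show ?thesis using k by simp
        qed
        ultimately have "u \<in> pw G Z (n - ?q)" using pw_antimono [OF G(1)] by blast
        then show False using u(2) by contradiction
      qed
      then show ?thesis using s by (simp add: loc_tor_def)
    qed
    have "card ?P \<le> card (loc_tor G Z N)"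
      by (rule card_inj_on_le [OF inj]) (use maps loc_tor_card [OF G(1)] in auto)
    then show ?thesis by (simp add: card_PiE k_def)
  qed
  have "(1 / (2 * real n)) ^ ?r * real N ^ ?r \<le> real (card (loc_tor G Z N))"
    if N: "N \<ge> 2 * n * (n * ?m + 1)" for N
  proof -
    \<comment> \<open>For such \<open>N\<close> the side \<open>N div n - n * ?m\<close> of the box
      is at least N / (2n), which is where the constant comes from.\<close>
    have N': "N div n \<ge> 2 * (n * ?m + 1)"
    proof -
      have "2 * (n * ?m + 1) = (n * (2 * (n * ?m + 1))) div n" using n1 by simp
      also have "\<dots> \<le> N div n" using N by (intro div_le_mono) (simp add: algebra_simps)
      finally show ?thesis .
    qed
    then have le: "n * ?m \<le> N div n" by simp
    have "N mod n < n" using n1 by simp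
    then have "N < (N div n + 1) * n" using div_mult_mod_eq [of N n] unfolding distrib_right by linarith
    then have "real N < (real (N div n) + 1) * real n" by (metis of_nat_1 of_nat_add of_nat_less_iff of_nat_mult)
    moreover have "real (N div n) \<ge> 2 * (real n * real ?m + 1)"
      using of_nat_mono [OF N', where 'a = real] by simp
    then have "(real (N div n) + 1) * real n \<le> 2 * (real (N div n) - real n * real ?m) * real n"
      by (intro mult_right_mono) auto
    ultimately have "real N \<le> 2 * (real (N div n) - real n * real ?m) * real n" by linarith
    then have "1 / (2 * real n) * real N \<le> real (N div n - n * ?m)"
      using n1 le by (simp add: field_simps of_nat_diff)
    then have "(1 / (2 * real n) * real N) ^ ?r \<le> real (N div n - n * ?m) ^ ?r"
      by (rule power_mono) simp
    also have "\<dots> = real ((N div n - n * ?m) ^ ?r)" by simp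
    also have "\<dots> \<le> real (card (loc_tor G Z N))" using main [of N] N' by (intro of_nat_mono) auto
    finally show ?thesis by (simp only: power_mult_distrib)
  qed
  then have "\<forall>\<^sub>F N in sequentially. (1 / (2 * real n)) ^ ?r * real N ^ ?r \<le> real (card (loc_tor G Z N))"
    unfolding eventually_sequentially by blast
  moreover have "(1 / (2 * real n)) ^ ?r > 0" using n1 by simp
  ultimately show ?thesis by blast
qed

text \<open>Under \<open>sub\<close> the torsion of level n + q consists of points of the n-th
  power, that is, of sums of n generators and some unit vectors. Shifted by \<open>q\<close>, the
  saturations and the powers are stable under adding both, and the torsion is their
  difference.\<close>

lemma loc_tor_eventually_poly:
  assumes G: "finite G" and sub: "\<And>n. sat G Z (n + q) \<subseteq> pw G Z n"
  shows "eventually_poly (\<lambda>n. card (loc_tor G Z n))"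
proof -
  define l where "l = card G"
  define r where "r = card (- Z)"
  obtain gs where gs: "bij_betw gs {0..<l} G" using ex_bij_betw_nat_finite [OF G] by (auto simp: l_def)
  obtain ds where ds: "bij_betw ds {0..<r} (- Z)"
    using ex_bij_betw_nat_finite [of "- Z"] by (auto simp: r_def)
  define pt where "pt a i = (if i \<in> Z then 0 else (\<Sum>j<l. a j * gs j i) + (\<Sum>j<r. if ds j = i then a (l + j) else 0))"
    for a :: "nat \<Rightarrow> nat" and i
  \<comment> \<open>The level is recorded because one exponent vector lies in several
    powers.\<close>
  define \<phi> where "\<phi> a = (pt a, sum a {..<l})" for a
  have pt_add: "pt (\<lambda>j. a j + c j) = (\<lambda>i. pt a i + pt c i)" for a c
  proof
    fix i
    have "(\<Sum>j<r. if ds j = i then a (l + j) + c (l + j) else 0)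
      = (\<Sum>j<r. (if ds j = i then a (l + j) else 0) + (if ds j = i then c (l + j) else 0))"
      by (rule sum.cong) auto
    then show "pt (\<lambda>j. a j + c j) i = pt a i + pt c i"
      by (simp add: pt_def sum.distrib distrib_right)
  qed
  have \<phi>_add: "\<phi> (\<lambda>j. a j + c j) = (\<lambda>i. pt a i + pt c i, sum a {..<l} + sum c {..<l})" for a c
    by (simp add: \<phi>_def pt_add sum.distrib)
  have pt_pw: "pt a \<in> pw G Z (sum a {..<l})" for a
  proof -
    have "(\<lambda>i. \<Sum>j<l. a j * gs j i) \<in> pw G Z (\<Sum>j<l. a j * 1)"
    proof (rule pw_sum)
      fix j assume "j \<in> {..<l}"
      then have "gs j \<in> G" using gs by (auto simp: bij_betw_def)
      then show "gs j \<in> pw G Z 1" by (rule pw_gen [OF G])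
    qed simp
    then have "(\<lambda>i. \<Sum>j<l. a j * gs j i) \<in> pw G Z (sum a {..<l})" by simp
    then show ?thesis by (rule pw_upset) (simp add: pt_def)
  qed
  define W1 where "W1 = {(u, m). u \<in> sat G Z (m + q)}"
  define W2 where "W2 = {(u, m). u \<in> pw G Z (m + q)}"
  have img: "\<phi> ` {a \<in> {a. \<forall>i\<ge>l + r. a i = 0}. sum a {..<l} = n} \<inter> (W1 - W2)
      = (\<lambda>u. (u, n)) ` loc_tor G Z (n + q)" for n
  proof
    show "\<phi> ` {a \<in> {a. \<forall>i\<ge>l + r. a i = 0}. sum a {..<l} = n} \<inter> (W1 - W2) \<subseteq> (\<lambda>u. (u, n)) ` loc_tor G Z (n + q)"
    proof
      fix y assume y: "y \<in> \<phi> ` {a \<in> {a. \<forall>i\<ge>l + r. a i = 0}. sum a {..<l} = n} \<inter> (W1 - W2)"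
      then obtain a where a: "y = (pt a, n)" by (auto simp: \<phi>_def)
      have "pt a \<in> loc_tor G Z (n + q)" using y by (auto simp: loc_tor_def a W1_def W2_def) (simp add: pt_def)
      then show "y \<in> (\<lambda>u. (u, n)) ` loc_tor G Z (n + q)" using a by blast
    qed
    show "(\<lambda>u. (u, n)) ` loc_tor G Z (n + q) \<subseteq> \<phi> ` {a \<in> {a. \<forall>i\<ge>l + r. a i = 0}. sum a {..<l} = n} \<inter> (W1 - W2)"
    proof (rule image_subsetI)
      fix u assume u: "u \<in> loc_tor G Z (n + q)"
      then have "u \<in> sat G Z (n + q)" by (simp add: loc_tor_def)
      with sub [of n] have "u \<in> pw G Z n" by (rule subsetD)
      then obtain b where b: "sum b G = n" "\<And>i. i \<notin> Z \<Longrightarrow> (\<Sum>g\<in>G. b g * g i) \<le> u i"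
        by (rule pwE) (rule that)
      define a where "a j = (if j < l then b (gs j) else if j < l + r then
          u (ds (j - l)) - (\<Sum>g\<in>G. b g * g (ds (j - l))) else 0)" for j
      have sum_gs: "(\<Sum>j<l. f (gs j)) = sum f G" for f :: "('a \<Rightarrow> nat) \<Rightarrow> nat"
        using sum.reindex_bij_betw [OF gs, of f] by (simp add: atLeast0LessThan)
      have "pt a i = u i" for i
      proof (cases "i \<in> Z")
        case True
        then show ?thesis using u by (simp add: pt_def loc_tor_def)
      next
        case False
        then obtain j where j: "j < r" "ds j = i" using ds by (force simp: bij_betw_def)
        have "ds j' = i \<longleftrightarrow> j' = j" if "j' < r" for j'
          using ds j that by (auto simp: bij_betw_def inj_on_def)
        then have "(\<Sum>j'<r. if ds j' = i then a (l + j') else 0) = (\<Sum>j'<r. if j' = j then a (l + j') else 0)"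
          by (intro sum.cong) auto
        also have "\<dots> = a (l + j)" using j by simp
        also have "\<dots> = u i - (\<Sum>g\<in>G. b g * g i)" using j by (simp add: a_def)
        finally have "(\<Sum>j'<r. if ds j' = i then a (l + j') else 0) = u i - (\<Sum>g\<in>G. b g * g i)" .
        moreover have "(\<Sum>j<l. a j * gs j i) = (\<Sum>g\<in>G. b g * g i)"
          using sum_gs [of "\<lambda>g. b g * g i"] by (simp add: a_def)
        ultimately show ?thesis using b(2) [OF False] False by (simp add: pt_def)
      qed
      then have pt: "pt a = u" by (rule ext)
      have lev: "sum a {..<l} = n" using sum_gs [of b] b(1) by (simp add: a_def)
      have "(u, n) = \<phi> a" by (simp add: \<phi>_def pt lev)
      moreover have "\<forall>i\<ge>l + r. a i = 0" by (simp add: a_def)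
      moreover have "(u, n) \<in> W1 - W2" using u by (simp add: W1_def W2_def loc_tor_def)
      ultimately show "(u, n) \<in> \<phi> ` {a \<in> {a. \<forall>i\<ge>l + r. a i = 0}. sum a {..<l} = n} \<inter> (W1 - W2)"
        using lev by auto
    qed
  qed
  have "eventually_poly (\<lambda>n. card (\<phi> ` {a \<in> {a. \<forall>i\<ge>l + r. a i = 0}. sum a {..<l} = n} \<inter> (W1 - W2)))"
  proof (rule eventually_poly_card_image)
    show "l \<le> l + r" by simp
    show "\<phi> (\<lambda>i. a i + c i) = \<phi> (\<lambda>i. a' i + c i)" if "\<phi> a = \<phi> a'" for a a' c
      using that unfolding \<phi>_add by (simp add: \<phi>_def)
    show "sum a {..<l} = sum a' {..<l}" if "\<phi> a = \<phi> a'" for a a'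
      using that by (simp add: \<phi>_def)
    show "\<phi> (\<lambda>i. a i + c i) \<in> W1" if "\<phi> a \<in> W1" for a c
    proof -
      have "pt a \<in> sat G Z (sum a {..<l} + q)" using that by (simp add: \<phi>_def W1_def)
      from sat_add [OF this pw_sat [OF pt_pw [of c]]]
      show ?thesis unfolding \<phi>_add by (simp add: W1_def ac_simps)
    qed
    show "\<phi> (\<lambda>i. a i + c i) \<in> W2" if "\<phi> a \<in> W2" for a c
    proof -
      have "pt a \<in> pw G Z (sum a {..<l} + q)" using that by (simp add: \<phi>_def W2_def)
      from pw_add [OF this pt_pw [of c]]
      show ?thesis unfolding \<phi>_add by (simp add: W2_def ac_simps)
    qed
    show "finite (\<phi> ` {a \<in> {a. \<forall>i\<ge>l + r. a i = 0}. sum a {..<l} = n} \<inter> (W1 - W2))" for n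
      unfolding img using loc_tor_card(1) [OF G] by (rule finite_imageI)
  qed
  then have "eventually_poly (\<lambda>n. card ((\<lambda>u. (u, n)) ` loc_tor G Z (n + q)))" unfolding img .
  then have "eventually_poly (\<lambda>n. card (loc_tor G Z (n + q)))"
    by (simp add: card_image inj_on_def)
  then show ?thesis by (rule eventually_poly_shift)
qed

text \<open>\<open>card G\<close> is the loss from rounding coefficients in the growth estimate, so
  this one shift decides between the two cases.\<close>

theorem loc_tor_dichotomy:
  assumes "finite G" "G \<noteq> {}"
  shows "eventually_poly (\<lambda>n. card (loc_tor G Z n)) \<or>
    (\<exists>c>0. \<forall>\<^sub>F N in sequentially. c * real N ^ card (- Z) \<le> real (card (loc_tor G Z N)))"
proof (cases "\<forall>n. sat G Z (n + card G) \<subseteq> pw G Z n")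
  case True
  then show ?thesis using loc_tor_eventually_poly [OF assms(1), of Z "card G"] by blast
next
  case False
  then obtain n u where "u \<in> sat G Z (n + card G)" "u \<notin> pw G Z n" by blast
  then have "\<exists>c>0. \<forall>\<^sub>F N in sequentially. c * real N ^ card (- Z) \<le> real (card (loc_tor G Z N))"
    by (intro loc_tor_growth [OF assms, of "n + card G" u]) auto
  then show ?thesis ..
qed

section \<open>Truncation at degree \<open>D n\<close>\<close>

lemma sum_between:
  fixes x y :: "'a \<Rightarrow> nat"
  assumes "finite A" "\<And>i. i \<in> A \<Longrightarrow> y i \<le> x i" "sum y A \<le> s" "s \<le> sum x A"
  obtains z where "\<And>i. i \<in> A \<Longrightarrow> y i \<le> z i" "\<And>i. i \<in> A \<Longrightarrow> z i \<le> x i" "sum z A = s"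
proof -
  have "sum x A = sum y A + (\<Sum>i\<in>A. x i - y i)"
    unfolding sum.distrib [symmetric] by (rule sum.cong) (use assms(2) in auto)
  then have "s - sum y A \<le> (\<Sum>i\<in>A. x i - y i)" using assms(4) by simp
  from sum_reduce [OF assms(1) this] obtain b where b: "\<forall>i. b i \<le> x i - y i" "sum b A = s - sum y A" by blast
  show ?thesis
  proof (rule that [of "\<lambda>i. y i + b i"])
    show "y i \<le> y i + b i" for i by simp
    show "y i + b i \<le> x i" if "i \<in> A" for i using b(1) [rule_format, of i] assms(2) [OF that] by linarith
    show "(\<Sum>i\<in>A. y i + b i) = s" using b(2) assms(3) by (simp add: sum.distrib)
  qed
qed

text \<open>The bound is linear in \<open>n\<close>, so points of levels m and n still add up to
  points of level m + n, while each level becomes finite.\<close>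

definition trunc_pw :: "('n::finite \<Rightarrow> nat) set \<Rightarrow> 'n set \<Rightarrow> nat \<Rightarrow> nat \<Rightarrow> ('n \<Rightarrow> nat) set" where
  "trunc_pw G Z D n = {u. (\<forall>i\<in>Z. u i = 0) \<and> sum u (- Z) \<le> D * n \<and> u \<in> pw G Z n}"

definition trunc_sat :: "('n::finite \<Rightarrow> nat) set \<Rightarrow> 'n set \<Rightarrow> nat \<Rightarrow> nat \<Rightarrow> ('n \<Rightarrow> nat) set" where
  "trunc_sat G Z D n = {u. (\<forall>i\<in>Z. u i = 0) \<and> sum u (- Z) \<le> D * n \<and> u \<in> sat G Z n}"

lemma trunc_sat_card:
  "finite (trunc_sat G Z D n)" "card (trunc_sat G Z D n) \<le> (D * n + 1) ^ card (- Z)"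
proof -
  have "finite (trunc_sat G Z D n) \<and> card (trunc_sat G Z D n) \<le> (D * n + 1) ^ card (- Z)"
  proof (rule card_box_le)
    fix u i assume u: "u \<in> trunc_sat G Z D n"
    show "u i = 0" if "i \<in> Z" using u that by (simp add: trunc_sat_def)
    assume "i \<notin> Z"
    then have "u i \<le> sum u (- Z)" by (intro member_le_sum) auto
    then show "u i < D * n + 1" using u by (simp add: trunc_sat_def)
  qed
  then show "finite (trunc_sat G Z D n)" "card (trunc_sat G Z D n) \<le> (D * n + 1) ^ card (- Z)" by auto
qed

lemma trunc_pw_subset: "trunc_pw G Z D n \<subseteq> trunc_sat G Z D n"
  by (auto simp: trunc_pw_def trunc_sat_def intro: pw_sat)

text \<open>Truncated at degree \<open>D n\<close>, the powers of the ideal are generated in level one.\<close>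

lemma trunc_pw_split:
  assumes G: "finite G" and D: "\<And>g. g \<in> G \<Longrightarrow> sum g (- Z) \<le> D" and u: "u \<in> trunc_pw G Z D (Suc n)"
  obtains u' v where "u' \<in> trunc_pw G Z D n" "v \<in> trunc_pw G Z D 1" "u = (\<lambda>i. u' i + v i)"
proof -
  have u0: "\<And>i. i \<in> Z \<Longrightarrow> u i = 0" and uD: "sum u (- Z) \<le> D * Suc n" and "u \<in> pw G Z (Suc n)"
    using u by (auto simp: trunc_pw_def)
  from this(3) obtain a where a: "sum a G = Suc n" "\<And>i. i \<notin> Z \<Longrightarrow> (\<Sum>g\<in>G. a g * g i) \<le> u i"
    by (rule pwE) (rule that)
  have "\<exists>g\<in>G. a g \<noteq> 0" using a(1) by (metis nat.distinct(1) sum.neutral)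
  then obtain g where g: "g \<in> G" "a g \<noteq> 0" by blast
  define b where "b = a(g := a g - 1)"
  have ab: "a h = b h + (if h = g then 1 else 0)" for h using g by (simp add: b_def)
  have sb: "sum b G = n" using a(1) g(1) G by (simp add: ab sum.distrib)
  define y where "y i = (\<Sum>h\<in>G. b h * h i)" for i
  have yg: "(\<Sum>h\<in>G. a h * h i) = y i + g i" for i
    using g(1) G by (simp add: ab y_def distrib_right sum.distrib if_distrib [of "\<lambda>x. x * _"] cong: if_cong)
  have le: "y i + g i \<le> u i" if "i \<notin> Z" for i using a(2) [OF that] yg by simp
  have sy: "sum y (- Z) \<le> D * n"
  proof -
    have "sum y (- Z) = (\<Sum>h\<in>G. b h * sum h (- Z))"
      unfolding y_def by (subst sum.swap) (simp add: sum_distrib_left)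
    also have "\<dots> \<le> (\<Sum>h\<in>G. b h * D)" by (intro sum_mono mult_left_mono D) auto
    also have "\<dots> = D * n" using sb by (simp flip: sum_distrib_right)
    finally show ?thesis .
  qed
  define x where "x i = u i - g i" for i
  have ux: "u i = x i + g i" if "i \<notin> Z" for i using le [OF that] by (simp add: x_def)
  have yx: "y i \<le> x i" if "i \<in> - Z" for i using le [of i] that by (simp add: x_def)
  have "sum y (- Z) \<le> sum x (- Z)" by (rule sum_mono) (rule yx)
  then have ym: "sum y (- Z) \<le> min (D * n) (sum x (- Z))" using sy by simp
  \<comment> \<open>\<open>z\<close> lies between what the \<open>n\<close> remaining generators
    need and \<open>u - g\<close>, with the largest degree allowed. If this degree is D n, the rest
    has degree at most \<open>D\<close>; otherwise \<open>z\<close> is \<open>u - g\<close> outside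
    \<open>Z\<close>, and the rest is \<open>g\<close> there.\<close>
  obtain z where z: "\<And>i. i \<in> - Z \<Longrightarrow> y i \<le> z i" "\<And>i. i \<in> - Z \<Longrightarrow> z i \<le> x i"
      "sum z (- Z) = min (D * n) (sum x (- Z))"
    apply (rule sum_between [of "- Z" y x "min (D * n) (sum x (- Z))"])
        apply simp
       apply (rule yx, assumption)
      apply (rule ym)
     apply simp
    apply (rule that; assumption)
    done
  define u' where "u' i = (if i \<in> Z then 0 else z i)" for i
  define v where "v i = u i - u' i" for i
  have su': "sum u' (- Z) = min (D * n) (sum x (- Z))"
    unfolding z(3) [symmetric] by (rule sum.cong) (auto simp: u'_def)
  have u'u: "u' i \<le> u i" for i using z(2) [of i] ux [of i] by (auto simp: u'_def)
  have gv: "g i \<le> v i" if "i \<notin> Z" for i using z(2) [of i] ux [of i] that by (auto simp: u'_def v_def)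
  have sv: "sum v (- Z) + sum u' (- Z) = sum u (- Z)"
    unfolding sum.distrib [symmetric] by (rule sum.cong) (use u'u in \<open>auto simp: v_def\<close>)
  have su: "sum u (- Z) = sum x (- Z) + sum g (- Z)"
    unfolding sum.distrib [symmetric] by (rule sum.cong) (use ux in auto)
  have svD: "sum v (- Z) \<le> D"
  proof (cases "D * n \<le> sum x (- Z)")
    case True
    then show ?thesis using su' sv uD by simp
  next
    case False
    then show ?thesis using su' sv su D [OF g(1)] by simp
  qed
  show ?thesis
  proof (rule that [of u' v])
    have "u' \<in> pw G Z n" by (rule pwI [OF sb]) (use z(1) in \<open>auto simp: u'_def y_def\<close>)
    then show "u' \<in> trunc_pw G Z D n" using su' by (simp add: trunc_pw_def u'_def)
    have "v \<in> pw G Z 1" by (rule pw_upset [OF pw_gen [OF G g(1)]]) (rule gv)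
    then show "v \<in> trunc_pw G Z D 1" using svD u0 by (simp add: trunc_pw_def v_def)
    show "u = (\<lambda>i. u' i + v i)" using u'u by (auto simp: v_def)
  qed
qed

text \<open>The truncated powers are generated by their finitely many points of level one, so all
  variables of the presentation have degree one and nothing is removed from the image.\<close>

lemma trunc_pw_eventually_poly:
  assumes G: "finite G" and D: "\<And>g. g \<in> G \<Longrightarrow> sum g (- Z) \<le> D"
  shows "eventually_poly (\<lambda>n. card (trunc_pw G Z D n))"
proof -
  let ?V = "trunc_pw G Z D 1"
  have finV: "finite ?V" by (rule finite_subset [OF trunc_pw_subset trunc_sat_card(1)])
  define l where "l = card ?V"
  obtain vs where vs: "bij_betw vs {0..<l} ?V" using ex_bij_betw_nat_finite [OF finV] by (auto simp: l_def)
  have vsV: "vs j \<in> ?V" if "j < l" for j using vs that by (auto simp: bij_betw_def)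
  define \<phi> where "\<phi> a = ((\<lambda>i. \<Sum>j<l. a j * vs j i), sum a {..<l})" for a :: "nat \<Rightarrow> nat"
  have \<phi>_add: "\<phi> (\<lambda>j. a j + c j) = (\<lambda>i. fst (\<phi> a) i + fst (\<phi> c) i, snd (\<phi> a) + snd (\<phi> c))" for a c
    by (simp add: \<phi>_def sum.distrib distrib_right)
  have img: "\<phi> ` {a \<in> {a. \<forall>i\<ge>l. a i = 0}. sum a {..<l} = n} = (\<lambda>u. (u, n)) ` trunc_pw G Z D n" for n
  proof
    show "\<phi> ` {a \<in> {a. \<forall>i\<ge>l. a i = 0}. sum a {..<l} = n} \<subseteq> (\<lambda>u. (u, n)) ` trunc_pw G Z D n"
    proof (rule image_subsetI)
      fix a assume a: "a \<in> {a \<in> {a. \<forall>i\<ge>l. a i = 0}. sum a {..<l} = n}"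
      let ?u = "\<lambda>i. \<Sum>j<l. a j * vs j i"
      have "?u \<in> pw G Z (\<Sum>j<l. a j * 1)"
        by (rule pw_sum) (use vsV in \<open>auto simp: trunc_pw_def\<close>)
      moreover have "(\<Sum>j<l. a j * 1) = n" using a by simp
      moreover have "?u i = 0" if "i \<in> Z" for i
        using vsV that by (intro sum.neutral) (auto simp: trunc_pw_def)
      moreover have "sum ?u (- Z) \<le> D * n"
      proof -
        have "sum ?u (- Z) = (\<Sum>j<l. a j * sum (vs j) (- Z))"
          by (subst sum.swap) (simp add: sum_distrib_left)
        also have "\<dots> \<le> (\<Sum>j<l. a j * D)"
          by (intro sum_mono mult_left_mono) (use vsV in \<open>auto simp: trunc_pw_def\<close>)
        also have "\<dots> = D * n" using a by (simp flip: sum_distrib_right)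
        finally show ?thesis .
      qed
      ultimately have "?u \<in> trunc_pw G Z D n" by (simp add: trunc_pw_def)
      then show "\<phi> a \<in> (\<lambda>u. (u, n)) ` trunc_pw G Z D n" using a by (simp add: \<phi>_def)
    qed
    have "\<exists>a. (\<forall>i\<ge>l. a i = 0) \<and> \<phi> a = (u, n)" if "u \<in> trunc_pw G Z D n" for u
      using that
    proof (induction n arbitrary: u)
      case 0
      have "u i = 0" for i
      proof (cases "i \<in> Z")
        case True
        then show ?thesis using 0 by (simp add: trunc_pw_def)
      next
        case False
        then have "u i \<le> sum u (- Z)" by (intro member_le_sum) auto
        then show ?thesis using 0 by (simp add: trunc_pw_def)
      qed
      then show ?case by (intro exI [of _ "\<lambda>_. 0"]) (auto simp: \<phi>_def)
    next
      case (Suc n)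
      obtain u' v where uv: "u' \<in> trunc_pw G Z D n" "v \<in> ?V" "u = (\<lambda>i. u' i + v i)"
        by (rule trunc_pw_split [OF G D Suc.prems]) (auto intro: that)
      from Suc.IH [OF uv(1)] obtain a where a: "\<forall>i\<ge>l. a i = 0" "\<phi> a = (u', n)" by blast
      from uv(2) vs obtain j where j: "j < l" "v = vs j" by (force simp: bij_betw_def)
      let ?c = "\<lambda>i. if i = j then 1 else 0 :: nat"
      have "\<phi> ?c = (v, 1)"
        using j by (simp add: \<phi>_def if_distrib [of "\<lambda>x. x * _"] cong: if_cong)
      then have "\<phi> (\<lambda>i. a i + ?c i) = (u, Suc n)" unfolding \<phi>_add a(2) by (simp add: uv(3))
      then show ?case using a(1) j by (intro exI [of _ "\<lambda>i. a i + ?c i"]) auto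
    qed
    then show "(\<lambda>u. (u, n)) ` trunc_pw G Z D n \<subseteq> \<phi> ` {a \<in> {a. \<forall>i\<ge>l. a i = 0}. sum a {..<l} = n}"
      by (force simp: \<phi>_def)
  qed
  have "eventually_poly (\<lambda>n. card (\<phi> ` {a \<in> {a. \<forall>i\<ge>l. a i = 0}. sum a {..<l} = n} \<inter> (UNIV - {})))"
  proof (rule eventually_poly_card_image)
    show "\<phi> (\<lambda>i. a i + c i) = \<phi> (\<lambda>i. a' i + c i)" if "\<phi> a = \<phi> a'" for a a' c
      unfolding \<phi>_add that ..
    show "sum a {..<l} = sum a' {..<l}" if "\<phi> a = \<phi> a'" for a a'
      using that by (simp add: \<phi>_def)
    show "finite (\<phi> ` {a \<in> {a. \<forall>i\<ge>l. a i = 0}. sum a {..<l} = n} \<inter> (UNIV - {}))" for n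
    proof -
      have "finite (trunc_pw G Z D n)" by (rule finite_subset [OF trunc_pw_subset trunc_sat_card(1)])
      then show ?thesis unfolding img by simp
    qed
  qed auto
  then show ?thesis unfolding img by (simp add: card_image inj_on_def)
qed

section \<open>The truncated saturation as the points of a cone\<close>

definition embed :: "'n set \<Rightarrow> ('n \<Rightarrow> nat) \<Rightarrow> nat \<Rightarrow> 'n option \<Rightarrow> int" where
  "embed Z u n k = (case k of None \<Rightarrow> int n | Some i \<Rightarrow> if i \<in> Z then 0 else int (u i))"

definition unit_vec :: "'k \<Rightarrow> 'k \<Rightarrow> int" where
  "unit_vec j k = (if k = j then 1 else 0)"

lemma embed_simps [simp]:
  "embed Z u n None = int n" "embed Z u n (Some i) = (if i \<in> Z then 0 else int (u i))"
  by (simp_all add: embed_def)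

lemma unit_vec_simps [simp]:
  "unit_vec j j = 1" "k \<noteq> j \<Longrightarrow> unit_vec j k = 0"
  by (simp_all add: unit_vec_def)

lemma in_monoid_cong: "in_monoid K \<Gamma> v \<Longrightarrow> (\<And>k. k \<in> K \<Longrightarrow> v k = w k) \<Longrightarrow> in_monoid K \<Gamma> w"
  unfolding in_monoid_def by auto

lemma in_monoid_zero: "in_monoid K \<Gamma> (\<lambda>_. 0)"
  by (rule in_monoidI_int [of _ "\<lambda>_. 0"]) auto

lemma in_monoid_gen: "finite \<Gamma> \<Longrightarrow> z \<in> \<Gamma> \<Longrightarrow> in_monoid K \<Gamma> z"
  by (rule in_monoidI_int [of _ "\<lambda>y. if y = z then 1 else 0"])
    (auto simp: if_distrib [of "\<lambda>x. x * _"] cong: if_cong)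

lemma in_monoid_scale: "in_monoid K \<Gamma> v \<Longrightarrow> in_monoid K \<Gamma> (\<lambda>k. int m * v k)"
proof (induction m)
  case 0
  show ?case by (simp add: in_monoid_zero)
next
  case (Suc m)
  then have "in_monoid K \<Gamma> (\<lambda>k. v k + int m * v k)" by (intro in_monoid_add) auto
  then show ?case by (simp add: distrib_right)
qed

lemma in_monoid_sum:
  assumes "finite A" "\<And>x. x \<in> A \<Longrightarrow> in_monoid K \<Gamma> (z x)"
  shows "in_monoid K \<Gamma> (\<lambda>k. \<Sum>x\<in>A. int (c x) * z x k)"
  using assms
proof (induction A rule: finite_induct)
  case empty
  show ?case by (simp add: in_monoid_zero)
next
  case (insert x A)
  then have "in_monoid K \<Gamma> (\<lambda>k. int (c x) * z x k + (\<Sum>x\<in>A. int (c x) * z x k))"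
    by (intro in_monoid_add in_monoid_scale) auto
  then show ?case using insert.hyps by simp
qed

lemma in_monoid_induct:
  assumes "in_monoid K \<Gamma> v" "finite \<Gamma>" and P0: "P (\<lambda>_. 0)" and Pg: "\<And>z. z \<in> \<Gamma> \<Longrightarrow> P z"
    and Pa: "\<And>v w. P v \<Longrightarrow> P w \<Longrightarrow> P (\<lambda>k. v k + w k)"
    and Pc: "\<And>v w. P v \<Longrightarrow> (\<And>k. k \<in> K \<Longrightarrow> v k = w k) \<Longrightarrow> P w"
  shows "P v"
proof -
  from assms(1) obtain a :: "('a \<Rightarrow> int) \<Rightarrow> nat" where a: "\<forall>k\<in>K. v k = (\<Sum>z\<in>\<Gamma>. int (a z) * z k)"
    unfolding in_monoid_def ..
  have Ps: "P (\<lambda>k. int m * z k)" if "P z" for m z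
  proof (induction m)
    case 0
    show ?case by (simp add: P0)
  next
    case (Suc m)
    from Pa [OF that this] show ?case by (simp add: distrib_right)
  qed
  have "P (\<lambda>k. \<Sum>z\<in>A. int (a z) * z k)" if "finite A" "A \<subseteq> \<Gamma>" for A
    using that
  proof (induction A rule: finite_induct)
    case empty
    show ?case by (simp add: P0)
  next
    case (insert z A)
    have "P z" by (rule Pg) (use insert.prems in simp)
    then have "P (\<lambda>k. int (a z) * z k)" by (rule Ps)
    moreover have "P (\<lambda>k. \<Sum>z\<in>A. int (a z) * z k)" using insert by simp
    ultimately have "P (\<lambda>k. int (a z) * z k + (\<Sum>z\<in>A. int (a z) * z k))" by (rule Pa)
    then show ?case using insert.hyps by simp
  qed
  from this [OF assms(2) subset_refl] show ?thesis by (rule Pc) (use a in simp)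
qed

text \<open>Generators for the pairs of an exponent vector and a level in the powers with
  \<open>Z\<close> and \<open>i\<close> inverted. The negative unit vector inverts \<open>i\<close>,
  while the coordinates in \<open>Z\<close> are set to zero.\<close>

definition gens :: "('n::finite \<Rightarrow> nat) set \<Rightarrow> 'n set \<Rightarrow> 'n \<Rightarrow> ('n option \<Rightarrow> int) set" where
  "gens G Z i = (\<lambda>g. embed Z g 1) ` G \<union> (\<lambda>j. unit_vec (Some j)) ` (- Z) \<union> {\<lambda>k. - unit_vec (Some i) k}"

lemma finite_gens: "finite G \<Longrightarrow> finite (gens G Z i)"
  by (simp add: gens_def)

lemma pw_iff_in_monoid:
  fixes G :: "('n::finite \<Rightarrow> nat) set"
  assumes G: "finite G" and i: "i \<notin> Z"
  defines "K \<equiv> insert None (Some ` (- Z))"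
  shows "u \<in> pw G (insert i Z) n \<longleftrightarrow> in_monoid K (gens G Z i) (embed Z u n)"
proof
  assume "u \<in> pw G (insert i Z) n"
  then obtain a where a: "sum a G = n" "\<And>j. j \<notin> insert i Z \<Longrightarrow> (\<Sum>g\<in>G. a g * g j) \<le> u j"
    by (rule pwE) (rule that)
  let ?M = "in_monoid K (gens G Z i)"
  \<comment> \<open>The slack of \<open>u\<close> over the chosen generators. Unit vectors supply
    it; at \<open>i\<close> it may be negative, and then the negative unit vector does.\<close>
  define b where "b j = int (u j) - int (\<Sum>g\<in>G. a g * g j)" for j
  have 1: "?M (\<lambda>k. \<Sum>g\<in>G. int (a g) * embed Z g 1 k)"
    using G by (intro in_monoid_sum in_monoid_gen finite_gens) (auto simp: gens_def)
  have 2: "?M (\<lambda>k. \<Sum>j\<in>- Z. int (nat (b j)) * unit_vec (Some j) k)"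
    using G by (intro in_monoid_sum in_monoid_gen finite_gens) (auto simp: gens_def)
  have 3: "?M (\<lambda>k. int (nat (- b i)) * (- unit_vec (Some i) k))"
    using G by (intro in_monoid_scale in_monoid_gen finite_gens) (auto simp: gens_def)
  from in_monoid_add [OF in_monoid_add [OF 1 2] 3]
  show "?M (embed Z u n)"
  proof (rule in_monoid_cong)
    fix k assume k: "k \<in> K"
    show "(\<Sum>g\<in>G. int (a g) * embed Z g 1 k) + (\<Sum>j\<in>- Z. int (nat (b j)) * unit_vec (Some j) k)
      + int (nat (- b i)) * (- unit_vec (Some i) k) = embed Z u n k"
    proof (cases k)
      case None
      then show ?thesis using a(1) by (auto simp: unit_vec_def)
    next
      case (Some j)
      then have j: "j \<notin> Z" using k by (auto simp: K_def)
      have "(\<Sum>j'\<in>- Z. int (nat (b j')) * unit_vec (Some j') k) = (\<Sum>j'\<in>- Z. if j' = j then int (nat (b j)) else 0)"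
        by (rule sum.cong) (auto simp: unit_vec_def Some)
      also have "\<dots> = int (nat (b j))" using j by simp
      finally have s: "(\<Sum>j'\<in>- Z. int (nat (b j')) * unit_vec (Some j') k) = int (nat (b j))" .
      have bj: "b j \<ge> 0" if "j \<noteq> i"
      proof -
        have "(\<Sum>g\<in>G. a g * g j) \<le> u j" by (rule a(2)) (use j that in simp)
        then have "int (\<Sum>g\<in>G. a g * g j) \<le> int (u j)" by (simp only: of_nat_le_iff)
        then show ?thesis unfolding b_def by linarith
      qed
      have e: "(\<Sum>g\<in>G. int (a g) * embed Z g 1 k) = int (u j) - b j" using j by (simp add: Some b_def)
      show ?thesis unfolding s e using bj j by (cases "j = i") (auto simp: Some unit_vec_def)
    qed
  qed
next
  assume m: "in_monoid K (gens G Z i) (embed Z u n)"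
  \<comment> \<open>The goal as a property of an arbitrary integer vector. It is additive, and it
    holds for every generator because nothing is required at the coordinate
    \<open>i\<close>.\<close>
  define P where "P v \<longleftrightarrow> (\<exists>a :: ('n \<Rightarrow> nat) \<Rightarrow> nat. int (sum a G) = v None \<and>
      (\<forall>j. j \<notin> insert i Z \<longrightarrow> int (\<Sum>g\<in>G. a g * g j) \<le> v (Some j)))" for v :: "'n option \<Rightarrow> int"
  have "P (embed Z u n)"
  proof (rule in_monoid_induct [OF m finite_gens [OF G]])
    show "P (\<lambda>_. 0)" unfolding P_def by (intro exI [of _ "\<lambda>_. 0"]) simp
    show "P (\<lambda>k. v k + w k)" if v: "P v" and w: "P w" for v w
    proof -
      from v obtain a where a: "int (sum a G) = v None"
        "\<forall>j. j \<notin> insert i Z \<longrightarrow> int (\<Sum>g\<in>G. a g * g j) \<le> v (Some j)" unfolding P_def by auto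
      from w obtain b where b: "int (sum b G) = w None"
        "\<forall>j. j \<notin> insert i Z \<longrightarrow> int (\<Sum>g\<in>G. b g * g j) \<le> w (Some j)" unfolding P_def by auto
      show ?thesis unfolding P_def
      proof (intro exI [of _ "\<lambda>g. a g + b g"] conjI allI impI)
        show "int (\<Sum>g\<in>G. a g + b g) = v None + w None" using a(1) b(1) by (simp add: sum.distrib)
        fix j assume "j \<notin> insert i Z"
        then have "int (\<Sum>g\<in>G. a g * g j) \<le> v (Some j)" "int (\<Sum>g\<in>G. b g * g j) \<le> w (Some j)"
          using a(2) b(2) by auto
        then show "int (\<Sum>g\<in>G. (a g + b g) * g j) \<le> v (Some j) + w (Some j)"
          by (simp add: distrib_right sum.distrib)
      qed
    qed
    show "P w" if v: "P v" and eq: "\<And>k. k \<in> K \<Longrightarrow> v k = w k" for v w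
    proof -
      have "v None = w None" "\<And>j. j \<notin> insert i Z \<Longrightarrow> v (Some j) = w (Some j)"
        using eq by (auto simp: K_def)
      then show ?thesis using v unfolding P_def by auto
    qed
    fix z assume z: "z \<in> gens G Z i"
    consider (g) g where "g \<in> G" "z = embed Z g 1" | (u) j where "j \<notin> Z" "z = unit_vec (Some j)"
      | (n) "z = (\<lambda>k. - unit_vec (Some i) k)"
      using z by (auto simp: gens_def)
    then show "P z"
    proof cases
      case g
      show ?thesis unfolding P_def
        by (intro exI [of _ "\<lambda>h. if h = g then 1 else 0"])
          (use g G in \<open>auto simp: if_distrib [of "\<lambda>x. x * _"] cong: if_cong\<close>)
    next
      case u
      show ?thesis unfolding P_def
        by (intro exI [of _ "\<lambda>_. 0"]) (auto simp: u unit_vec_def)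
    next
      case n
      show ?thesis unfolding P_def
        by (intro exI [of _ "\<lambda>_. 0"]) (auto simp: n unit_vec_def)
    qed
  qed
  then obtain a where a: "int (sum a G) = int n"
    "\<forall>j. j \<notin> insert i Z \<longrightarrow> int (\<Sum>g\<in>G. a g * g j) \<le> embed Z u n (Some j)" unfolding P_def by auto
  show "u \<in> pw G (insert i Z) n"
  proof (rule pwI)
    show "sum a G = n" using a(1) by (simp only: of_nat_eq_iff)
    fix j assume j: "j \<notin> insert i Z"
    then show "(\<Sum>g\<in>G. a g * g j) \<le> u j"
      using a(2) [rule_format, OF j] by (simp del: of_nat_sum of_nat_mult)
  qed
qed

context
  fixes G :: "('n::finite \<Rightarrow> nat) set" and Z :: "'n set" and D :: nat
  assumes G: "finite G" "G \<noteq> {}" and Z: "Z \<noteq> UNIV" and D: "\<And>g. g \<in> G \<Longrightarrow> sum g (- Z) \<le> D"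
begin

private definition "K = insert None (Some ` (- Z))"

text \<open>The half-space of this functional is the truncation at degree D n.\<close>

private definition "degree_slack = (\<lambda>k. if k = None then int D else -1 :: int)"

private definition "Hs = insert degree_slack ((\<lambda>i. unit_vec (Some i)) ` (- Z))"

private definition "T = cone_level K None Hs (gens G Z ` (- Z))"

private lemma finK: "finite K" by (simp add: K_def)

private lemma cardK: "card K = Suc (card (- Z))"
  by (simp add: K_def card_image)

private lemma SomeK: "Some i \<in> K \<longleftrightarrow> i \<notin> Z" by (auto simp: K_def)

private lemma dot_unit_vec: "k \<in> K \<Longrightarrow> dot K (unit_vec k) v = v k"
  unfolding unit_vec_def by (rule dot_unit [OF finK])

private lemma dot_slack: "dot K degree_slack v = int D * v None - (\<Sum>i\<in>- Z. v (Some i))"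
proof -
  have "dot K degree_slack v = int D * v None + (\<Sum>k\<in>Some ` (- Z). degree_slack k * v k)"
    by (simp add: dot_def K_def degree_slack_def)
  also have "(\<Sum>k\<in>Some ` (- Z). degree_slack k * v k) = - (\<Sum>i\<in>- Z. v (Some i))"
    by (simp add: sum.reindex degree_slack_def sum_negf)
  finally show ?thesis by simp
qed

private lemma embed_in_T: "u \<in> trunc_sat G Z D n \<Longrightarrow> embed Z u n \<in> T n"
proof -
  assume u: "u \<in> trunc_sat G Z D n"
  have sum: "(\<Sum>i\<in>- Z. embed Z u n (Some i)) = int (sum u (- Z))" by simp
  have le: "int (sum u (- Z)) \<le> int D * int n"
    using u by (simp only: trunc_sat_def mem_Collect_eq of_nat_mult [symmetric] of_nat_le_iff)
  have "embed Z u n k = 0" if "k \<notin> K" for k using that by (cases k) (auto simp: K_def)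
  moreover have "dot K h (embed Z u n) \<ge> 0" if "h \<in> Hs" for h
    using that sum le unfolding Hs_def
    by (elim insertE imageE) (auto simp: dot_slack dot_unit_vec SomeK simp del: of_nat_sum)
  moreover have "in_monoid K (gens G Z i) (embed Z u n)" if "i \<notin> Z" for i
    using u that pw_iff_in_monoid [OF G(1) that, of u n] by (simp add: trunc_sat_def sat_def K_def)
  ultimately show ?thesis unfolding T_def cone_level_def by auto
qed

private lemma T_embed:
  assumes v: "v \<in> T n"
  obtains u where "u \<in> trunc_sat G Z D n" "v = embed Z u n"
proof -
  define u where "u i = (if i \<in> Z then 0 else nat (v (Some i)))" for i
  have v0: "v k = 0" if "k \<notin> K" for k using v that by (simp add: T_def cone_level_def)
  have vn: "v None = int n" using v by (simp add: T_def cone_level_def)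
  have vh: "dot K h v \<ge> 0" if "h \<in> Hs" for h using v that by (simp add: T_def cone_level_def)
  have pos: "v (Some i) \<ge> 0" if "i \<notin> Z" for i
    using vh [of "unit_vec (Some i)"] dot_unit_vec [of "Some i" v] that by (simp add: Hs_def K_def)
  have eq: "v = embed Z u n"
  proof
    fix k
    show "v k = embed Z u n k"
    proof (cases k)
      case None
      then show ?thesis using vn by simp
    next
      case (Some i)
      then show ?thesis using v0 [of k] pos [of i] by (auto simp: u_def K_def)
    qed
  qed
  have "(\<Sum>i\<in>- Z. v (Some i)) = int (sum u (- Z))" unfolding eq by simp
  moreover have "(\<Sum>i\<in>- Z. v (Some i)) \<le> int D * int n"
    using vh [of degree_slack] vn by (simp add: Hs_def dot_slack)
  ultimately have "int (sum u (- Z)) \<le> int (D * n)" by simp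
  then have "sum u (- Z) \<le> D * n" by (simp only: of_nat_le_iff)
  moreover have "u \<in> pw G (insert i Z) n" if "i \<notin> Z" for i
    using v that pw_iff_in_monoid [OF G(1) that, of u n] by (simp add: T_def cone_level_def K_def eq)
  ultimately have "u \<in> trunc_sat G Z D n" by (simp add: trunc_sat_def sat_def u_def)
  then show ?thesis using eq by (rule that)
qed

private lemma card_T: "card (T n) = card (trunc_sat G Z D n)"
proof -
  have "T n = (\<lambda>u. embed Z u n) ` trunc_sat G Z D n"
    using embed_in_T by (auto elim!: T_embed)
  moreover have "inj_on (\<lambda>u. embed Z u n) (trunc_sat G Z D n)"
  proof (rule inj_onI, rule ext)
    fix u v i assume u: "u \<in> trunc_sat G Z D n" and v: "v \<in> trunc_sat G Z D n" and eq: "embed Z u n = embed Z v n"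
    show "u i = v i" using fun_cong [OF eq, of "Some i"] u v by (cases "i \<in> Z") (auto simp: trunc_sat_def)
  qed
  ultimately show ?thesis by (simp add: card_image)
qed

private lemma gen_in_T: "g \<in> G \<Longrightarrow> embed Z g 1 \<in> T 1"
proof -
  assume g: "g \<in> G"
  let ?u = "\<lambda>i. if i \<in> Z then 0 else g i"
  have "?u \<in> pw G Z 1" by (rule pw_upset [OF pw_gen [OF G(1) g]]) simp
  moreover have "sum ?u (- Z) = sum g (- Z)" by (rule sum.cong) auto
  ultimately have "?u \<in> trunc_sat G Z D 1" using D [OF g] by (simp add: trunc_sat_def pw_sat)
  then have "embed Z ?u 1 \<in> T 1" by (rule embed_in_T)
  moreover have "embed Z ?u 1 = embed Z g 1" by (rule ext) (simp add: embed_def split: option.split)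
  ultimately show ?thesis by simp
qed

text \<open>\<open>D + 1\<close> also covers the level coordinate, which equals \<open>n\<close>
  even when \<open>D\<close> is zero.\<close>

private lemma T_bounded:
  assumes "v \<in> T n" "k \<in> K"
  shows "\<bar>v k\<bar> \<le> int ((D + 1) * n)"
proof -
  from assms(1) obtain u where u: "u \<in> trunc_sat G Z D n" "v = embed Z u n" by (rule T_embed)
  show ?thesis
  proof (cases k)
    case None
    then show ?thesis using u by (simp add: distrib_right)
  next
    case (Some i)
    then have i: "i \<in> - Z" using assms(2) by (auto simp: K_def)
    have "u i \<le> sum u (- Z)" using i by (intro member_le_sum) auto
    also have "\<dots> \<le> D * n" using u by (simp add: trunc_sat_def)
    also have "\<dots> \<le> (D + 1) * n" by simp
    finally have "int (u i) \<le> int ((D + 1) * n)" by (simp only: of_nat_le_iff)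
    then show ?thesis using u(2) Some i by simp
  qed
qed

text \<open>A generator is padded in a variable outside \<open>Z\<close> to degree exactly
  \<open>D\<close>.\<close>

private lemma slack_facet: "\<exists>x\<in>T 1. dot K degree_slack x = 0"
proof -
  obtain i where i: "i \<notin> Z" using Z by blast
  obtain g where g: "g \<in> G" using G by blast
  let ?u = "\<lambda>j. if j \<in> Z then 0 else if j = i then g j + (D - sum g (- Z)) else g j"
  have "sum ?u (- Z) = (\<Sum>j\<in>- Z. g j + (if j = i then D - sum g (- Z) else 0))"
    by (rule sum.cong) auto
  also have "\<dots> = D" using i D [OF g] by (simp add: sum.distrib)
  finally have s: "sum ?u (- Z) = D" .
  have "?u \<in> pw G Z 1" by (rule pw_upset [OF pw_gen [OF G(1) g]]) simp
  then have "?u \<in> trunc_sat G Z D 1" using s by (simp add: trunc_sat_def pw_sat)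
  then have "embed Z ?u 1 \<in> T 1" by (rule embed_in_T)
  moreover have "(\<Sum>j\<in>- Z. embed Z ?u 1 (Some j)) = int (sum ?u (- Z))"
    unfolding of_nat_sum by (rule sum.cong) auto
  then have "dot K degree_slack (embed Z ?u 1) = 0" unfolding dot_slack s by simp
  ultimately show ?thesis by blast
qed

text \<open>If every generator involves \<open>i\<close>, then inverting another variable
  \<open>j\<close> shows that the exponent at \<open>i\<close> is at least \<open>n\<close>, against
  the bound \<open>B\<close>. If no such \<open>j\<close> exists, inverting \<open>i\<close> inverts
  everything, and the zero vector is in the saturation of level one.\<close>

private lemma coordinate_facet:
  assumes i: "i \<notin> Z" and v: "v \<in> T n" "v (Some i) \<le> B" "int n > B"
  shows "\<exists>x\<in>T 1. x (Some i) = 0"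
proof -
  from v(1) obtain u where u: "u \<in> trunc_sat G Z D n" "v = embed Z u n" by (rule T_embed)
  show ?thesis
  proof (cases "- Z = {i}")
    case True
    obtain g where g: "g \<in> G" using G by blast
    have "(\<lambda>_. 0) \<in> sat G Z 1"
      unfolding sat_def
    proof (intro CollectI allI impI)
      fix j assume "j \<notin> Z"
      then have "j = i" using True by blast
      then have "insert j Z = UNIV" using True by blast
      moreover have "(\<lambda>_. 0) \<in> pw G UNIV 1"
        by (rule pw_upset [OF pw_mono [OF pw_gen [OF G(1) g] subset_UNIV]]) simp
      ultimately show "(\<lambda>_. 0) \<in> pw G (insert j Z) 1" by simp
    qed
    then have "(\<lambda>_. 0) \<in> trunc_sat G Z D 1" by (simp add: trunc_sat_def)
    then have "embed Z (\<lambda>_. 0) 1 \<in> T 1" by (rule embed_in_T)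
    then show ?thesis by (rule bexI [rotated]) simp
  next
    case False
    then obtain j where j: "j \<notin> Z" "j \<noteq> i" using i by blast
    have "u \<in> pw G (insert j Z) n" using u(1) j(1) by (simp add: trunc_sat_def sat_def)
    then obtain a where a: "sum a G = n" "\<And>k. k \<notin> insert j Z \<Longrightarrow> (\<Sum>g\<in>G. a g * g k) \<le> u k"
      by (rule pwE) (rule that)
    have "\<exists>g\<in>G. g i = 0"
    proof (rule ccontr)
      assume "\<not> (\<exists>g\<in>G. g i = 0)"
      then have "a g \<le> a g * g i" if "g \<in> G" for g using that by (cases "g i") auto
      then have "n \<le> (\<Sum>g\<in>G. a g * g i)" unfolding a(1) [symmetric] by (rule sum_mono)
      also have "\<dots> \<le> u i" using a(2) [of i] i j by simp
      finally show False using v(2,3) u(2) i by simp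
    qed
    then obtain g where "g \<in> G" "g i = 0" by blast
    then show ?thesis using gen_in_T [of g] by (intro bexI [of _ "embed Z g 1"]) auto
  qed
qed

lemma trunc_sat_second_difference:
  obtains b where "small (card (- Z) - 1) b"
    "\<forall>\<^sub>F n in sequentially. card (trunc_sat G Z D (n + 2)) + card (trunc_sat G Z D n)
      \<le> 2 * card (trunc_sat G Z D (n + 1)) + b (n + 2)"
proof -
  obtain b where b: "small (card K - 2) b"
    "\<forall>\<^sub>F n in sequentially. card (T (n + 2)) + card (T n) \<le> 2 * card (T (n + 1)) + b (n + 2)"
  proof (rule second_difference_cone_level [of K Hs "gens G Z ` (- Z)" None "D + 1", folded T_def])
    show "finite K" by (rule finK)
    show "finite Hs" "finite (gens G Z ` (- Z))" by (simp_all add: Hs_def)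
    show "finite \<Gamma>" if "\<Gamma> \<in> gens G Z ` (- Z)" for \<Gamma> using that finite_gens [OF G(1)] by auto
    show "None \<in> K" by (simp add: K_def)
    show "\<bar>v k\<bar> \<le> int ((D + 1) * n)" if "v \<in> T n" "k \<in> K" for n v k using that by (rule T_bounded)
    show "T 1 \<noteq> {}" using gen_in_T G by blast
    show "\<exists>n0. \<forall>n\<ge>n0. \<forall>v\<in>T n. dot K h v \<le> B \<longrightarrow> (\<exists>x\<in>T 1. dot K h x = 0)" if h: "h \<in> Hs" for h B
    proof (cases "h = degree_slack")
      case True
      then show ?thesis using slack_facet by blast
    next
      case False
      then obtain i where i: "i \<notin> Z" "h = unit_vec (Some i)" using h by (auto simp: Hs_def)
      have iK: "Some i \<in> K" using i(1) by (simp add: K_def)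
      show ?thesis
      proof (intro exI [of _ "nat \<bar>B\<bar> + 1"] allI impI ballI)
        fix n v assume "n \<ge> nat \<bar>B\<bar> + 1" and v: "v \<in> T n" "dot K h v \<le> B"
        then have n: "int n > B" by linarith
        have "v (Some i) \<le> B" using v(2) by (simp add: i(2) dot_unit_vec [OF iK])
        from coordinate_facet [OF i(1) v(1) this n]
        show "\<exists>x\<in>T 1. dot K h x = 0" by (simp add: i(2) dot_unit_vec [OF iK])
      qed
    qed
    show "z None = 0 \<or> z None = 1 \<and> z \<in> T 1" if "\<Gamma> \<in> gens G Z ` (- Z)" "z \<in> \<Gamma>" for \<Gamma> z
      using that gen_in_T by (auto simp: gens_def)
  qed (rule that)
  show ?thesis
  proof (rule that)
    \<comment> \<open>The level adds one coordinate, so \<open>card K - 2\<close> is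
      \<open>card (- Z) - 1\<close>.\<close>
    show "small (card (- Z) - 1) b" using b(1) by (simp add: cardK)
    show "\<forall>\<^sub>F n in sequentially. card (trunc_sat G Z D (n + 2)) + card (trunc_sat G Z D n)
      \<le> 2 * card (trunc_sat G Z D (n + 1)) + b (n + 2)" using b(2) by (simp only: card_T)
  qed
qed

end

theorem loc_tor_second_difference:
  fixes G :: "('n::finite \<Rightarrow> nat) set"
  assumes G: "finite G" "G \<noteq> {}" and Z: "Z \<noteq> UNIV"
  obtains M where "\<forall>\<^sub>F n in sequentially.
    (real (card (loc_tor G Z (n + 2))) + real (card (loc_tor G Z n)) - 2 * real (card (loc_tor G Z (n + 1)))) * real n
      \<le> M * real n ^ (card (- Z) - 1)"
proof -
  let ?r = "card (- Z)"
  \<comment> \<open>Torsion points of level \<open>n\<close> have degree at most ?r *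
    \<open>gen_bound G\<close> * n, and generators have degree at most \<open>gen_bound G\<close>.
    So no torsion is cut off and every generator survives in level one.\<close>
  define D where "D = (?r + 1) * gen_bound G"
  have D: "sum g (- Z) \<le> D" if "g \<in> G" for g
    using sum_le_gen_bound [OF G(1) that, of "- Z"] by (simp add: D_def)
  have "- Z \<noteq> {}" using Z by blast
  then have r: "?r \<ge> 1" by (simp add: Suc_le_eq card_gt_0_iff)
  let ?e = "\<lambda>n. card (loc_tor G Z n)" and ?t = "\<lambda>n. card (trunc_sat G Z D n)"
    and ?\<rho> = "\<lambda>n. card (trunc_pw G Z D n)"
  have e: "?e n + ?\<rho> n = ?t n" for n
  proof -
    have "loc_tor G Z n = trunc_sat G Z D n - trunc_pw G Z D n"
    proof
      show "loc_tor G Z n \<subseteq> trunc_sat G Z D n - trunc_pw G Z D n"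
      proof
        fix u assume u: "u \<in> loc_tor G Z n"
        have "sum u (- Z) \<le> (\<Sum>i\<in>- Z. gen_bound G * n)"
          by (rule sum_mono) (use loc_tor_bound [OF G(1) u] in \<open>auto intro: less_imp_le\<close>)
        also have "\<dots> \<le> D * n" by (simp add: D_def algebra_simps)
        finally show "u \<in> trunc_sat G Z D n - trunc_pw G Z D n"
          using u by (simp add: loc_tor_def trunc_sat_def trunc_pw_def)
      qed
      show "trunc_sat G Z D n - trunc_pw G Z D n \<subseteq> loc_tor G Z n"
        by (auto simp: loc_tor_def trunc_sat_def trunc_pw_def)
    qed
    moreover have "finite (trunc_pw G Z D n)" by (rule finite_subset [OF trunc_pw_subset trunc_sat_card(1)])
    ultimately have "?e n = ?t n - ?\<rho> n" by (simp add: card_Diff_subset [OF _ trunc_pw_subset])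
    moreover have "?\<rho> n \<le> ?t n" by (rule card_mono [OF trunc_sat_card(1) trunc_pw_subset])
    ultimately show ?thesis by simp
  qed
  have \<rho>: "eventually_poly ?\<rho>" by (rule trunc_pw_eventually_poly [OF G(1)]) (rule D)
  have "real (?\<rho> n) \<le> real (D + 1) ^ ?r * real n ^ ?r" if "n \<ge> 1" for n
  proof -
    have "?\<rho> n \<le> ?t n" by (rule card_mono [OF trunc_sat_card(1) trunc_pw_subset])
    also have "\<dots> \<le> (D * n + 1) ^ ?r" by (rule trunc_sat_card(2))
    also have "\<dots> \<le> ((D + 1) * n) ^ ?r" by (rule power_mono) (use that in auto)
    finally have "real (?\<rho> n) \<le> real (((D + 1) * n) ^ ?r)" by (simp only: of_nat_le_iff)
    also have "\<dots> = real (D + 1) ^ ?r * real n ^ ?r" by (simp only: of_nat_power of_nat_mult power_mult_distrib)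
    finally show ?thesis .
  qed
  then have "\<forall>\<^sub>F n in sequentially. real (?\<rho> n) \<le> real (D + 1) ^ ?r * real n ^ ?r"
    unfolding eventually_sequentially by blast
  then obtain M1 where M1: "\<forall>\<^sub>F n in sequentially.
      \<bar>real (?\<rho> (n + 2)) + real (?\<rho> n) - 2 * real (?\<rho> (n + 1))\<bar> * real n \<le> M1 * real n ^ (?r - 1)"
    by (rule eventually_poly_second_difference [OF \<rho> _ r]) (rule that)
  obtain b where b: "small (?r - 1) b"
    "\<forall>\<^sub>F n in sequentially. ?t (n + 2) + ?t n \<le> 2 * ?t (n + 1) + b (n + 2)"
    by (rule trunc_sat_second_difference [OF G Z D]) (auto intro: that)
  from b(1) obtain M2 where "\<forall>\<^sub>F n in sequentially. real (b n) * real n \<le> M2 * real n ^ (?r - 1)"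
    unfolding small_def ..
  then have "\<forall>\<^sub>F n in sequentially. real (b (n + 2)) * real (n + 2) \<le> M2 * real (n + 2) ^ (?r - 1)"
    by (rule eventually_compose_filterlim [OF _ filterlim_add_const_nat_at_top])
  \<comment> \<open>The truncated saturations contribute the error \<open>b\<close>, the truncated
    powers the second difference of a polynomial of degree at most \<open>?r\<close>. The factor
    3^(?r - 1) comes from n + 2 \<le> 3 n.\<close>
  with M1 b(2) eventually_ge_at_top [of 1]
  have "\<forall>\<^sub>F n in sequentially. (real (?e (n + 2)) + real (?e n) - 2 * real (?e (n + 1))) * real n
      \<le> (M1 + \<bar>M2\<bar> * 3 ^ (?r - 1)) * real n ^ (?r - 1)"
  proof eventually_elim
    case (elim n)
    have n: "real n \<ge> 1" using elim by simp
    have "real (b (n + 2)) * real n \<le> real (b (n + 2)) * real (n + 2)" by (intro mult_left_mono) auto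
    also have "\<dots> \<le> M2 * real (n + 2) ^ (?r - 1)" by (rule elim(4))
    also have "\<dots> \<le> \<bar>M2\<bar> * (3 * real n) ^ (?r - 1)"
      by (intro mult_mono power_mono) (use n in auto)
    finally have bn: "real (b (n + 2)) * real n \<le> \<bar>M2\<bar> * 3 ^ (?r - 1) * real n ^ (?r - 1)"
      by (simp add: power_mult_distrib mult.assoc)
    have er: "real (?e m) = real (?t m) - real (?\<rho> m)" for m using e [of m] by linarith
    have "real (?e (n + 2)) + real (?e n) - 2 * real (?e (n + 1))
        \<le> real (b (n + 2)) + \<bar>real (?\<rho> (n + 2)) + real (?\<rho> n) - 2 * real (?\<rho> (n + 1))\<bar>"
      using of_nat_mono [OF elim(2), where 'a = real] unfolding er by simp
    then have "(real (?e (n + 2)) + real (?e n) - 2 * real (?e (n + 1))) * real n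
        \<le> (real (b (n + 2)) + \<bar>real (?\<rho> (n + 2)) + real (?\<rho> n) - 2 * real (?\<rho> (n + 1))\<bar>) * real n"
      by (rule mult_right_mono) simp
    then show ?case using bn elim(1) by (simp only: distrib_right)
  qed
  then show ?thesis by (rule that)
qed

section \<open>Monomial ideals of the polynomial ring\<close>

lemma mpoly_ring_simps [simp]:
  "carrier (ring_of_type_algebra :: 'a::comm_ring_1 ring) = UNIV"
  "x \<otimes>\<^bsub>(ring_of_type_algebra :: 'a ring)\<^esub> y = x * y"
  "x \<oplus>\<^bsub>(ring_of_type_algebra :: 'a ring)\<^esub> y = x + y"
  "\<one>\<^bsub>(ring_of_type_algebra :: 'a ring)\<^esub> = 1"
  "\<zero>\<^bsub>(ring_of_type_algebra :: 'a ring)\<^esub> = 0"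
  by (simp_all add: ring_of_type_algebra_def)

lemma ring_mpoly_ring: "ring (ring_of_type_algebra :: 'a::comm_ring_1 ring)"
  by (rule ring_from_type_algebra)

lemma cring_mpoly_ring: "cring (ring_of_type_algebra :: 'a::comm_ring_1 ring)"
  by (rule cring_from_type_algebra)

lemma idealI_type:
  assumes "0 \<in> P" "\<And>x y. x \<in> P \<Longrightarrow> y \<in> P \<Longrightarrow> x + y \<in> P" "\<And>x y. y \<in> P \<Longrightarrow> x * y \<in> P"
  shows "ideal P (ring_of_type_algebra :: 'a::comm_ring_1 ring)"
proof (rule idealI [OF ring_mpoly_ring])
  interpret ring "ring_of_type_algebra :: 'a ring" by (rule ring_mpoly_ring)
  show "subgroup P (add_monoid (ring_of_type_algebra :: 'a ring))"
  proof (rule add.subgroupI)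
    show "\<ominus>\<^bsub>ring_of_type_algebra\<^esub> x \<in> P" if "x \<in> P" for x
    proof -
      have "- 1 * x \<in> P" by (rule assms(3) [OF that])
      moreover have "\<ominus>\<^bsub>ring_of_type_algebra\<^esub> x = - 1 * x"
        using minus_equality [of "- x" x] by simp
      ultimately show ?thesis by simp
    qed
  qed (use assms in auto)
  show "x \<otimes>\<^bsub>ring_of_type_algebra\<^esub> a \<in> P" "a \<otimes>\<^bsub>ring_of_type_algebra\<^esub> x \<in> P"
    if "a \<in> P" "x \<in> carrier ring_of_type_algebra" for a x :: 'a
    using assms(3) [OF that(1), of x] by (simp_all add: mult.commute)
qed

lemma idealD_type:
  assumes "ideal P (ring_of_type_algebra :: 'a::comm_ring_1 ring)"
  shows "0 \<in> P" "\<And>x y. x \<in> P \<Longrightarrow> y \<in> P \<Longrightarrow> x + y \<in> P" "\<And>x y. y \<in> P \<Longrightarrow> x * y \<in> P"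
    "\<And>x y. x \<in> P \<Longrightarrow> y \<in> P \<Longrightarrow> x - y \<in> P"
proof -
  interpret ideal P "ring_of_type_algebra :: 'a ring" by (rule assms)
  show 0: "0 \<in> P" using additive_subgroup.zero_closed [OF additive_subgroup_axioms] by simp
  show add: "x + y \<in> P" if "x \<in> P" "y \<in> P" for x y
    using additive_subgroup.a_closed [OF additive_subgroup_axioms that] by simp
  show mult: "x * y \<in> P" if "y \<in> P" for x y using I_l_closed [OF that, of x] by simp
  show "x - y \<in> P" if "x \<in> P" "y \<in> P" for x y
    using add [OF that(1) mult [OF that(2), of "- 1"]] by simp
qed

lemma primeidealD_type:
  assumes "primeideal P (ring_of_type_algebra :: 'a::comm_ring_1 ring)"
  shows "ideal P (ring_of_type_algebra :: 'a ring)" "1 \<notin> P" "\<And>x y. x * y \<in> P \<Longrightarrow> x \<in> P \<or> y \<in> P"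
proof -
  interpret primeideal P "ring_of_type_algebra :: 'a ring" by (rule assms)
  show "ideal P (ring_of_type_algebra :: 'a ring)" by (rule is_ideal)
  show "1 \<notin> P" using one_imp_carrier I_notcarr by auto
  show "x \<in> P \<or> y \<in> P" if "x * y \<in> P" for x y using I_prime [of x y] that by simp
qed

lemma a_r_coset_type: "P +>\<^bsub>(ring_of_type_algebra :: 'a::comm_ring_1 ring)\<^esub> x = (\<lambda>y. y + x) ` P"
  by (auto simp: a_r_coset_def')

lemma a_r_coset_eq_iff_type:
  assumes "ideal P (ring_of_type_algebra :: 'a::comm_ring_1 ring)"
  shows "P +>\<^bsub>(ring_of_type_algebra :: 'a ring)\<^esub> x = P +>\<^bsub>(ring_of_type_algebra :: 'a ring)\<^esub> y \<longleftrightarrow> x - y \<in> P"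
proof
  assume eq: "P +>\<^bsub>(ring_of_type_algebra :: 'a ring)\<^esub> x = P +>\<^bsub>(ring_of_type_algebra :: 'a ring)\<^esub> y"
  have "x \<in> (\<lambda>z. z + x) ` P" using idealD_type(1) [OF assms] by (intro image_eqI [of _ _ 0]) auto
  then have "x \<in> (\<lambda>z. z + y) ` P" using eq by (simp add: a_r_coset_type)
  then show "x - y \<in> P" by auto
next
  assume d: "x - y \<in> P"
  show "P +>\<^bsub>(ring_of_type_algebra :: 'a ring)\<^esub> x = P +>\<^bsub>(ring_of_type_algebra :: 'a ring)\<^esub> y"
    unfolding a_r_coset_type
  proof
    show "(\<lambda>z. z + x) ` P \<subseteq> (\<lambda>z. z + y) ` P"
    proof (rule image_subsetI)
      fix z assume "z \<in> P"
      then have "z + (x - y) \<in> P" using d by (rule idealD_type(2) [OF assms])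
      then show "z + x \<in> (\<lambda>z. z + y) ` P" by (rule image_eqI [rotated]) simp
    qed
    show "(\<lambda>z. z + y) ` P \<subseteq> (\<lambda>z. z + x) ` P"
    proof (rule image_subsetI)
      fix z assume "z \<in> P"
      then have "z - (x - y) \<in> P" using d by (rule idealD_type(4) [OF assms])
      then show "z + y \<in> (\<lambda>z. z + x) ` P" by (rule image_eqI [rotated]) simp
    qed
  qed
qed

text \<open>For an upset \<open>U\<close> this is the monomial ideal with exponent set
  \<open>U\<close>; through it, products, powers, colons and saturations of ideals become operations
  on exponent sets.\<close>

definition mi :: "('n::finite \<Rightarrow> nat) set \<Rightarrow> ('n, 'k::field) mpoly set" where
  "mi U = {p. \<forall>t\<in>Poly_Mapping.keys p. Poly_Mapping.lookup t \<in> U}"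

definition expo :: "('n::finite \<Rightarrow> nat) \<Rightarrow> 'n \<Rightarrow>\<^sub>0 nat" where
  "expo u = Abs_poly_mapping u"

lemma lookup_expo [simp]: "Poly_Mapping.lookup (expo u) = u"
  by (simp add: expo_def)

lemma expo_lookup [simp]: "expo (Poly_Mapping.lookup t) = t"
  by (rule poly_mapping_eqI) simp

lemma expo_add: "expo (\<lambda>i. u i + v i) = expo u + expo v"
  by (rule poly_mapping_eqI) (simp add: lookup_add)

lemma expo_inject [simp]: "expo u = expo v \<longleftrightarrow> u = v"
  by (metis lookup_expo)

lemma lookup_plus: "Poly_Mapping.lookup (s + t) = (\<lambda>i. Poly_Mapping.lookup s i + Poly_Mapping.lookup t i)"
  by (rule ext) (simp add: lookup_add)

lemma poly_mapping_sum_single: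
  "p = (\<Sum>t\<in>Poly_Mapping.keys p. Poly_Mapping.single t (Poly_Mapping.lookup p t))"
proof (rule poly_mapping_eqI)
  fix s
  have "(\<Sum>t\<in>Poly_Mapping.keys p. Poly_Mapping.lookup (Poly_Mapping.single t (Poly_Mapping.lookup p t)) s)
      = (\<Sum>t\<in>Poly_Mapping.keys p. if t = s then Poly_Mapping.lookup p s else 0)"
    by (rule sum.cong) (auto simp: lookup_single when_def)
  then show "Poly_Mapping.lookup p s = Poly_Mapping.lookup
      (\<Sum>t\<in>Poly_Mapping.keys p. Poly_Mapping.single t (Poly_Mapping.lookup p t)) s"
    by (simp add: lookup_sum in_keys_iff)
qed

lemma upset_UNIV_add: "upset_on UNIV U \<Longrightarrow> v \<in> U \<Longrightarrow> (\<lambda>i. u i + v i) \<in> U"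
  by (erule upset_onD) auto

lemma mi_single: "Poly_Mapping.single (expo u) c \<in> mi U" if "u \<in> U"
  using that by (simp add: mi_def)

lemma mi_single_iff: "c \<noteq> 0 \<Longrightarrow> Poly_Mapping.single t c \<in> mi U \<longleftrightarrow> Poly_Mapping.lookup t \<in> U"
  by (simp add: mi_def)

lemma ideal_mi:
  assumes "upset_on UNIV U"
  shows "ideal (mi U) (mpoly_ring :: ('n::finite, 'k::field) mpoly ring)"
proof (rule idealI_type)
  show "0 \<in> mi U" by (simp add: mi_def)
  show "p + q \<in> mi U" if "p \<in> mi U" "q \<in> mi U" for p q :: "('n, 'k) mpoly"
    using that keys_add [of p q] by (auto simp: mi_def)
  show "p * q \<in> mi U" if "q \<in> mi U" for p q :: "('n, 'k) mpoly"
    unfolding mi_def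
  proof (intro CollectI ballI)
    fix t assume "t \<in> Poly_Mapping.keys (p * q)"
    then obtain a b where "t = a + b" "b \<in> Poly_Mapping.keys q" using keys_mult [of p q] by auto
    then show "Poly_Mapping.lookup t \<in> U"
      using that by (simp add: lookup_plus mi_def upset_UNIV_add [OF assms])
  qed
qed

lemma sum_mem_type:
  assumes "ideal P (ring_of_type_algebra :: 'a::comm_ring_1 ring)" "\<And>x. x \<in> A \<Longrightarrow> f x \<in> P"
  shows "sum f A \<in> P"
  using assms(2)
proof (induction A rule: infinite_finite_induct)
  case (insert x A)
  then have "f x \<in> P" "sum f A \<in> P" by auto
  then have "f x + sum f A \<in> P" by (rule idealD_type(2) [OF assms(1)])
  then show ?case using insert.hyps by simp
qed (use idealD_type(1) [OF assms(1)] in simp_all)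

lemma genideal_monomials:
  fixes S :: "('n::finite \<Rightarrow>\<^sub>0 nat) set"
  shows "Idl\<^bsub>(mpoly_ring :: ('n, 'k::field) mpoly ring)\<^esub> ((\<lambda>t. Poly_Mapping.single t 1) ` S)
    = mi {u. \<exists>t\<in>S. \<forall>i. Poly_Mapping.lookup t i \<le> u i}" (is "Idl\<^bsub>?R\<^esub> ?S = mi ?U")
proof
  interpret ring ?R by (rule ring_mpoly_ring)
  have up: "upset_on UNIV ?U" unfolding upset_on_def by (auto intro: order_trans)
  have "?S \<subseteq> mi ?U" by (auto simp: mi_single_iff)
  then show "Idl\<^bsub>?R\<^esub> ?S \<subseteq> mi ?U" by (rule genideal_minimal [OF ideal_mi [OF up]])
  have idl: "ideal (Idl\<^bsub>?R\<^esub> ?S) ?R" by (rule genideal_ideal) simp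
  have sub: "?S \<subseteq> Idl\<^bsub>?R\<^esub> ?S" by (rule genideal_self) simp
  show "mi ?U \<subseteq> Idl\<^bsub>?R\<^esub> ?S"
  proof
    fix p :: "('n, 'k) mpoly" assume p: "p \<in> mi ?U"
    have "Poly_Mapping.single s (Poly_Mapping.lookup p s) \<in> Idl\<^bsub>?R\<^esub> ?S" if s: "s \<in> Poly_Mapping.keys p" for s
    proof -
      from p s obtain t where t: "t \<in> S" "\<forall>i. Poly_Mapping.lookup t i \<le> Poly_Mapping.lookup s i"
        by (auto simp: mi_def)
      let ?d = "expo (\<lambda>i. Poly_Mapping.lookup s i - Poly_Mapping.lookup t i)"
      have "Poly_Mapping.single t 1 \<in> Idl\<^bsub>?R\<^esub> ?S" using sub t by blast
      then have "Poly_Mapping.single ?d (Poly_Mapping.lookup p s) * Poly_Mapping.single t 1 \<in> Idl\<^bsub>?R\<^esub> ?S"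
        by (rule idealD_type(3) [OF idl])
      moreover have "?d + t = s" using t by (intro poly_mapping_eqI) (simp add: lookup_add)
      ultimately show ?thesis by (simp add: mult_single)
    qed
    then have "(\<Sum>t\<in>Poly_Mapping.keys p. Poly_Mapping.single t (Poly_Mapping.lookup p t)) \<in> Idl\<^bsub>?R\<^esub> ?S"
      by (rule sum_mem_type [OF idl])
    then show "p \<in> Idl\<^bsub>?R\<^esub> ?S" by (subst poly_mapping_sum_single)
  qed
qed

text \<open>The given set of monomials may be infinite; Dickson's lemma picks finitely many
  exponents that generate the same upset.\<close>

lemma monomial_ideal_finite:
  assumes "monomial_ideal (I :: ('n::finite, 'k::field) mpoly set)"
  obtains G where "finite G" "I = mi {u. \<exists>g\<in>G. \<forall>i. g i \<le> u i}"
proof -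
  from assms obtain S where S: "I = Idl\<^bsub>mpoly_ring\<^esub> ((\<lambda>t. Poly_Mapping.single t 1) ` S)"
    unfolding monomial_ideal_def ..
  obtain G where G: "G \<subseteq> Poly_Mapping.lookup ` S" "finite G"
    "\<And>u. u \<in> Poly_Mapping.lookup ` S \<Longrightarrow> \<exists>v\<in>G. \<forall>k\<in>UNIV. v k \<le> u k"
    by (rule dickson [of UNIV "Poly_Mapping.lookup ` S"]) (auto intro: that)
  have "(\<exists>t\<in>S. \<forall>i. Poly_Mapping.lookup t i \<le> u i) \<longleftrightarrow> (\<exists>g\<in>G. \<forall>i. g i \<le> u i)" for u
  proof
    assume "\<exists>t\<in>S. \<forall>i. Poly_Mapping.lookup t i \<le> u i"
    then obtain t where t: "t \<in> S" "\<forall>i. Poly_Mapping.lookup t i \<le> u i" by blast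
    from G(3) [of "Poly_Mapping.lookup t"] t(1) obtain v where "v \<in> G" "\<forall>k. v k \<le> Poly_Mapping.lookup t k" by auto
    then show "\<exists>g\<in>G. \<forall>i. g i \<le> u i" using t(2) by (meson order_trans)
  qed (use G(1) in blast)
  then show ?thesis using G(2) S by (intro that [of G]) (simp_all add: genideal_monomials)
qed

lemma ideal_prod_mi:
  assumes U: "upset_on UNIV U" and V: "upset_on UNIV V"
  shows "(mi U :: ('n::finite, 'k::field) mpoly set) \<cdot>\<^bsub>mpoly_ring\<^esub> mi V = mi {w. \<exists>u\<in>U. \<exists>v\<in>V. w = (\<lambda>i. u i + v i)}"
    (is "?L = mi ?W")
proof
  interpret ring "mpoly_ring :: ('n, 'k) mpoly ring" by (rule ring_mpoly_ring)
  have idl: "ideal ?L (mpoly_ring :: ('n, 'k) mpoly ring)"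
    by (rule ideal_prod_is_ideal [OF ideal_mi [OF U] ideal_mi [OF V]])
  show "?L \<subseteq> mi ?W"
  proof
    fix p assume "p \<in> ?L"
    then show "p \<in> mi ?W"
    proof (induction rule: ideal_prod.induct)
      case (prod p q)
      show ?case unfolding mi_def
      proof (intro CollectI ballI)
        fix t assume "t \<in> Poly_Mapping.keys (p \<otimes>\<^bsub>mpoly_ring\<^esub> q)"
        then obtain a b where "t = a + b" "a \<in> Poly_Mapping.keys p" "b \<in> Poly_Mapping.keys q"
          using keys_mult [of p q] by auto
        then show "\<exists>u\<in>U. \<exists>v\<in>V. Poly_Mapping.lookup t = (\<lambda>i. u i + v i)"
          using prod by (intro bexI [of _ "Poly_Mapping.lookup a"] bexI [of _ "Poly_Mapping.lookup b"])
            (auto simp: lookup_plus mi_def)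
      qed
    next
      case (sum p q)
      then show ?case using keys_add [of p q] by (auto simp: mi_def)
    qed
  qed
  show "mi ?W \<subseteq> ?L"
  proof
    fix p :: "('n, 'k) mpoly" assume p: "p \<in> mi ?W"
    have "Poly_Mapping.single s (Poly_Mapping.lookup p s) \<in> ?L" if s: "s \<in> Poly_Mapping.keys p" for s
    proof -
      from p s obtain u v where uv: "u \<in> U" "v \<in> V" "Poly_Mapping.lookup s = (\<lambda>i. u i + v i)"
        by (auto simp: mi_def)
      have "Poly_Mapping.single (expo u) 1 \<otimes>\<^bsub>mpoly_ring\<^esub> Poly_Mapping.single (expo v) (Poly_Mapping.lookup p s) \<in> ?L"
        by (rule ideal_prod.prod) (use uv in \<open>simp_all add: mi_single\<close>)
      moreover have "expo u + expo v = expo (Poly_Mapping.lookup s)"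
        unfolding uv(3) by (rule expo_add [symmetric])
      then have "expo u + expo v = s" by simp
      ultimately show ?thesis by (simp add: mult_single)
    qed
    then have "(\<Sum>t\<in>Poly_Mapping.keys p. Poly_Mapping.single t (Poly_Mapping.lookup p t)) \<in> ?L"
      by (rule sum_mem_type [OF idl])
    then show "p \<in> ?L" by (subst poly_mapping_sum_single)
  qed
qed

lemma upset_pw: "upset_on UNIV (pw G Z n)"
  unfolding upset_on_def by (auto intro: pw_upset)

lemma pw_UNIV_0: "pw G Z 0 = UNIV"
  using pw_0 by blast

lemma ideal_power_mi:
  fixes G :: "('n::finite \<Rightarrow> nat) set"
  assumes "finite G"
  shows "ideal_power (mpoly_ring :: ('n, 'k::field) mpoly ring) (mi {u. \<exists>g\<in>G. \<forall>i. g i \<le> u i}) n = mi (pw G {} n)"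
proof (induction n)
  case 0
  have "ideal_power (mpoly_ring :: ('n, 'k) mpoly ring) (mi {u. \<exists>g\<in>G. \<forall>i. g i \<le> u i}) 0 = UNIV"
    by (simp add: nat_pow_def ideals_set_def)
  then show ?case by (simp add: pw_UNIV_0 mi_def)
next
  case (Suc n)
  let ?R = "mpoly_ring :: ('n, 'k) mpoly ring" and ?U = "{u. \<exists>g\<in>G. \<forall>i. g i \<le> u i}"
  have up: "upset_on UNIV ?U" unfolding upset_on_def by (auto intro: order_trans)
  have "ideal_power ?R (mi ?U) (Suc n) = mi (pw G {} n) \<cdot>\<^bsub>?R\<^esub> mi ?U"
    using Suc by (simp add: nat_pow_def ideals_set_def)
  also have "\<dots> = mi {w. \<exists>u\<in>pw G {} n. \<exists>v\<in>?U. w = (\<lambda>i. u i + v i)}"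
    by (rule ideal_prod_mi [OF upset_pw up])
  also have "{w. \<exists>u\<in>pw G {} n. \<exists>v\<in>?U. w = (\<lambda>i. u i + v i)} = pw G {} (Suc n)"
  proof (intro equalityI subsetI)
    fix w assume "w \<in> {w. \<exists>u\<in>pw G {} n. \<exists>v\<in>?U. w = (\<lambda>i. u i + v i)}"
    then obtain u v g where uv: "u \<in> pw G {} n" "g \<in> G" "\<forall>i. g i \<le> v i" "w = (\<lambda>i. u i + v i)" by blast
    have "v \<in> pw G {} 1" by (rule pw_upset [OF pw_gen [OF assms uv(2)]]) (use uv(3) in simp)
    from pw_add [OF uv(1) this] show "w \<in> pw G {} (Suc n)" by (simp add: uv(4))
  next
    fix w assume "w \<in> pw G {} (Suc n)"
    then obtain a where a: "sum a G = Suc n" "\<And>i. i \<notin> {} \<Longrightarrow> (\<Sum>g\<in>G. a g * g i) \<le> w i"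
      by (rule pwE) (rule that)
    have "\<exists>g\<in>G. a g \<noteq> 0" using a(1) by (metis nat.distinct(1) sum.neutral)
    then obtain g where g: "g \<in> G" "a g \<noteq> 0" by blast
    define b where "b = a(g := a g - 1)"
    have ab: "a h = b h + (if h = g then 1 else 0)" for h using g by (simp add: b_def)
    have sb: "sum b G = n" using a(1) g(1) assms by (simp add: ab sum.distrib)
    have bg: "(\<Sum>h\<in>G. b h * h i) + g i \<le> w i" for i
      using a(2) [of i] g(1) assms
      by (simp add: ab distrib_right sum.distrib if_distrib [of "\<lambda>x. x * _"] cong: if_cong)
    have "(\<lambda>i. w i - g i) \<in> pw G {} n"
    proof (rule pwI [OF sb])
      show "(\<Sum>h\<in>G. b h * h i) \<le> w i - g i" for i using bg [of i] by linarith
    qed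
    moreover have "w = (\<lambda>i. (w i - g i) + g i)" using bg by (intro ext) (metis add_leD2 le_add_diff_inverse2)
    moreover have "g \<in> ?U" using g(1) by blast
    ultimately have "\<exists>u\<in>pw G {} n. \<exists>v\<in>?U. w = (\<lambda>i. u i + v i)"
      by (intro bexI [of _ "\<lambda>i. w i - g i"] bexI [of _ g])
    then show "w \<in> {w. \<exists>u\<in>pw G {} n. \<exists>v\<in>?U. w = (\<lambda>i. u i + v i)}" by (simp only: mem_Collect_eq)
  qed
  finally show ?case .
qed

text \<open>Multiplication by a single monomial shifts exponents injectively. No terms cancel, so
  each term of an element of the colon ideal can be tested separately.\<close>

lemma colon_mi:
  assumes U: "upset_on UNIV U"
  shows "colon (mpoly_ring :: ('n::finite, 'k::field) mpoly ring) (mi U) (mi V)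
    = mi {u. \<forall>v\<in>V. (\<lambda>i. u i + v i) \<in> U}" (is "?L = mi ?W")
proof
  show "?L \<subseteq> mi ?W"
  proof
    fix p assume p: "p \<in> ?L"
    show "p \<in> mi ?W" unfolding mi_def
    proof (intro CollectI ballI)
      fix t v assume t: "t \<in> Poly_Mapping.keys p" and v: "v \<in> V"
      have q: "p * Poly_Mapping.single (expo v) 1 \<in> mi U"
        using p mi_single [OF v, of 1] by (auto simp: colon_def)
      have "p * Poly_Mapping.single (expo v) 1
          = (\<Sum>s\<in>Poly_Mapping.keys p. Poly_Mapping.single (s + expo v) (Poly_Mapping.lookup p s))"
        by (subst (1) poly_mapping_sum_single [of p]) (simp add: sum_distrib_right mult_single)
      then have "Poly_Mapping.lookup (p * Poly_Mapping.single (expo v) 1) (t + expo v)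
          = (\<Sum>s\<in>Poly_Mapping.keys p. if s = t then Poly_Mapping.lookup p t else 0)"
        by (simp add: lookup_sum lookup_single when_def)
      also have "\<dots> \<noteq> 0" using t by (simp add: in_keys_iff)
      finally have "t + expo v \<in> Poly_Mapping.keys (p * Poly_Mapping.single (expo v) 1)"
        by (simp add: in_keys_iff)
      then have "Poly_Mapping.lookup (t + expo v) \<in> U" using q unfolding mi_def by blast
      then show "(\<lambda>i. Poly_Mapping.lookup t i + v i) \<in> U" by (simp add: lookup_plus)
    qed
  qed
  show "mi ?W \<subseteq> ?L"
  proof
    fix p :: "('n, 'k) mpoly" assume p: "p \<in> mi ?W"
    have "p * q \<in> mi U" if q: "q \<in> mi V" for q
      unfolding mi_def
    proof (intro CollectI ballI)
      fix t assume "t \<in> Poly_Mapping.keys (p * q)"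
      then obtain a b where "t = a + b" "a \<in> Poly_Mapping.keys p" "b \<in> Poly_Mapping.keys q"
        using keys_mult [of p q] by auto
      then show "Poly_Mapping.lookup t \<in> U" using p q by (auto simp: lookup_plus mi_def)
    qed
    then show "p \<in> ?L" by (simp add: colon_def)
  qed
qed

section \<open>Symbolic powers of monomial ideals\<close>

definition supp :: "('n \<Rightarrow> nat) \<Rightarrow> 'n set" where
  "supp h = {i. h i \<noteq> 0}"

text \<open>A coordinate of size \<open>gen_bound G * n\<close> satisfies the inequality for any
  choice of \<open>n\<close> generators, so its inversion can be undone.\<close>

lemma pw_absorb:
  assumes "finite G" "u \<in> pw G Z n" "\<And>i. i \<in> Z \<Longrightarrow> i \<notin> Z' \<Longrightarrow> gen_bound G * n \<le> u i"
  shows "u \<in> pw G Z' n"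
proof -
  obtain a where a: "sum a G = n" "\<And>i. i \<notin> Z \<Longrightarrow> (\<Sum>g\<in>G. a g * g i) \<le> u i"
    by (rule pwE [OF assms(2)]) (rule that)
  show ?thesis
  proof (rule pwI [OF a(1)])
    fix i assume i: "i \<notin> Z'"
    show "(\<Sum>g\<in>G. a g * g i) \<le> u i"
    proof (cases "i \<in> Z")
      case True
      have "(\<Sum>g\<in>G. a g * g i) \<le> (\<Sum>g\<in>G. a g * gen_bound G)"
        by (rule sum_mono) (use assms(1) le_gen_bound in auto)
      also have "\<dots> = gen_bound G * n" using a(1) by (simp flip: sum_distrib_right)
      also have "\<dots> \<le> u i" using assms(3) True i by blast
      finally show ?thesis .
    qed (rule a(2))
  qed
qed

text \<open>Saturating by one monomial inverts the variables in its support; for an ideal, the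
  conditions from its generators are intersected.\<close>

definition sat_by :: "('n::finite \<Rightarrow> nat) set \<Rightarrow> ('n \<Rightarrow> nat) set \<Rightarrow> nat \<Rightarrow> ('n \<Rightarrow> nat) set" where
  "sat_by G H n = {u. \<forall>h\<in>H. u \<in> pw G (supp h) n}"

lemma upset_sat_by: "upset_on UNIV (sat_by G H n)"
  unfolding upset_on_def sat_by_def by (auto intro: pw_upset)

lemma symbolic_power_mi:
  fixes G H :: "('n::finite \<Rightarrow> nat) set"
  assumes G: "finite G" and H: "finite H"
  shows "symbolic_power (mpoly_ring :: ('n, 'k::field) mpoly ring)
      (mi {u. \<exists>g\<in>G. \<forall>i. g i \<le> u i}) (mi {u. \<exists>h\<in>H. \<forall>i. h i \<le> u i}) n = mi (sat_by G H n)"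
proof -
  let ?C = "\<lambda>k. {u. \<forall>v\<in>pw H {} k. (\<lambda>i. u i + v i) \<in> pw G {} n}"
  have sp: "symbolic_power (mpoly_ring :: ('n, 'k) mpoly ring)
      (mi {u. \<exists>g\<in>G. \<forall>i. g i \<le> u i}) (mi {u. \<exists>h\<in>H. \<forall>i. h i \<le> u i}) n = (\<Union>k\<in>{1..}. mi (?C k))"
    by (simp add: symbolic_power_def saturation_def ideal_power_mi [OF G] ideal_power_mi [OF H] colon_mi [OF upset_pw])
  have 1: "?C k \<subseteq> sat_by G H n" for k
  proof
    fix u assume u: "u \<in> ?C k"
    show "u \<in> sat_by G H n" unfolding sat_by_def
    proof (intro CollectI ballI)
      fix h assume h: "h \<in> H"
      have "(\<lambda>i. k * h i) \<in> pw H {} (k * 1)" by (rule pw_scale [OF pw_gen [OF H h]])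
      then have "(\<lambda>i. u i + k * h i) \<in> pw G {} n" using u by auto
      then have "(\<lambda>i. u i + k * h i) \<in> pw G (supp h) n" by (rule pw_mono) simp
      then show "u \<in> pw G (supp h) n" by (rule pw_upset) (simp add: supp_def)
    qed
  qed
  define N where "N = gen_bound G * n"
  \<comment> \<open>By pigeonhole, a product of card H * N + 1 generators contains some
    \<open>h\<close> more than \<open>N\<close> times. This raises every coordinate in
    \<open>supp h\<close> to at least \<open>N\<close>, so that these variables need not be inverted
    any more.\<close>
  have 2: "sat_by G H n \<subseteq> ?C (card H * N + 1)"
  proof (intro subsetI CollectI ballI)
    fix u v assume u: "u \<in> sat_by G H n" and v: "v \<in> pw H {} (card H * N + 1)"
    from v obtain b where b: "sum b H = card H * N + 1" "\<And>i. i \<notin> {} \<Longrightarrow> (\<Sum>h\<in>H. b h * h i) \<le> v i"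
      by (rule pwE) (rule that)
    have "\<exists>h\<in>H. b h > N"
    proof (rule ccontr)
      assume "\<not> (\<exists>h\<in>H. b h > N)"
      then have "sum b H \<le> card H * N" using sum_bounded_above [of H b N] by (auto simp: not_less)
      then show False using b(1) by simp
    qed
    then obtain h where h: "h \<in> H" "b h > N" by blast
    have "u \<in> pw G (supp h) n" using u h(1) by (simp add: sat_by_def)
    then have uv: "(\<lambda>i. u i + v i) \<in> pw G (supp h) n" by (rule pw_upset) simp
    show "(\<lambda>i. u i + v i) \<in> pw G {} n"
    proof (rule pw_absorb [OF G uv])
      fix i assume "i \<in> supp h"
      then have "N * 1 \<le> b h * h i" using h(2) by (intro mult_mono) (auto simp: supp_def)
      also have "\<dots> \<le> (\<Sum>h\<in>H. b h * h i)" by (rule member_le_sum [OF h(1)]) (use H in auto)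
      also have "\<dots> \<le> v i" using b(2) by simp
      finally show "gen_bound G * n \<le> u i + v i" by (simp add: N_def)
    qed
  qed
  show ?thesis unfolding sp
  proof
    show "(\<Union>k\<in>{1..}. mi (?C k)) \<subseteq> mi (sat_by G H n)" using 1 by (fastforce simp: mi_def)
    have "mi (sat_by G H n) \<subseteq> mi (?C (card H * N + 1))" using 2 by (auto simp: mi_def)
    then show "mi (sat_by G H n) \<subseteq> (\<Union>k\<in>{1..}. mi (?C k))" by (auto intro!: bexI [of _ "card H * N + 1"])
  qed
qed

section \<open>Krull dimension and multiplicity\<close>

lemma linear_dependence:
  fixes v :: "'b \<Rightarrow> 'f \<Rightarrow> 'k::field"
  assumes "finite F" "finite B" "card F < card B"
  shows "\<exists>c. (\<exists>b\<in>B. c b \<noteq> 0) \<and> (\<forall>t\<in>F. (\<Sum>b\<in>B. c b * v b t) = 0)"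
  using assms
proof (induction F arbitrary: B v rule: finite_induct)
  case empty
  then obtain b where "b \<in> B" by fastforce
  then show ?case by (intro exI [of _ "\<lambda>_. 1"]) auto
next
  case (insert t F)
  show ?case
  proof (cases "\<forall>b\<in>B. v b t = 0")
    case True
    from insert.IH [OF insert.prems(1), of v] insert.prems(2) insert.hyps
    obtain c where "\<exists>b\<in>B. c b \<noteq> 0" "\<forall>t\<in>F. (\<Sum>b\<in>B. c b * v b t) = 0" by auto
    then show ?thesis using True by (intro exI [of _ c]) auto
  next
    case False
    then obtain b0 where b0: "b0 \<in> B" "v b0 t \<noteq> 0" by blast
    let ?B = "B - {b0}"
    \<comment> \<open>The pivot \<open>b0\<close> clears the coordinate \<open>t\<close> of the
      other vectors.\<close>
    let ?v = "\<lambda>b f. v b f - v b t / v b0 t * v b0 f"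
    have "card F < card ?B" using insert b0(1) by simp
    from insert.IH [OF _ this, of ?v] insert.prems(1) obtain c where
      c: "\<exists>b\<in>?B. c b \<noteq> 0" "\<forall>f\<in>F. (\<Sum>b\<in>?B. c b * ?v b f) = 0" by auto
    define s where "s = (\<Sum>b\<in>?B. c b * (v b t / v b0 t))"
    define d where "d = c(b0 := - s)"
    have expand: "(\<Sum>b\<in>B. d b * v b f) = (\<Sum>b\<in>?B. c b * v b f) - s * v b0 f" for f
    proof -
      have "(\<Sum>b\<in>?B. d b * v b f) = (\<Sum>b\<in>?B. c b * v b f)" by (rule sum.cong) (auto simp: d_def)
      then show ?thesis using b0(1) insert.prems(1) by (simp add: sum.remove [of B b0] d_def)
    qed
    have "(\<Sum>b\<in>B. d b * v b f) = 0" if "f \<in> insert t F" for f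
    proof -
      have "(\<Sum>b\<in>?B. c b * ?v b f) = (\<Sum>b\<in>?B. c b * v b f) - s * v b0 f"
        by (simp add: s_def right_diff_distrib sum_subtractf sum_distrib_right mult.assoc)
      moreover have "(\<Sum>b\<in>?B. c b * ?v b f) = 0"
        using c(2) that b0(2) by auto
      ultimately show ?thesis using expand [of f] by simp
    qed
    moreover have "\<exists>b\<in>B. d b \<noteq> 0" using c(1) by (auto simp: d_def)
    ultimately show ?thesis by blast
  qed
qed

text \<open>A polynomial relation between \<open>y 0, y 1, \<dots>\<close> modulo the smallest prime of the chain is peeled
  off from its lexicographically smallest monomial, one variable and one prime at a time.\<close>

lemma prime_chain_no_relation:
  fixes P :: "nat \<Rightarrow> 'a::comm_ring_1 set" and c :: "(nat \<Rightarrow> nat) \<Rightarrow> 'a"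
  assumes primes: "\<And>i. i \<le> k \<Longrightarrow> primeideal (P i) ring_of_type_algebra"
    and inc: "\<And>i. i < k \<Longrightarrow> P i \<subseteq> P (Suc i)"
    and y: "\<And>i. i < k \<Longrightarrow> y i \<in> P (Suc i)" "\<And>i. i < k \<Longrightarrow> y i \<notin> P i"
    and B: "finite B" "B \<noteq> {}" and c: "\<And>a. a \<in> B \<Longrightarrow> \<exists>d. d * c a = 1"
    and j: "j \<le> k" and rel: "(\<Sum>a\<in>B. c a * (\<Prod>i\<in>{j..<k}. y i ^ a i)) \<in> P j"
    and inj: "\<And>a b. a \<in> B \<Longrightarrow> b \<in> B \<Longrightarrow> (\<And>i. i \<in> {j..<k} \<Longrightarrow> a i = b i) \<Longrightarrow> a = b"
  shows False
  using B c j rel inj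
proof (induction "k - j" arbitrary: j B)
  case 0
  then have "j = k" by simp
  have "a = b" if "a \<in> B" "b \<in> B" for a b using 0 that \<open>j = k\<close> by auto
  then obtain a where a: "B = {a}" using \<open>B \<noteq> {}\<close> by blast
  then have "c a \<in> P k" using 0 \<open>j = k\<close> by simp
  moreover obtain d where "d * c a = 1" using 0(4) [of a] a by auto
  moreover have "d * c a \<in> P k" if "c a \<in> P k"
    using idealD_type(3) [OF primeidealD_type(1) [OF primes [OF order_refl]] that] .
  ultimately show ?case using primeidealD_type(2) [OF primes [OF order_refl]] by metis
next
  case (Suc m)
  then have jk: "j < k" by simp
  have Pj: "primeideal (P j) (ring_of_type_algebra :: 'a ring)" using primes jk by simp
  have PSj: "ideal (P (Suc j)) (ring_of_type_algebra :: 'a ring)"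
    using primeidealD_type(1) [OF primes [of "Suc j"]] jk by simp
  \<comment> \<open>The lowest power of \<open>y j\<close> that occurs. It can be cancelled since
    \<open>y j\<close> is not in the prime \<open>P j\<close>; the terms still divisible by
    \<open>y j\<close> then lie in \<open>P (Suc j)\<close>.\<close>
  define r where "r = Min ((\<lambda>a. a j) ` B)"
  have r: "r \<le> a j" if "a \<in> B" for a using that Suc.prems(1) by (simp add: r_def)
  let ?q = "\<lambda>a. \<Prod>i\<in>{Suc j..<k}. y i ^ a i"
  have split: "(\<Prod>i\<in>{j..<k}. y i ^ a i) = y j ^ a j * ?q a" for a
    using jk by (simp add: prod.atLeast_Suc_lessThan)
  have "(\<Sum>a\<in>B. c a * (\<Prod>i\<in>{j..<k}. y i ^ a i)) = y j ^ r * (\<Sum>a\<in>B. c a * (y j ^ (a j - r) * ?q a))"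
    unfolding sum_distrib_left
  proof (rule sum.cong [OF refl])
    fix a assume "a \<in> B"
    then have "y j ^ a j = y j ^ r * y j ^ (a j - r)" using r by (simp flip: power_add)
    then show "c a * (\<Prod>i\<in>{j..<k}. y i ^ a i) = y j ^ r * (c a * (y j ^ (a j - r) * ?q a))"
      unfolding split by (simp add: ac_simps)
  qed
  then have "y j ^ r * (\<Sum>a\<in>B. c a * (y j ^ (a j - r) * ?q a)) \<in> P j" using Suc.prems(5) by simp
  moreover have "y j ^ n \<notin> P j" for n
    by (induction n) (use primeidealD_type [OF Pj] y(2) [OF jk] in auto)
  ultimately have "(\<Sum>a\<in>B. c a * (y j ^ (a j - r) * ?q a)) \<in> P j"
    using primeidealD_type(3) [OF Pj] by blast
  then have 1: "(\<Sum>a\<in>B. c a * (y j ^ (a j - r) * ?q a)) \<in> P (Suc j)" using inc [OF jk] by blast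
  let ?B = "{a \<in> B. a j = r}"
  have 2: "(\<Sum>a\<in>B - ?B. c a * (y j ^ (a j - r) * ?q a)) \<in> P (Suc j)"
  proof (rule sum_mem_type [OF PSj])
    fix a assume a: "a \<in> B - ?B"
    then have "a j - r = Suc (a j - r - 1)" using r [of a] by auto
    then have "c a * (y j ^ (a j - r) * ?q a) = (c a * (y j ^ (a j - r - 1) * ?q a)) * y j"
      by (metis (no_types, lifting) mult.assoc mult.commute power_Suc)
    moreover have "(c a * (y j ^ (a j - r - 1) * ?q a)) * y j \<in> P (Suc j)"
      by (rule idealD_type(3) [OF PSj y(1) [OF jk]])
    ultimately show "c a * (y j ^ (a j - r) * ?q a) \<in> P (Suc j)" by simp
  qed
  have "(\<Sum>a\<in>B. c a * (y j ^ (a j - r) * ?q a))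
      = (\<Sum>a\<in>B - ?B. c a * (y j ^ (a j - r) * ?q a)) + (\<Sum>a\<in>?B. c a * (y j ^ (a j - r) * ?q a))"
    by (rule sum.subset_diff) (use Suc.prems(1) in auto)
  then have "(\<Sum>a\<in>?B. c a * (y j ^ (a j - r) * ?q a)) \<in> P (Suc j)"
    using idealD_type(4) [OF PSj 1 2] by simp
  moreover have "(\<Sum>a\<in>?B. c a * (y j ^ (a j - r) * ?q a)) = (\<Sum>a\<in>?B. c a * ?q a)"
    by (rule sum.cong) auto
  ultimately have rel: "(\<Sum>a\<in>?B. c a * ?q a) \<in> P (Suc j)" by simp
  have "r \<in> (\<lambda>a. a j) ` B" unfolding r_def using Suc.prems(1,2) by (intro Min_in) auto
  then have ne: "?B \<noteq> {}" by auto
  show False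
  proof (rule Suc.hyps(1) [of "Suc j" ?B])
    show "m = k - Suc j" using Suc.hyps(2) by simp
    show "finite ?B" using Suc.prems(1) by simp
    show "?B \<noteq> {}" by (rule ne)
    show "\<exists>d. d * c a = 1" if "a \<in> ?B" for a using Suc.prems(3) that by simp
    show "Suc j \<le> k" using jk by simp
    show "(\<Sum>a\<in>?B. c a * ?q a) \<in> P (Suc j)" by (rule rel)
    show "a = b" if ab: "a \<in> ?B" "b \<in> ?B" "\<And>i. i \<in> {Suc j..<k} \<Longrightarrow> a i = b i" for a b
    proof (rule Suc.prems(6))
      show "a \<in> B" "b \<in> B" using ab by auto
      show "a i = b i" if "i \<in> {j..<k}" for i using ab that by (cases "i = j") auto
    qed
  qed
qed

definition tdeg :: "('n::finite \<Rightarrow>\<^sub>0 nat) \<Rightarrow> nat" where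
  "tdeg t = (\<Sum>i\<in>UNIV. Poly_Mapping.lookup t i)"

definition deg_le :: "nat \<Rightarrow> ('n::finite, 'k::field) mpoly \<Rightarrow> bool" where
  "deg_le d p \<longleftrightarrow> (\<forall>t\<in>Poly_Mapping.keys p. tdeg t \<le> d)"

lemma tdeg_add: "tdeg (s + t) = tdeg s + tdeg t"
  by (simp add: tdeg_def lookup_add sum.distrib)

lemma deg_le_mult: "deg_le d p \<Longrightarrow> deg_le e q \<Longrightarrow> deg_le (d + e) (p * q)"
  unfolding deg_le_def
proof
  fix t assume p: "\<forall>t\<in>Poly_Mapping.keys p. tdeg t \<le> d" and q: "\<forall>t\<in>Poly_Mapping.keys q. tdeg t \<le> e"
    and t: "t \<in> Poly_Mapping.keys (p * q)"
  obtain a b where "t = a + b" "a \<in> Poly_Mapping.keys p" "b \<in> Poly_Mapping.keys q"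
    using keys_mult [of p q] t by auto
  then show "tdeg t \<le> d + e" using p q by (simp add: tdeg_add add_mono)
qed

lemma deg_le_one: "deg_le 0 1"
  by (simp add: deg_le_def tdeg_def)

lemma deg_le_power: "deg_le d p \<Longrightarrow> deg_le (n * d) (p ^ n)"
  by (induction n) (simp_all add: deg_le_one deg_le_mult)

lemma deg_le_prod: "finite A \<Longrightarrow> (\<And>i. i \<in> A \<Longrightarrow> deg_le (d i) (p i)) \<Longrightarrow> deg_le (\<Sum>i\<in>A. d i) (\<Prod>i\<in>A. p i)"
  by (induction A rule: finite_induct) (simp_all add: deg_le_one deg_le_mult)

lemma deg_le_mono: "deg_le d p \<Longrightarrow> d \<le> e \<Longrightarrow> deg_le e p"
  by (auto simp: deg_le_def)

lemma deg_le_exists: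
  obtains d where "deg_le d p"
proof
  show "deg_le (\<Sum>t\<in>Poly_Mapping.keys p. tdeg t) p"
    unfolding deg_le_def by (intro ballI member_le_sum) auto
qed

lemma lookup_const_mult: "Poly_Mapping.lookup (Poly_Mapping.single 0 c * p) t = (c :: 'k::field) * Poly_Mapping.lookup p t"
proof -
  have "Poly_Mapping.single 0 c * p = (\<Sum>s\<in>Poly_Mapping.keys p. Poly_Mapping.single s (c * Poly_Mapping.lookup p s))"
    by (subst (1) poly_mapping_sum_single [of p]) (simp add: sum_distrib_left mult_single)
  then have "Poly_Mapping.lookup (Poly_Mapping.single 0 c * p) t
      = (\<Sum>s\<in>Poly_Mapping.keys p. if s = t then c * Poly_Mapping.lookup p t else 0)"
    by (simp add: lookup_sum lookup_single when_def)
  then show ?thesis by (auto simp: in_keys_iff)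
qed

lemma finite_tdeg_le: "finite {t :: 'n::finite \<Rightarrow>\<^sub>0 nat. tdeg t \<le> m}"
proof -
  have "{t :: 'n \<Rightarrow>\<^sub>0 nat. tdeg t \<le> m} \<subseteq> expo ` (\<Union>j\<le>m. compositions UNIV j)"
  proof
    fix t :: "'n \<Rightarrow>\<^sub>0 nat" assume "t \<in> {t. tdeg t \<le> m}"
    then have "Poly_Mapping.lookup t \<in> (\<Union>j\<le>m. compositions UNIV j)"
      by (auto simp: compositions_def tdeg_def)
    then show "t \<in> expo ` (\<Union>j\<le>m. compositions UNIV j)" by (rule image_eqI [rotated]) simp
  qed
  moreover have "finite (\<Union>j\<le>m. compositions (UNIV :: 'n set) j)" by (auto intro: finite_compositions)
  ultimately show ?thesis by (meson finite_imageI finite_subset)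
qed

text \<open>A dimension count. For k > s the products of powers of \<open>y 0\<close>, ...,
  \<open>y (k - 1)\<close> with bounded exponents outnumber the monomials outside \<open>N\<close>
  of the degrees that they reach. So a nontrivial combination of them with constant coefficients
  lies in \<open>mi N\<close>, hence in the smallest prime.\<close>

lemma prime_chain_mi_upper:
  fixes P :: "nat \<Rightarrow> ('n::finite, 'k::field) mpoly set"
  assumes primes: "\<And>i. i \<le> k \<Longrightarrow> primeideal (P i) mpoly_ring"
    and inc: "\<And>i. i < k \<Longrightarrow> P i \<subset> P (Suc i)"
    and N: "mi N \<subseteq> P 0"
    and growth: "\<And>m. card {t :: 'n \<Rightarrow>\<^sub>0 nat. tdeg t \<le> m \<and> Poly_Mapping.lookup t \<notin> N} \<le> C * (m + 1) ^ s"
  shows "k \<le> s"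
proof (rule ccontr)
  assume "\<not> k \<le> s"
  then have ks: "s < k" by simp
  have "\<forall>i\<in>{..<k}. \<exists>y. y \<in> P (Suc i) \<and> y \<notin> P i" using inc by blast
  from bchoice [OF this] obtain y where y: "\<forall>i\<in>{..<k}. y i \<in> P (Suc i) \<and> y i \<notin> P i" ..
  have "\<forall>i\<in>{..<k}. \<exists>d. deg_le d (y i)" using deg_le_exists by blast
  from bchoice [OF this] obtain d where d: "\<forall>i\<in>{..<k}. deg_le (d i) (y i)" ..
  define e where "e = (\<Sum>i<k. d i)"
  \<comment> \<open>Chosen such that C (e M + 1)^s \<le> M (M + 1)^s < (M + 1)^(s + 1), where the
    last number is at most the number of exponent vectors in \<open>?B\<close>.\<close>
  define M where "M = C * (e + 1) ^ s"
  define F where "F = {t :: 'n \<Rightarrow>\<^sub>0 nat. tdeg t \<le> e * M \<and> Poly_Mapping.lookup t \<notin> N}"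
  let ?B = "PiE {..<k} (\<lambda>_. {..M})"
  let ?m = "\<lambda>a. \<Prod>i\<in>{0..<k}. y i ^ a i"
  have finF: "finite F" unfolding F_def by (rule finite_subset [OF _ finite_tdeg_le]) auto
  have finB: "finite ?B" by (intro finite_PiE) auto
  have degm: "deg_le (e * M) (?m a)" if a: "a \<in> ?B" for a
  proof -
    have "deg_le (\<Sum>i\<in>{0..<k}. a i * d i) (?m a)" by (intro deg_le_prod deg_le_power) (use d in auto)
    moreover have "(\<Sum>i\<in>{0..<k}. a i * d i) \<le> (\<Sum>i\<in>{0..<k}. M * d i)"
      by (intro sum_mono mult_right_mono) (use a in auto)
    moreover have "(\<Sum>i\<in>{0..<k}. M * d i) = e * M" by (simp add: e_def sum_distrib_left atLeast0LessThan mult.commute)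
    ultimately show ?thesis using deg_le_mono by metis
  qed
  have "card F \<le> C * (e * M + 1) ^ s" unfolding F_def by (rule growth)
  also have "\<dots> \<le> C * ((e + 1) * (M + 1)) ^ s" by (intro mult_left_mono power_mono) auto
  also have "\<dots> = (C * (e + 1) ^ s) * (M + 1) ^ s" by (simp only: power_mult_distrib mult.assoc)
  also have "\<dots> = M * (M + 1) ^ s" by (simp only: M_def)
  also have "\<dots> < (M + 1) ^ Suc s" by simp
  also have "\<dots> \<le> (M + 1) ^ k" using ks by (intro power_increasing) auto
  also have "\<dots> = card ?B" by (simp add: card_PiE)
  finally have "card F < card ?B" .
  from linear_dependence [OF finF finB this, of "\<lambda>a t. Poly_Mapping.lookup (?m a) t"]
  obtain c where c: "\<exists>a\<in>?B. c a \<noteq> 0" "\<forall>t\<in>F. (\<Sum>a\<in>?B. c a * Poly_Mapping.lookup (?m a) t) = 0" by auto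
  let ?B' = "{a \<in> ?B. c a \<noteq> 0}"
  define p where "p = (\<Sum>a\<in>?B'. Poly_Mapping.single 0 (c a) * ?m a)"
  have lp: "Poly_Mapping.lookup p t = (\<Sum>a\<in>?B. c a * Poly_Mapping.lookup (?m a) t)" for t
    unfolding p_def lookup_sum lookup_const_mult by (rule sum.mono_neutral_left) (use finB in auto)
  have "p \<in> mi N"
    unfolding mi_def
  proof (intro CollectI ballI)
    fix t assume t: "t \<in> Poly_Mapping.keys p"
    then have nz: "(\<Sum>a\<in>?B. c a * Poly_Mapping.lookup (?m a) t) \<noteq> 0" by (simp add: in_keys_iff lp)
    then obtain a where a: "a \<in> ?B" "Poly_Mapping.lookup (?m a) t \<noteq> 0"
      by (metis (no_types, lifting) mult_zero_right sum.neutral)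
    then have "tdeg t \<le> e * M" using degm [OF a(1)] by (simp add: deg_le_def in_keys_iff)
    moreover have "t \<notin> F" using c(2) nz by blast
    ultimately show "Poly_Mapping.lookup t \<in> N" by (simp add: F_def)
  qed
  then have p0: "p \<in> P 0" using N by blast
  show False
  proof (rule prime_chain_no_relation [of k P y ?B' "\<lambda>a. Poly_Mapping.single 0 (c a)" 0])
    show "primeideal (P i) mpoly_ring" if "i \<le> k" for i by (rule primes [OF that])
    show "P i \<subseteq> P (Suc i)" if "i < k" for i using inc [OF that] by blast
    show "y i \<in> P (Suc i)" "y i \<notin> P i" if "i < k" for i using y that by auto
    show "finite ?B'" using finB by simp
    show "?B' \<noteq> {}" using c(1) by blast
    show "\<exists>d. d * Poly_Mapping.single 0 (c a) = 1" if "a \<in> ?B'" for a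
      using that by (intro exI [of _ "Poly_Mapping.single 0 (inverse (c a))"]) (simp add: mult_single)
    show "(\<Sum>a\<in>?B'. Poly_Mapping.single 0 (c a) * (\<Prod>i\<in>{0..<k}. y i ^ a i)) \<in> P 0"
      using p0 by (simp add: p_def)
    show "a = b" if "a \<in> ?B'" "b \<in> ?B'" "\<And>i. i \<in> {0..<k} \<Longrightarrow> a i = b i" for a b
      using that by (intro PiE_ext [of a "{..<k}" "\<lambda>_. {..M}" b]) auto
  qed simp
qed

text \<open>This is the ideal of the variables outside \<open>Z\<close>. If neither factor lies in
  it, take from each the lexicographically least monomial in the variables of \<open>Z\<close>.
  Their product arises in one way only and survives.\<close>

lemma primeideal_coordinate:
  fixes Z :: "'n::finite set"
  shows "primeideal (mi {u. \<exists>i. i \<notin> Z \<and> u i \<noteq> 0}) (mpoly_ring :: ('n, 'k::field) mpoly ring)"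
    (is "primeideal (mi ?U) ?R")
proof (rule primeidealI)
  have up: "upset_on UNIV ?U"     unfolding upset_on_def
  proof (intro ballI allI impI)
    fix u v :: "'n \<Rightarrow> nat" assume "u \<in> ?U" and le: "\<forall>k\<in>UNIV. u k \<le> v k"
    then obtain i where "i \<notin> Z" "u i \<noteq> 0" by blast
    then show "v \<in> ?U" using le [rule_format, of i] by auto
  qed
  show "ideal (mi ?U) ?R" by (rule ideal_mi [OF up])
  show "cring ?R" by (rule cring_mpoly_ring)
  have "(1 :: ('n, 'k) mpoly) \<notin> mi ?U" by (simp add: mi_def)
  then show "carrier ?R \<noteq> mi ?U" by auto
  fix p q :: "('n, 'k) mpoly" assume pq: "p \<otimes>\<^bsub>?R\<^esub> q \<in> mi ?U"
  let ?N = "card (UNIV :: 'n set)"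
  obtain en :: "nat \<Rightarrow> 'n" where en: "bij_betw en {0..<?N} UNIV"
    using ex_bij_betw_nat_finite [of "UNIV :: 'n set"] by auto
  \<comment> \<open>Exponents are listed along an enumeration of the variables, so that the
    lexicographic order on sequences becomes available.\<close>
  define o' where "o' t = (\<lambda>k. if k < ?N then Poly_Mapping.lookup t (en k) else 0)"
    for t :: "'n \<Rightarrow>\<^sub>0 nat"
  have o'_inj: "s = t" if "o' s = o' t" for s t
  proof (rule poly_mapping_eqI)
    fix i
    have "i \<in> en ` {0..<?N}" using en by (simp add: bij_betw_def)
    then obtain k where "k < ?N" "en k = i" by auto
    then show "Poly_Mapping.lookup s i = Poly_Mapping.lookup t i"
      using fun_cong [OF that, of k] by (simp add: o'_def)
  qed
  have o'_add: "o' (s + t) = (\<lambda>k. o' s k + o' t k)" for s t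
    by (rule ext) (simp add: o'_def lookup_add)
  let ?L = "{t :: 'n \<Rightarrow>\<^sub>0 nat. Poly_Mapping.lookup t \<notin> ?U}"
  have min: "\<exists>s\<in>Poly_Mapping.keys p \<inter> ?L. \<forall>t\<in>Poly_Mapping.keys p \<inter> ?L. t \<noteq> s \<longrightarrow> less_fun (o' s) (o' t)"
    if "p \<notin> mi ?U" for p :: "('n, 'k) mpoly"
  proof -
    from that have "\<exists>t. t \<in> Poly_Mapping.keys p \<inter> ?L" by (auto simp: mi_def)
    then obtain t0 where "o' t0 \<in> o' ` (Poly_Mapping.keys p \<inter> ?L)" by blast
    from wfE_min [OF wf_less_fun_finite_support [of "?N"] this] obtain a where
      a: "a \<in> o' ` (Poly_Mapping.keys p \<inter> ?L)" "\<And>b. (b, a) \<in> {(b, a). less_fun b a \<and> (\<forall>i\<ge>?N. a i = 0) \<and> (\<forall>i\<ge>?N. b i = 0)}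
        \<Longrightarrow> b \<notin> o' ` (Poly_Mapping.keys p \<inter> ?L)" by auto
    from a(1) obtain s where s: "s \<in> Poly_Mapping.keys p \<inter> ?L" "a = o' s" by blast
    have "less_fun (o' s) (o' t)" if t: "t \<in> Poly_Mapping.keys p \<inter> ?L" "t \<noteq> s" for t
    proof -
      have "\<not> less_fun (o' t) (o' s)"
      proof
        assume "less_fun (o' t) (o' s)"
        then have "o' t \<notin> o' ` (Poly_Mapping.keys p \<inter> ?L)" by (intro a(2)) (simp add: s(2) o'_def)
        then show False using t(1) by blast
      qed
      moreover have "finite {k. o' s k \<noteq> o' t k}"
        by (rule finite_subset [of _ "{..<?N}"]) (auto simp: o'_def)
      from less_fun_trichotomy [OF this] have "less_fun (o' s) (o' t) \<or> o' s = o' t \<or> less_fun (o' t) (o' s)" .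
      ultimately show ?thesis using o'_inj t(2) by blast
    qed
    then show ?thesis using s(1) by blast
  qed
  have L_add: "a + b \<in> ?L \<longleftrightarrow> a \<in> ?L \<and> b \<in> ?L" for a b by (auto simp: lookup_add)
  show "p \<in> mi ?U \<or> q \<in> mi ?U"
  proof (rule ccontr)
    assume "\<not> (p \<in> mi ?U \<or> q \<in> mi ?U)"
    then have np: "p \<notin> mi ?U" and nq: "q \<notin> mi ?U" by auto
    from min [OF np] obtain s where s: "s \<in> Poly_Mapping.keys p \<inter> ?L"
      "\<forall>t\<in>Poly_Mapping.keys p \<inter> ?L. t \<noteq> s \<longrightarrow> less_fun (o' s) (o' t)" by blast
    from min [OF nq] obtain t where t: "t \<in> Poly_Mapping.keys q \<inter> ?L"
      "\<forall>x\<in>Poly_Mapping.keys q \<inter> ?L. x \<noteq> t \<longrightarrow> less_fun (o' t) (o' x)" by blast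
    let ?c = "Poly_Mapping.lookup p s" and ?d = "Poly_Mapping.lookup q t"
    let ?p1 = "p - Poly_Mapping.single s ?c" and ?q1 = "q - Poly_Mapping.single t ?d"
    have kp: "Poly_Mapping.keys ?p1 = Poly_Mapping.keys p - {s}"
      by (auto simp: in_keys_iff lookup_minus lookup_single when_def split: if_splits)
    have kq: "Poly_Mapping.keys ?q1 = Poly_Mapping.keys q - {t}"
      by (auto simp: in_keys_iff lookup_minus lookup_single when_def split: if_splits)
    have 1: "s + t \<notin> Poly_Mapping.keys (Poly_Mapping.single s ?c * ?q1)"
    proof
      assume "s + t \<in> Poly_Mapping.keys (Poly_Mapping.single s ?c * ?q1)"
      then obtain a b where ab: "s + t = a + b" "a \<in> Poly_Mapping.keys (Poly_Mapping.single s ?c)" "b \<in> Poly_Mapping.keys ?q1"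
        using keys_mult [of "Poly_Mapping.single s ?c" ?q1] by auto
      then have "a = s" by (simp split: if_splits)
      then show False using ab kq by simp
    qed
    have 2: "s + t \<notin> Poly_Mapping.keys (?p1 * q)"
    proof
      assume "s + t \<in> Poly_Mapping.keys (?p1 * q)"
      then obtain a b where ab: "s + t = a + b" "a \<in> Poly_Mapping.keys ?p1" "b \<in> Poly_Mapping.keys q"
        using keys_mult [of ?p1 q] by auto
      have "s + t \<in> ?L" using s(1) t(1) L_add by blast
      then have "a \<in> ?L" "b \<in> ?L" unfolding ab(1) using L_add by blast+
      then have sa: "less_fun (o' s) (o' a)" and tb: "b = t \<or> less_fun (o' t) (o' b)"
        using s(2) t(2) ab kp by auto
      have "less_fun (o' (s + t)) (o' (a + t))" unfolding o'_add by (rule less_fun_add [OF sa])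
      moreover have "b = t \<or> less_fun (o' (a + t)) (o' (a + b))"
        using tb less_fun_add [of "o' t" "o' b" "o' a"] by (auto simp: o'_add add.commute)
      ultimately have "less_fun (o' (s + t)) (o' (a + b))" using less_fun_trans by blast
      then show False using ab(1) less_fun_irrefl by metis
    qed
    \<comment> \<open>The monomial s + t occurs in the first summand only, by 1 and 2.\<close>
    have "p * q = Poly_Mapping.single s ?c * Poly_Mapping.single t ?d + Poly_Mapping.single s ?c * ?q1 + ?p1 * q"
      by (simp add: algebra_simps)
    then have "Poly_Mapping.lookup (p * q) (s + t) = ?c * ?d"
      using 1 2 by (simp add: lookup_add mult_single in_keys_iff)
    then have "s + t \<in> Poly_Mapping.keys (p * q)" using s(1) t(1) by (auto simp: in_keys_iff)
    then have "Poly_Mapping.lookup (s + t) \<in> ?U" using pq unfolding mi_def by auto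
    moreover have "s + t \<in> ?L" using s(1) t(1) L_add by blast
    ultimately show False by blast
  qed
qed

lemma mi_mono: "U \<subseteq> V \<Longrightarrow> mi U \<subseteq> mi V"
  by (auto simp: mi_def)

section \<open>Quotients by monomial ideals\<close>

lemma subfield_constants:
  "subfield (range (Poly_Mapping.single 0)) (mpoly_ring :: ('n::finite, 'k::field) mpoly ring)"
proof -
  have "ring_hom_ring (ring_of_type_algebra :: 'k ring) (mpoly_ring :: ('n, 'k) mpoly ring) (Poly_Mapping.single 0)"
    by (rule ring_hom_ringI) (auto simp: ring_mpoly_ring mult_single single_add)
  from ring_hom_ring.img_is_subfield(2) [OF this field.carrier_is_subfield [OF field_from_type_algebra]]
  show ?thesis by simp
qed

lemma dimension_monomials:
  assumes "finite M"
  shows "ring.dimension (mpoly_ring :: ('n::finite, 'k::field) mpoly ring) (card M)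
    (range (Poly_Mapping.single 0)) {p. Poly_Mapping.keys p \<subseteq> M}"
  using assms
proof (induction M rule: finite_induct)
  case empty
  interpret ring "mpoly_ring :: ('n, 'k) mpoly ring" by (rule ring_mpoly_ring)
  have "{p :: ('n, 'k) mpoly. Poly_Mapping.keys p \<subseteq> {}} = {\<zero>\<^bsub>mpoly_ring\<^esub>}" by auto
  then show ?case using zero_dim by simp
next
  case (insert t M)
  interpret ring "mpoly_ring :: ('n, 'k) mpoly ring" by (rule ring_mpoly_ring)
  let ?K = "range (Poly_Mapping.single 0) :: ('n, 'k) mpoly set"
  have "{p :: ('n, 'k) mpoly. Poly_Mapping.keys p \<subseteq> insert t M}
      = line_extension ?K (Poly_Mapping.single t 1) {p. Poly_Mapping.keys p \<subseteq> M}" (is "?A = ?B")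
  proof (intro equalityI subsetI)
    fix p assume p: "p \<in> ?A"
    let ?q = "p - Poly_Mapping.single t (Poly_Mapping.lookup p t)"
    have "Poly_Mapping.keys ?q \<subseteq> M"
      using p by (auto simp: in_keys_iff lookup_minus lookup_single when_def split: if_splits)
    moreover have "p = Poly_Mapping.single 0 (Poly_Mapping.lookup p t) \<otimes>\<^bsub>mpoly_ring\<^esub> Poly_Mapping.single t 1 \<oplus>\<^bsub>mpoly_ring\<^esub> ?q"
      by (simp add: mult_single)
    ultimately show "p \<in> ?B" unfolding line_extension_mem_iff by blast
  next
    fix p assume "p \<in> ?B"
    then obtain c q where "Poly_Mapping.keys q \<subseteq> M" "p = Poly_Mapping.single t c + q"
      unfolding line_extension_mem_iff by (auto simp: mult_single)
    then show "p \<in> ?A" using keys_add [of "Poly_Mapping.single t c" q] by (auto split: if_splits)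
  qed
  moreover have "dimension (Suc (card M)) ?K (line_extension ?K (Poly_Mapping.single t 1) {p. Poly_Mapping.keys p \<subseteq> M})"
    by (rule Suc_dim [OF _ _ insert.IH]) (use insert.hyps in auto)
  ultimately show ?case using insert.hyps by simp
qed

lemma quot_hom:
  assumes "ideal Q (ring_of_type_algebra :: 'a::comm_ring_1 ring)"
  shows "ring_hom_ring (ring_of_type_algebra :: 'a ring) (ring_of_type_algebra Quot Q) ((+>\<^bsub>ring_of_type_algebra\<^esub>) Q)"
  by (rule ideal.rcos_ring_hom_ring [OF assms])

lemma carrier_quot:
  "carrier ((ring_of_type_algebra :: 'a::comm_ring_1 ring) Quot Q) = range ((+>\<^bsub>ring_of_type_algebra\<^esub>) Q)"
  by (auto simp: FactRing_def A_RCOSETS_def')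

lemma coset_mem_image_iff:
  assumes "ideal Q (ring_of_type_algebra :: 'a::comm_ring_1 ring)" "ideal P (ring_of_type_algebra :: 'a ring)" "Q \<subseteq> P"
  shows "Q +>\<^bsub>(ring_of_type_algebra :: 'a ring)\<^esub> x \<in> (+>\<^bsub>ring_of_type_algebra\<^esub>) Q ` P \<longleftrightarrow> x \<in> P"
proof
  assume "Q +>\<^bsub>(ring_of_type_algebra :: 'a ring)\<^esub> x \<in> (+>\<^bsub>ring_of_type_algebra\<^esub>) Q ` P"
  then obtain p where p: "p \<in> P" "Q +>\<^bsub>(ring_of_type_algebra :: 'a ring)\<^esub> x = Q +>\<^bsub>ring_of_type_algebra\<^esub> p" by blast
  then have "x - p \<in> P" using a_r_coset_eq_iff_type [OF assms(1)] assms(3) by blast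
  from idealD_type(2) [OF assms(2) this p(1)] show "x \<in> P" by simp
qed blast

lemma primeideal_quot_image:
  assumes Q: "ideal Q (ring_of_type_algebra :: 'a::comm_ring_1 ring)"
    and P: "primeideal P (ring_of_type_algebra :: 'a ring)" and QP: "Q \<subseteq> P"
  shows "primeideal ((+>\<^bsub>ring_of_type_algebra\<^esub>) Q ` P) ((ring_of_type_algebra :: 'a ring) Quot Q)"
proof -
  let ?R = "ring_of_type_algebra :: 'a ring" and ?h = "(+>\<^bsub>ring_of_type_algebra\<^esub>) Q"
  let ?S = "?R Quot Q"
  interpret h: ring_hom_ring ?R ?S ?h by (rule quot_hom [OF Q])
  note Pi = primeidealD_type(1) [OF P]
  note mem = coset_mem_image_iff [OF Q Pi QP]
  have add: "?h x \<oplus>\<^bsub>?S\<^esub> ?h y = ?h (x + y)" for x y using h.hom_add [of x y] by simp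
  have mult: "?h x \<otimes>\<^bsub>?S\<^esub> ?h y = ?h (x * y)" for x y using h.hom_mult [of x y] by simp
  have crS: "cring ?S" by (rule ideal.quotient_is_cring [OF Q cring_mpoly_ring])
  have idl: "ideal (?h ` P) ?S"
  proof (rule idealI)
    show "ring ?S" by (rule ideal.quotient_is_ring [OF Q])
    show "subgroup (?h ` P) (add_monoid ?S)"
    proof (rule h.S.add.subgroupI)
      show "?h ` P \<subseteq> carrier ?S" by (auto simp: carrier_quot)
      show "?h ` P \<noteq> {}" using idealD_type(1) [OF Pi] by blast
      show "\<ominus>\<^bsub>?S\<^esub> x \<in> ?h ` P" if "x \<in> ?h ` P" for x
      proof -
        from that obtain p where p: "p \<in> P" "x = ?h p" by blast
        have "?h (- p) \<oplus>\<^bsub>?S\<^esub> ?h p = \<zero>\<^bsub>?S\<^esub>" using h.hom_zero by (simp add: add)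
        then have "\<ominus>\<^bsub>?S\<^esub> x = ?h (- p)"
          unfolding p(2) by (intro h.S.minus_equality) (auto simp: carrier_quot)
        moreover have "- p \<in> P" using idealD_type(4) [OF Pi idealD_type(1) [OF Pi] p(1)] by simp
        ultimately show ?thesis by simp
      qed
      show "x \<oplus>\<^bsub>?S\<^esub> y \<in> ?h ` P" if "x \<in> ?h ` P" "y \<in> ?h ` P" for x y
        using that idealD_type(2) [OF Pi] by (auto simp: add)
    qed
    show "x \<otimes>\<^bsub>?S\<^esub> a \<in> ?h ` P" if a: "a \<in> ?h ` P" and x: "x \<in> carrier ?S" for a x
    proof -
      from a x obtain p r where "p \<in> P" "a = ?h p" "x = ?h r" by (auto simp: carrier_quot)
      then show ?thesis using idealD_type(3) [OF Pi, of p r] by (auto simp: mult)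
    qed
    then show "a \<otimes>\<^bsub>?S\<^esub> x \<in> ?h ` P" if "a \<in> ?h ` P" "x \<in> carrier ?S" for a x
      using that cring.cring_simprules(14) [OF crS, of a x] by (auto simp: carrier_quot)
  qed
  show ?thesis
  proof (rule primeidealI [OF idl crS])
    have "?h 1 \<notin> ?h ` P" using primeidealD_type(2) [OF P] mem by simp
    then show "carrier ?S \<noteq> ?h ` P" by (auto simp: carrier_quot)
    fix a b assume a: "a \<in> carrier ?S" and b: "b \<in> carrier ?S" and ab: "a \<otimes>\<^bsub>?S\<^esub> b \<in> ?h ` P"
    from a b obtain x y where xy: "a = ?h x" "b = ?h y" by (auto simp: carrier_quot)
    from ab have "x * y \<in> P" by (simp add: xy mult mem)
    then show "a \<in> ?h ` P \<or> b \<in> ?h ` P" using primeidealD_type(3) [OF P] by (simp add: xy mem)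
  qed
qed

text \<open>The hypothesis on \<open>Z\<close> puts \<open>mi N\<close> into the prime of the
  variables outside \<open>Z\<close>. Adding the variables of \<open>Z\<close> to this prime one at
  a time gives a chain of length \<open>card Z\<close>. The growth hypothesis bounds every chain
  after pulling it back to the polynomial ring.\<close>

lemma krull_dim_quot_mi:
  fixes Z :: "'n::finite set"
  assumes N: "upset_on UNIV N" and Z: "\<And>u. u \<in> N \<Longrightarrow> \<exists>i. i \<notin> Z \<and> u i \<noteq> 0"
    and growth: "\<And>m. card {t :: 'n \<Rightarrow>\<^sub>0 nat. tdeg t \<le> m \<and> Poly_Mapping.lookup t \<notin> N} \<le> C * (m + 1) ^ card Z"
  shows "krull_dim ((mpoly_ring :: ('n, 'k::field) mpoly ring) Quot (mi N)) = enat (card Z)"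
proof -
  let ?R = "mpoly_ring :: ('n, 'k) mpoly ring"
  let ?Q = "mi N :: ('n, 'k) mpoly set"
  let ?h = "(+>\<^bsub>?R\<^esub>) ?Q"
  let ?s = "card Z"
  have Q: "ideal ?Q ?R" by (rule ideal_mi [OF N])
  obtain en where en: "bij_betw en {0..<?s} Z" using ex_bij_betw_nat_finite [of Z] by auto
  let ?U = "\<lambda>i. {u. \<exists>j. j \<notin> en ` {i..<?s} \<and> u j \<noteq> 0} :: ('n \<Rightarrow> nat) set"
  have prime: "primeideal (mi (?U i)) ?R" for i by (rule primeideal_coordinate)
  have sub: "?Q \<subseteq> mi (?U i)" for i
  proof -
    have "en ` {i..<?s} \<subseteq> Z" using en by (auto simp: bij_betw_def)
    then have "N \<subseteq> ?U i" using Z by blast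
    then show ?thesis by (rule mi_mono)
  qed
  have "prime_chain (?R Quot ?Q) ?s (\<lambda>i. ?h ` mi (?U i))"
    unfolding prime_chain_def
  proof (intro conjI allI impI)
    show "primeideal (?h ` mi (?U i)) (?R Quot ?Q)" for i by (rule primeideal_quot_image [OF Q prime sub])
    fix i assume i: "i < ?s"
    have "en ` {Suc i..<?s} \<subseteq> en ` {i..<?s}" by (rule image_mono) auto
    then have "?U i \<subseteq> ?U (Suc i)" by blast
    then have "mi (?U i) \<subseteq> (mi (?U (Suc i)) :: ('n, 'k) mpoly set)" by (rule mi_mono)
    then have "?h ` mi (?U i) \<subseteq> ?h ` mi (?U (Suc i))" by (rule image_mono)
    moreover have "?h ` mi (?U i) \<noteq> ?h ` mi (?U (Suc i))"
    proof
      assume eq: "?h ` mi (?U i) = ?h ` mi (?U (Suc i))"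
      let ?u = "\<lambda>j. if j = en i then 1 else 0 :: nat"
      let ?x = "Poly_Mapping.single (expo ?u) 1 :: ('n, 'k) mpoly"
      have "en i \<notin> en ` {Suc i..<?s}"
      proof
        assume "en i \<in> en ` {Suc i..<?s}"
        then obtain x where x: "x \<in> {Suc i..<?s}" "en i = en x" by blast
        have "i = x" by (rule inj_onD [OF bij_betw_imp_inj_on [OF en] x(2)]) (use x i in auto)
        then show False using x by simp
      qed
      then have "?x \<in> mi (?U (Suc i))" by (intro mi_single) auto
      then have "?h ?x \<in> ?h ` mi (?U i)" unfolding eq by (rule imageI)
      then have "?x \<in> mi (?U i)" using coset_mem_image_iff [OF Q primeidealD_type(1) [OF prime] sub] by blast
      then have "?u \<in> ?U i" by (simp add: mi_single_iff)
      then show False using i by (auto split: if_splits)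
    qed
    ultimately show "?h ` mi (?U i) \<subset> ?h ` mi (?U (Suc i))" by blast
  qed
  then have lower: "enat ?s \<le> krull_dim (?R Quot ?Q)" unfolding krull_dim_def by (intro Sup_upper) blast
  have upper: "k \<le> ?s" if chain: "prime_chain (?R Quot ?Q) k C" for k C
  proof -
    interpret h: ring_hom_ring ?R "?R Quot ?Q" ?h by (rule quot_hom [OF Q])
    let ?P = "\<lambda>i. {r. ?h r \<in> C i}"
    have Cp: "primeideal (C i) (?R Quot ?Q)" if "i \<le> k" for i using chain that by (simp add: prime_chain_def)
    show ?thesis
    proof (rule prime_chain_mi_upper [of k ?P N, OF _ _ _ growth])
      show "primeideal (?P i) ?R" if "i \<le> k" for i
        using h.primeideal_vimage [OF cring_mpoly_ring Cp [OF that]] by simp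
      show "?P i \<subset> ?P (Suc i)" if "i < k" for i
      proof -
        have ss: "C i \<subset> C (Suc i)" using chain that by (simp add: prime_chain_def)
        then obtain x where x: "x \<in> C (Suc i)" "x \<notin> C i" by blast
        have "C (Suc i) \<subseteq> carrier (?R Quot ?Q)"
          using additive_subgroup.a_subset [OF ideal.axioms(1) [OF primeideal.axioms(1) [OF Cp [of "Suc i"]]]] that by simp
        then obtain r where "x = ?h r" using x(1) by (auto simp: carrier_quot)
        then show ?thesis using ss x by blast
      qed
      show "mi N \<subseteq> ?P 0"
      proof
        fix r :: "('n, 'k) mpoly" assume "r \<in> mi N"
        then have "?h r = ?h 0" by (simp add: a_r_coset_eq_iff_type [OF Q])
        also have "?h 0 = \<zero>\<^bsub>?R Quot ?Q\<^esub>" using h.hom_zero by simp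
        also have "\<dots> \<in> C 0"
          using additive_subgroup.zero_closed [OF ideal.axioms(1) [OF primeideal.axioms(1) [OF Cp [of 0]]]] by simp
        finally show "r \<in> ?P 0" by simp
      qed
    qed
  qed
  have "krull_dim (?R Quot ?Q) \<le> enat ?s"
    unfolding krull_dim_def by (rule Sup_least) (use upper in auto)
  then show ?thesis using lower by (rule antisym)
qed

text \<open>The monomials of degree \<open>m\<close> with exponents in \<open>S - A\<close> give a
  basis: they are independent modulo \<open>mi A\<close>, and the other terms of a homogeneous
  element of \<open>mi S\<close> vanish in the quotient.\<close>

lemma dim_subquotient:
  fixes S A :: "('n::finite \<Rightarrow> nat) set"
  assumes S: "upset_on UNIV S" and A: "upset_on UNIV A" and A0: "(\<lambda>_. 0) \<notin> A"
  shows "ring.dim ((mpoly_ring :: ('n, 'k::field) mpoly ring) Quot (mi A)) (const_image (mi A)) (subquotient_part (mi S) (mi A) m)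
    = card {u \<in> S - A. sum u UNIV = m}"
proof -
  let ?R = "mpoly_ring :: ('n, 'k) mpoly ring"
  let ?Q = "mi A :: ('n, 'k) mpoly set"
  let ?h = "(+>\<^bsub>?R\<^esub>) ?Q"
  have Q: "ideal ?Q ?R" by (rule ideal_mi [OF A])
  interpret h: ring_hom_ring ?R "?R Quot ?Q" ?h by (rule quot_hom [OF Q])
  let ?K = "range (Poly_Mapping.single 0) :: ('n, 'k) mpoly set"
  define M where "M = expo ` {u \<in> S - A. sum u UNIV = m}"
  have mM: "t \<in> M \<longleftrightarrow> Poly_Mapping.lookup t \<in> S \<and> Poly_Mapping.lookup t \<notin> A \<and> (\<Sum>i\<in>UNIV. Poly_Mapping.lookup t i) = m" for t
  proof
    assume "Poly_Mapping.lookup t \<in> S \<and> Poly_Mapping.lookup t \<notin> A \<and> (\<Sum>i\<in>UNIV. Poly_Mapping.lookup t i) = m"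
    then show "t \<in> M" unfolding M_def by (intro image_eqI [of _ _ "Poly_Mapping.lookup t"]) auto
  qed (auto simp: M_def)
  have cM: "card M = card {u \<in> S - A. sum u UNIV = m}"
    unfolding M_def by (rule card_image) (auto simp: inj_on_def)
  have "M \<subseteq> {t. tdeg t \<le> m}" by (auto simp: mM tdeg_def)
  then have finM: "finite M" using finite_tdeg_le by (rule finite_subset)
  let ?E = "{p :: ('n, 'k) mpoly. Poly_Mapping.keys p \<subseteq> M}"
  have "Poly_Mapping.lookup (0 :: 'n \<Rightarrow>\<^sub>0 nat) = (\<lambda>_. 0)" by (rule ext) simp
  then have "(1 :: ('n, 'k) mpoly) \<notin> ?Q" using A0 by (simp add: mi_def)
  then have "?h 1 \<noteq> ?h 0" by (simp add: a_r_coset_eq_iff_type [OF Q])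
  then have one_zero: "\<one>\<^bsub>?R Quot ?Q\<^esub> \<noteq> \<zero>\<^bsub>?R Quot ?Q\<^esub>" using h.hom_one h.hom_zero by simp
  have inj: "inj_on ?h ?E"
  proof (rule inj_onI)
    fix p q assume p: "p \<in> ?E" and q: "q \<in> ?E" and eq: "?h p = ?h q"
    then have "p - q \<in> ?Q" by (simp add: a_r_coset_eq_iff_type [OF Q])
    moreover have "Poly_Mapping.keys (p - q) \<subseteq> M"
    proof
      fix t assume "t \<in> Poly_Mapping.keys (p - q)"
      then have "Poly_Mapping.lookup p t \<noteq> 0 \<or> Poly_Mapping.lookup q t \<noteq> 0"
        by (auto simp: in_keys_iff lookup_minus)
      then show "t \<in> M" using p q by (auto simp: in_keys_iff)
    qed
    ultimately have "t \<notin> Poly_Mapping.keys (p - q)" for t using mM [of t] unfolding mi_def by blast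
    then have "Poly_Mapping.keys (p - q) = {}" by blast
    then show "p = q" by simp
  qed
  have img: "?h ` ?E = subquotient_part (mi S) ?Q m"
    unfolding subquotient_part_def
  proof
    show "?h ` ?E \<subseteq> ?h ` (mi S \<inter> homogeneous_part m)"
      by (rule image_mono) (auto simp: mi_def homogeneous_part_def mM subset_iff)
    show "?h ` (mi S \<inter> homogeneous_part m) \<subseteq> ?h ` ?E"
    proof (rule image_subsetI)
      fix p :: "('n, 'k) mpoly" assume p: "p \<in> mi S \<inter> homogeneous_part m"
      let ?q = "\<Sum>t\<in>M. Poly_Mapping.single t (Poly_Mapping.lookup p t)"
      have lq: "Poly_Mapping.lookup ?q t = (if t \<in> M then Poly_Mapping.lookup p t else 0)" for t
        using finM by (simp add: lookup_sum lookup_single when_def)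
      have "p - ?q \<in> ?Q"
        unfolding mi_def
      proof (intro CollectI ballI)
        fix t assume "t \<in> Poly_Mapping.keys (p - ?q)"
        then have "t \<in> Poly_Mapping.keys p" "t \<notin> M" by (auto simp: in_keys_iff lookup_minus lq split: if_splits)
        then show "Poly_Mapping.lookup t \<in> A" using p by (auto simp: mi_def homogeneous_part_def mM)
      qed
      then have "?h p = ?h ?q" by (simp only: a_r_coset_eq_iff_type [OF Q])
      moreover have "?q \<in> ?E" by (auto simp: in_keys_iff lq split: if_splits)
      ultimately show "?h p \<in> ?h ` ?E" by blast
    qed
  qed
  have "ring.dimension (?R Quot ?Q) (card M) (?h ` ?K) (?h ` ?E)"
    by (rule h.inj_hom_dimension [OF subfield_constants one_zero inj dimension_monomials [OF finM]])
  moreover have "?h ` ?K = const_image ?Q" by (auto simp: const_image_def)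
  moreover have "subfield (?h ` ?K) (?R Quot ?Q)" by (rule h.img_is_subfield(2) [OF subfield_constants one_zero])
  ultimately have "ring.dim (?R Quot ?Q) (const_image ?Q) (subquotient_part (mi S) ?Q m) = card M"
    using h.S.dimI unfolding img over_def by metis
  then show ?thesis by (simp add: cM)
qed

text \<open>In the Stanley decomposition of \<open>S - A\<close>, pieces with fewer than
  \<open>s\<close> free coordinates carry a factor 1 - X in the numerator. Its value at 1 counts the
  pieces of top dimension, once the Krull dimension is known to be \<open>s\<close>.\<close>

lemma multiplicity_mi:
  fixes S A :: "('n::finite \<Rightarrow> nat) set"
  assumes S: "upset_on UNIV S" and A: "upset_on UNIV A"
    and bx: "boxed UNIV UNIV (S - A) B" and ne: "boxed.corner (S - A) B \<noteq> {}"
  defines "s \<equiv> Max ((\<lambda>w. card (boxed.free UNIV B w)) ` boxed.corner (S - A) B)"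
  shows "multiplicity_e0 (mi S) (mi A :: ('n, 'k::field) mpoly set)
    = int (card {w \<in> boxed.corner (S - A) B. card (boxed.free UNIV B w) = s})"
proof -
  interpret boxed UNIV UNIV "S - A" B by (rule bx)
  let ?R = "mpoly_ring :: ('n, 'k) mpoly ring"
  have s: "s = Max ((\<lambda>w. card (free w)) ` corner)" by (simp add: s_def)
  have le_s: "card (free w) \<le> s" if "w \<in> corner" for w
    unfolding s using that finite_corner by simp
  have "s \<in> (\<lambda>w. card (free w)) ` corner" unfolding s using ne finite_corner by (intro Max_in) auto
  then obtain w0 where w0: "w0 \<in> corner" "card (free w0) = s" by auto
  have w0SA: "w0 \<in> S" "w0 \<notin> A" using w0(1) by (auto simp: corner_def)
  have A0: "(\<lambda>_. 0) \<notin> A"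
  proof
    assume "(\<lambda>_. 0) \<in> A"
    then have "w0 \<in> A" by (rule upset_onD [OF A]) simp
    then show False using w0SA by simp
  qed
  have nsub: "\<not> mi S \<subseteq> (mi A :: ('n, 'k) mpoly set)"
  proof
    assume "mi S \<subseteq> (mi A :: ('n, 'k) mpoly set)"
    then have "(Poly_Mapping.single (expo w0) 1 :: ('n, 'k) mpoly) \<in> mi A" using mi_single [OF w0SA(1)] by blast
    then show False using w0SA by (simp add: mi_single_iff)
  qed
  have H: "hilbert_series (mi S) (mi A :: ('n, 'k) mpoly set) = Abs_fps (\<lambda>m. int (card (level m)))"
    unfolding hilbert_series_def dim_subquotient [OF S A A0] level_def ..
  \<comment> \<open>The exponents of the annihilator of the quotient module.\<close>
  define N where "N = {u. \<forall>v\<in>S. (\<lambda>i. u i + v i) \<in> A}"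
  have N: "upset_on UNIV N"
    unfolding upset_on_def
  proof (intro ballI allI impI)
    fix u v :: "'n \<Rightarrow> nat" assume u: "u \<in> N" and le: "\<forall>k\<in>UNIV. u k \<le> v k"
    show "v \<in> N" unfolding N_def
    proof (intro CollectI ballI)
      fix x assume "x \<in> S"
      then have "(\<lambda>i. u i + x i) \<in> A" using u by (simp add: N_def)
      then show "(\<lambda>i. v i + x i) \<in> A" by (rule upset_onD [OF A]) (use le in simp)
    qed
  qed
  obtain F where F: "F \<subseteq> S" "finite F" "\<And>u. u \<in> S \<Longrightarrow> \<exists>v\<in>F. \<forall>k\<in>UNIV. v k \<le> u k"
    by (rule dickson [of UNIV S]) (auto intro: that)
  \<comment> \<open>A monomial outside the annihilator is carried into some piece of the
    decomposition by one of the finitely many generators \<open>F\<close>; given these two, at most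
    \<open>s\<close> coordinates remain to be chosen.\<close>
  have growth: "card {t :: 'n \<Rightarrow>\<^sub>0 nat. tdeg t \<le> m \<and> Poly_Mapping.lookup t \<notin> N} \<le> (card F * card corner) * (m + 1) ^ card (free w0)" for m
  proof -
    define T where "T v w = {t :: 'n \<Rightarrow>\<^sub>0 nat. tdeg t \<le> m \<and> (\<forall>k. k \<notin> free w \<longrightarrow> Poly_Mapping.lookup t k + v k = w k)}" for v w
    have cT: "card (T v w) \<le> (m + 1) ^ s" if "w \<in> corner" for v w
    proof -
      let ?P = "PiE (free w) (\<lambda>_. {..m})"
      have "inj_on (\<lambda>t. restrict (Poly_Mapping.lookup t) (free w)) (T v w)"
      proof (rule inj_onI, rule poly_mapping_eqI)
        fix x y k assume x: "x \<in> T v w" and y: "y \<in> T v w"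
          and eq: "restrict (Poly_Mapping.lookup x) (free w) = restrict (Poly_Mapping.lookup y) (free w)"
        show "Poly_Mapping.lookup x k = Poly_Mapping.lookup y k"
        proof (cases "k \<in> free w")
          case True
          then show ?thesis using fun_cong [OF eq, of k] by simp
        next
          case False
          then have "Poly_Mapping.lookup x k + v k = Poly_Mapping.lookup y k + v k" using x y by (simp add: T_def)
          then show ?thesis by simp
        qed
      qed
      moreover have "(\<lambda>t. restrict (Poly_Mapping.lookup t) (free w)) ` T v w \<subseteq> ?P"
      proof (rule image_subsetI)
        fix t assume t: "t \<in> T v w"
        have "Poly_Mapping.lookup t k \<le> tdeg t" for k unfolding tdeg_def by (rule member_le_sum) auto
        then show "restrict (Poly_Mapping.lookup t) (free w) \<in> ?P" using t by (auto simp: T_def intro: order_trans)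
      qed
      moreover have "finite ?P" by (intro finite_PiE) (auto simp: finite_free)
      ultimately have "card (T v w) \<le> card ?P" by (rule card_inj_on_le)
      also have "\<dots> = (m + 1) ^ card (free w)" by (simp add: card_PiE finite_free)
      also have "\<dots> \<le> (m + 1) ^ s" by (rule power_increasing) (use le_s that in auto)
      finally show ?thesis .
    qed
    have finT: "finite (T v w)" for v w by (rule finite_subset [OF _ finite_tdeg_le [of m]]) (auto simp: T_def)
    have "{t :: 'n \<Rightarrow>\<^sub>0 nat. tdeg t \<le> m \<and> Poly_Mapping.lookup t \<notin> N} \<subseteq> (\<Union>(v, w)\<in>F \<times> corner. T v w)"
    proof
      fix t :: "'n \<Rightarrow>\<^sub>0 nat" assume t: "t \<in> {t. tdeg t \<le> m \<and> Poly_Mapping.lookup t \<notin> N}"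
      let ?u = "Poly_Mapping.lookup t"
      from t obtain x where x: "x \<in> S" "(\<lambda>i. ?u i + x i) \<notin> A" by (auto simp: N_def)
      from F(3) [OF x(1)] obtain v where v: "v \<in> F" "\<forall>k. v k \<le> x k" by auto
      have "(\<lambda>i. ?u i + v i) \<notin> A"
      proof
        assume "(\<lambda>i. ?u i + v i) \<in> A"
        then have "(\<lambda>i. ?u i + x i) \<in> A" by (rule upset_onD [OF A]) (use v(2) in simp)
        then show False using x(2) by simp
      qed
      moreover have "v \<in> S" using v(1) F(1) by blast
      then have "(\<lambda>i. ?u i + v i) \<in> S" by (rule upset_UNIV_add [OF S])
      ultimately have uv: "(\<lambda>i. ?u i + v i) \<in> S - A" by simp
      let ?w = "\<lambda>k. min (?u k + v k) B"
      have w: "?w \<in> corner" using truncate_corner(1) [OF uv] .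
      have "?u k + v k = ?w k" if "k \<notin> free ?w" for k
        using truncate_corner(2,3) [OF uv, of k] that by simp
      then have "t \<in> T v ?w" using t by (simp add: T_def)
      then show "t \<in> (\<Union>(v, w)\<in>F \<times> corner. T v w)" using v(1) w by blast
    qed
    then have "card {t :: 'n \<Rightarrow>\<^sub>0 nat. tdeg t \<le> m \<and> Poly_Mapping.lookup t \<notin> N} \<le> card (\<Union>(v, w)\<in>F \<times> corner. T v w)"
      by (intro card_mono) (use finT F(2) finite_corner in auto)
    also have "\<dots> \<le> (\<Sum>p\<in>F \<times> corner. card (case p of (v, w) \<Rightarrow> T v w))"
      by (rule card_UN_le) (use F(2) finite_corner in simp)
    also have "\<dots> \<le> (\<Sum>p\<in>F \<times> corner. (m + 1) ^ s)"
      by (rule sum_mono) (use cT in auto)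
    also have "\<dots> = (card F * card corner) * (m + 1) ^ card (free w0)" by (simp add: card_cartesian_product w0(2))
    finally show ?thesis .
  qed
  \<comment> \<open>Moving along the free coordinates of \<open>w0\<close> never leaves
    \<open>S - A\<close>, so the annihilator contains no monomial in these variables alone.\<close>
  have "\<exists>i. i \<notin> free w0 \<and> u i \<noteq> 0" if u: "u \<in> N" for u
  proof (rule ccontr)
    assume "\<not> (\<exists>i. i \<notin> free w0 \<and> u i \<noteq> 0)"
    then have "(\<lambda>k. w0 k + u k) \<in> S - A" by (intro add_free_in(1) [OF w0(1)]) auto
    moreover have "(\<lambda>k. u k + w0 k) \<in> A" using u w0SA(1) by (simp add: N_def)
    ultimately show False by (simp add: add.commute)
  qed
  then have "krull_dim (?R Quot (mi N)) = enat (card (free w0))"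
    by (rule krull_dim_quot_mi [OF N _ growth])
  then have md: "module_dim (mi S) (mi A :: ('n, 'k) mpoly set) = s"
    unfolding module_dim_def colon_mi [OF A] N_def [symmetric] by (simp add: w0(2))
  let ?p = "\<Sum>w\<in>corner. monom 1 (sum w UNIV) * [:1, -1:] ^ (s - card (free w)) :: int poly"
  have eq: "hilbert_series (mi S) (mi A :: ('n, 'k) mpoly set) * (1 - fps_X) ^ module_dim (mi S) (mi A :: ('n, 'k) mpoly set) = fps_of_poly ?p"
    unfolding H md by (rule level_fps) (use le_s in auto)
  have "h_polynomial (mi S) (mi A :: ('n, 'k) mpoly set) = ?p"
    unfolding h_polynomial_def eq by (rule the_equality) (auto simp: fps_of_poly_eq_iff)
  moreover have "poly ?p 1 = int (card {w \<in> corner. card (free w) = s})"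
  proof -
    have "poly ?p 1 = (\<Sum>w\<in>corner. if card (free w) = s then 1 else 0)"
      unfolding poly_sum
    proof (rule sum.cong [OF refl])
      fix w assume "w \<in> corner"
      then show "poly (monom 1 (sum w UNIV) * [:1, -1:] ^ (s - card (free w))) 1 = (if card (free w) = s then 1 else 0 :: int)"
        using le_s [of w] by (auto simp: poly_monom power_0_left)
    qed
    then show ?thesis using finite_corner by (simp add: sum.If_cases Int_def)
  qed
  ultimately show ?thesis using nsub by (simp add: multiplicity_e0_def)
qed

section \<open>The multiplicity as a sum of local lengths\<close>

lemma pw_cong: "(\<And>i. i \<notin> Z \<Longrightarrow> u i = v i) \<Longrightarrow> u \<in> pw G Z n \<longleftrightarrow> v \<in> pw G Z n"
  unfolding pw_def by auto

text \<open>\<open>Z\<close> stands for the prime ideal of the variables outside it; the condition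
  says that this prime contains the monomial ideal generated by \<open>H\<close>.\<close>

definition admissible :: "('n \<Rightarrow> nat) set \<Rightarrow> 'n set set" where
  "admissible H = {Z. \<forall>h\<in>H. \<not> supp h \<subseteq> Z}"

text \<open>Nonzero torsion means that the prime of \<open>Z\<close> is associated to the n-th
  power. The quotient by this prime has dimension \<open>card Z\<close>, so sets of maximal
  cardinality belong to the primes of top dimension.\<close>

definition relevant :: "('n::finite \<Rightarrow> nat) set \<Rightarrow> ('n \<Rightarrow> nat) set \<Rightarrow> nat \<Rightarrow> 'n set set" where
  "relevant G H n = {Z \<in> admissible H. loc_tor G Z n \<noteq> {}}"

text \<open>The minimal primes of maximal dimension in the support of \<open>I_n(J)/I^n\<close> are generated by
  variables; localising at such a prime inverts the remaining variables \<open>Z\<close> and leaves the finite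
  length module counted by \<open>loc_tor\<close>.\<close>

theorem f_sym_eq_sum_loc_tor:
  fixes G H :: "('n::finite \<Rightarrow> nat) set"
  assumes G: "finite G" and H: "finite H"
  shows "f_sym (mi {u. \<exists>g\<in>G. \<forall>i. g i \<le> u i} :: ('n, 'k::field) mpoly set) (mi {u. \<exists>h\<in>H. \<forall>i. h i \<le> u i}) n
    = int (\<Sum>Z | Z \<in> relevant G H n \<and> card Z = Max (card ` relevant G H n). card (loc_tor G Z n))"
proof -
  define B where "B = gen_bound G * n"
  let ?S = "sat_by G H n" and ?A = "pw G {} n"
  let ?V = "?S - ?A"
  have f: "f_sym (mi {u. \<exists>g\<in>G. \<forall>i. g i \<le> u i} :: ('n, 'k) mpoly set) (mi {u. \<exists>h\<in>H. \<forall>i. h i \<le> u i}) n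
      = multiplicity_e0 (mi ?S) (mi ?A :: ('n, 'k) mpoly set)"
    by (simp add: f_sym_def symbolic_power_mi [OF G H] ideal_power_mi [OF G])
  have pw_min: "(\<lambda>k. min (u k) B) \<in> pw G Z n \<longleftrightarrow> u \<in> pw G Z n" for u Z
  proof
    assume "(\<lambda>k. min (u k) B) \<in> pw G Z n"
    then show "u \<in> pw G Z n" by (rule pw_upset) simp
  next
    assume "u \<in> pw G Z n"
    then have "u \<in> pw G (Z \<union> {k. B \<le> u k}) n" by (rule pw_mono) simp
    then have "(\<lambda>k. min (u k) B) \<in> pw G (Z \<union> {k. B \<le> u k}) n" by (rule pw_upset) auto
    then show "(\<lambda>k. min (u k) B) \<in> pw G Z n" by (rule pw_absorb [OF G]) (auto simp: B_def)
  qed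
  have bx: "boxed UNIV UNIV ?V B"
    by unfold_locales (auto simp: pw_min sat_by_def)
  interpret boxed UNIV UNIV ?V B by (rule bx)
  have sat_in: "w \<in> ?S \<longleftrightarrow> (\<forall>h\<in>H. w \<in> pw G (supp h) n)" for w by (simp add: sat_by_def)
  have mem_corner: "w \<in> corner \<longleftrightarrow> (\<forall>h\<in>H. w \<in> pw G (supp h) n) \<and> w \<notin> pw G {} n \<and> (\<forall>k. w k \<le> B)" for w
    unfolding corner_def by (auto simp: sat_in)
  have free_def': "free w = {k. w k = B}" for w by (simp add: free_def)
  have absorb: "w \<in> pw G (Y \<union> free w) n \<longleftrightarrow> w \<in> pw G Y n" for w Y
  proof
    assume "w \<in> pw G (Y \<union> free w) n"
    then show "w \<in> pw G Y n" by (rule pw_absorb [OF G]) (simp add: free_def' B_def [symmetric])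
  qed (rule pw_mono, auto)
  \<comment> \<open>The value \<open>B\<close> stands for arbitrarily large. Giving it to the
    inverted variables turns a torsion point into a corner with free set \<open>Z\<close>.\<close>
  define fill where "fill Z u = (\<lambda>i. if i \<in> Z then B else u i)" for Z and u :: "'n \<Rightarrow> nat"
  have fill_pw: "fill Z u \<in> pw G Y n \<longleftrightarrow> u \<in> pw G Y n" if "Z \<subseteq> Y" for Z u Y
    by (rule pw_cong) (use that in \<open>auto simp: fill_def\<close>)
  have fill_corner: "fill Z u \<in> corner \<and> free (fill Z u) = Z"
    if Z: "Z \<in> admissible H" and u: "u \<in> loc_tor G Z n" for Z u
  proof -
    have lt: "u i < B" if "i \<notin> Z" for i using loc_tor_bound [OF G u that] by (simp add: B_def)
    have "k \<in> free (fill Z u) \<longleftrightarrow> k \<in> Z" for k using lt [of k] by (auto simp: free_def' fill_def)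
    then have fr: "free (fill Z u) = Z" by blast
    have "fill Z u \<notin> pw G {} n"
    proof
      assume "fill Z u \<in> pw G {} n"
      then have "fill Z u \<in> pw G Z n" by (rule pw_mono) simp
      then show False using u by (simp add: fill_pw loc_tor_def)
    qed
    moreover have "fill Z u \<in> pw G (supp h) n" if h: "h \<in> H" for h
    proof -
      from Z h obtain i where i: "i \<in> supp h" "i \<notin> Z" by (auto simp: admissible_def)
      then have "u \<in> pw G (insert i Z) n" using u by (simp add: loc_tor_def sat_def)
      then have "fill Z u \<in> pw G (insert i Z) n" by (subst fill_pw) auto
      then have "fill Z u \<in> pw G (supp h \<union> free (fill Z u)) n" unfolding fr by (rule pw_mono) (use i in auto)
      then show ?thesis by (simp only: absorb)
    qed
    moreover have "fill Z u k \<le> B" for k using lt [of k] by (auto simp: fill_def)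
    ultimately show ?thesis using fr by (simp add: mem_corner)
  qed
  have corner_admissible: "free w \<in> admissible H" if w: "w \<in> corner" for w
    unfolding admissible_def
  proof (intro CollectI ballI notI)
    fix h assume h: "h \<in> H" and sub: "supp h \<subseteq> free w"
    have "w \<in> pw G (supp h) n" using w h by (simp add: mem_corner)
    then have "w \<in> pw G ({} \<union> free w) n" by (rule pw_mono) (use sub in simp)
    then have "w \<in> pw G {} n" by (simp only: absorb)
    then show False using w by (simp add: mem_corner)
  qed
  have zero_loc_tor: "(\<lambda>i. if i \<in> free w then 0 else w i) \<in> loc_tor G (free w) n"
    if w: "w \<in> corner" and max: "\<And>v. v \<in> corner \<Longrightarrow> card (free v) \<le> card (free w)" for w
  proof -
    let ?Z = "free w" and ?u = "\<lambda>i. if i \<in> free w then 0 else w i"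
    have eqv: "?u \<in> pw G Y n \<longleftrightarrow> w \<in> pw G Y n" if "?Z \<subseteq> Y" for Y
      by (rule pw_cong) (use that in auto)
    have "w \<notin> pw G {} n" using w by (simp add: mem_corner)
    then have "w \<notin> pw G ({} \<union> ?Z) n" by (subst absorb)
    then have "?u \<notin> pw G ?Z n" by (simp add: eqv)
    \<comment> \<open>If inverting \<open>i\<close> did not help, raising the coordinate
      \<open>i\<close> to \<open>B\<close> would give a corner with a larger free set, against
      \<open>max\<close>.\<close>
    moreover have "?u \<in> pw G (insert i ?Z) n" if i: "i \<notin> ?Z" for i
    proof (rule ccontr)
      assume "?u \<notin> pw G (insert i ?Z) n"
      then have nw: "w \<notin> pw G (insert i ?Z) n" by (subst (asm) eqv) auto
      let ?v = "w(i := B)"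
      have le: "w k \<le> ?v k" for k using w by (auto simp: mem_corner)
      have "w \<in> ?S" using w by (simp add: mem_corner sat_in)
      then have "?v \<in> ?S" by (rule upset_onD [OF upset_sat_by]) (rule le)
      moreover have "?v \<notin> ?A"
      proof
        assume "?v \<in> ?A"
        then have "?v \<in> pw G (insert i ?Z) n" by (rule pw_mono) simp
        then have "w \<in> pw G (insert i ?Z) n" by (rule pw_upset) auto
        then show False using nw by contradiction
      qed
      ultimately have "?v \<in> corner" using w by (auto simp: mem_corner sat_in)
      then have "card (free ?v) \<le> card ?Z" by (rule max)
      moreover have "free ?v = insert i ?Z" by (auto simp: free_def')
      ultimately show False using i by simp
    qed
    ultimately show ?thesis by (simp add: loc_tor_def sat_def)
  qed
  show ?thesis
  proof (cases "corner = {}")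
    case True
    have "?S \<subseteq> ?A"
    proof
      fix u assume "u \<in> ?S"
      then show "u \<in> ?A" using truncate_corner(1) [of u] True by blast
    qed
    then have "mi ?S \<subseteq> (mi ?A :: ('n, 'k) mpoly set)" by (auto simp: mi_def)
    \<comment> \<open>The index set of the sum is empty, whatever value \<open>Max\<close> has on
      the empty set.\<close>
    moreover have "relevant G H n = {}" using fill_corner True by (auto simp: relevant_def)
    ultimately show ?thesis unfolding f by (simp add: multiplicity_e0_def)
  next
    case False
    define s where "s = Max ((\<lambda>w. card (free w)) ` corner)"
    have le_s: "card (free w) \<le> s" if "w \<in> corner" for w
      unfolding s_def using that finite_corner by simp
    have "s \<in> (\<lambda>w. card (free w)) ` corner" unfolding s_def using False finite_corner by (intro Max_in) auto
    then obtain w0 where w0: "w0 \<in> corner" "card (free w0) = s" by auto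
    have rel_s: "card Z \<le> s" if "Z \<in> relevant G H n" for Z
    proof -
      from that obtain u where "u \<in> loc_tor G Z n" "Z \<in> admissible H" by (auto simp: relevant_def)
      then show ?thesis using fill_corner [of Z u] le_s by force
    qed
    have "free w0 \<in> relevant G H n"
      using corner_admissible [OF w0(1)] zero_loc_tor [OF w0(1)] le_s w0(2) by (auto simp: relevant_def)
    then have s_rel: "Max (card ` relevant G H n) = s"
      using rel_s w0(2) by (intro Max_eqI) auto
    have "multiplicity_e0 (mi ?S) (mi ?A :: ('n, 'k) mpoly set) = int (card {w \<in> corner. card (free w) = s})"
      unfolding s_def by (rule multiplicity_mi [OF upset_sat_by upset_pw bx False])
    also have "card {w \<in> corner. card (free w) = s}
        = card (SIGMA Z:{Z \<in> relevant G H n. card Z = s}. loc_tor G Z n)"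
    proof (rule bij_betw_same_card, rule bij_betw_byWitness [where f' = "\<lambda>(Z, u). fill Z u"])
      \<comment> \<open>Setting the free coordinates to zero is inverse to \<open>fill\<close>; by
        maximality of \<open>s\<close> it leads into the torsion.\<close>
      let ?f = "\<lambda>w. (free w, \<lambda>i. if i \<in> free w then 0 else w i)"
      show "\<forall>w\<in>{w \<in> corner. card (free w) = s}. (case ?f w of (Z, u) \<Rightarrow> fill Z u) = w"
        by (auto simp: fill_def free_def' fun_eq_iff)
      show "\<forall>p\<in>SIGMA Z:{Z \<in> relevant G H n. card Z = s}. loc_tor G Z n. ?f (case p of (Z, u) \<Rightarrow> fill Z u) = p"
      proof
        fix p assume "p \<in> (SIGMA Z:{Z \<in> relevant G H n. card Z = s}. loc_tor G Z n)"
        then obtain Z u where p: "p = (Z, u)" "Z \<in> admissible H" "u \<in> loc_tor G Z n" by (auto simp: relevant_def)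
        have "(\<lambda>i. if i \<in> Z then 0 else fill Z u i) = u" using p(3) by (auto simp: fill_def loc_tor_def)
        then have "?f (fill Z u) = (Z, u)" using fill_corner [OF p(2,3)] by simp
        then show "?f (case p of (Z, u) \<Rightarrow> fill Z u) = p" unfolding p(1) by (simp only: prod.case)
      qed
      show "?f ` {w \<in> corner. card (free w) = s} \<subseteq> (SIGMA Z:{Z \<in> relevant G H n. card Z = s}. loc_tor G Z n)"
      proof (rule image_subsetI)
        fix w assume w: "w \<in> {w \<in> corner. card (free w) = s}"
        then have lt: "(\<lambda>i. if i \<in> free w then 0 else w i) \<in> loc_tor G (free w) n"
          using le_s by (intro zero_loc_tor) auto
        moreover have "free w \<in> relevant G H n" using corner_admissible [of w] w lt by (auto simp: relevant_def)
        ultimately show "?f w \<in> (SIGMA Z:{Z \<in> relevant G H n. card Z = s}. loc_tor G Z n)" using w by simp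
      qed
      show "(\<lambda>(Z, u). fill Z u) ` (SIGMA Z:{Z \<in> relevant G H n. card Z = s}. loc_tor G Z n) \<subseteq> {w \<in> corner. card (free w) = s}"
        using fill_corner by (auto simp: relevant_def)
    qed
    also have "\<dots> = (\<Sum>Z\<in>{Z \<in> relevant G H n. card Z = s}. card (loc_tor G Z n))"
      by (rule card_SigmaI) (use loc_tor_card(1) [OF G] in auto)
    finally show ?thesis unfolding f s_rel .
  qed
qed

section \<open>Second differences of quasi-polynomials\<close>

text \<open>The increments are nonincreasing and periodic, hence constant; a periodic sequence with
  constant increments has increment zero.\<close>

lemma periodic_concave_constant:
  fixes h :: "nat \<Rightarrow> real"
  assumes g: "g > 0" and per: "\<And>n. h (n + g) = h n" and conc: "\<And>n. h (n + 2) + h n - 2 * h (n + 1) \<le> 0"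
  shows "h n = h 0"
proof -
  define d where "d n = h (Suc n) - h n" for n
  have dec: "d (Suc n) \<le> d n" for n using conc [of n] by (simp add: d_def)
  then have anti: "antimono d" by (intro decseq_SucI)
  have dper: "d (n + g) = d n" for n using per [of n] per [of "Suc n"] by (simp add: d_def)
  have step: "d (Suc n) = d n" for n
  proof (rule antisym [OF dec])
    have "d (n + g) \<le> d (Suc n)" using g by (intro antimonoD [OF anti]) simp
    then show "d n \<le> d (Suc n)" by (simp add: dper)
  qed
  have d0: "d n = d 0" for n by (induction n) (simp_all add: step)
  have h: "h n = h 0 + real n * d 0" for n
  proof (induction n)
    case (Suc n)
    have "h (Suc n) = h n + d 0" using d0 [of n] by (simp add: d_def)
    then show ?case using Suc by (simp add: algebra_simps)
  qed simp
  have "h g = h 0" using per [of 0] by simp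
  then have "d 0 = 0" using h [of g] g by simp
  then show ?thesis using h [of n] by simp
qed

text \<open>Along the progression, q(x) / x^e tends to the coefficient of degree e and is at most M
  / x. Progressions appear because a quasi-polynomial is polynomial on residue classes.\<close>

lemma coeff_nonpos_of_growth:
  fixes q :: "real poly"
  assumes deg: "degree q \<le> e" and g: "g > 0"
    and le: "\<forall>\<^sub>F k in sequentially. poly q (real (n0 + k * g)) * real (n0 + k * g) \<le> M * real (n0 + k * g) ^ e"
  shows "coeff q e \<le> 0"
proof (rule ccontr)
  assume pos: "\<not> coeff q e \<le> 0"
  then have "e \<le> degree q" by (intro le_degree) auto
  then have e: "degree q = e" using deg by simp
  have lim: "filterlim (\<lambda>k. real (n0 + k * g)) at_top sequentially"
  proof (rule filterlim_compose [OF filterlim_real_sequentially])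
    show "filterlim (\<lambda>k. n0 + k * g) at_top sequentially"
      using g by (intro filterlim_subseq strict_monoI) (simp add: mult_strict_right_mono)
  qed
  have "((\<lambda>x. poly q x / x ^ degree q) \<longlongrightarrow> lead_coeff q) at_top"
    using poly_divide_tendsto_aux [of q] by (rule tendsto_mono [OF at_top_le_at_infinity])
  then have l: "(\<lambda>k. poly q (real (n0 + k * g)) / real (n0 + k * g) ^ e) \<longlonglongrightarrow> coeff q e"
    using filterlim_compose [OF _ lim] e by fastforce
  have z: "(\<lambda>k. M * inverse (real (n0 + k * g))) \<longlonglongrightarrow> M * 0"
    by (intro tendsto_mult tendsto_const filterlim_compose [OF tendsto_inverse_0_at_top lim] filterlim_ident)
  have "\<forall>\<^sub>F k in sequentially. real (n0 + k * g) \<ge> 1"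
    using lim by (simp add: filterlim_at_top)
  with le have "\<forall>\<^sub>F k in sequentially. poly q (real (n0 + k * g)) / real (n0 + k * g) ^ e \<le> M * inverse (real (n0 + k * g))"
  proof eventually_elim
    case (elim k)
    define x where "x = real (n0 + k * g)"
    have "x \<ge> 1" "poly q x * x \<le> M * x ^ e" using elim by (simp_all only: x_def)
    then have "poly q x / x ^ e \<le> M * inverse x" by (simp add: field_simps)
    then show ?case by (simp only: x_def)
  qed
  from tendsto_le [OF trivial_limit_sequentially z l this] show False using pos by simp
qed

theorem quasi_poly_second_difference:
  assumes q: "quasi_poly_type f g c a" and c: "c \<ge> 1"
    and le: "\<forall>\<^sub>F n in sequentially. (of_int (f (n + 2)) + of_int (f n) - 2 * of_int (f (n + 1))) * real n
      \<le> M * real n ^ (c - 1)"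
  shows "\<exists>r. \<forall>n. a (c - 1) n = r"
proof -
  define A where "A i n = (of_rat (a i n) :: real)" for i n
  have g: "g > 0" using q by (simp add: quasi_poly_type_def)
  have per: "A i (n + g) = A i n" if "i \<le> c" for i n using q that by (simp add: quasi_poly_type_def A_def)
  have perk: "A i (n + k * g) = A i n" if "i \<le> c" for i n k
  proof (induction k)
    case (Suc k)
    then show ?case using per [OF that, of "n + k * g"] by (simp add: ac_simps)
  qed simp
  have "\<forall>\<^sub>F n in sequentially. rat_of_int (f n) = (\<Sum>i\<le>c. a i n * of_nat n ^ i)"
    using q by (simp add: quasi_poly_type_def)
  then have fA: "\<forall>\<^sub>F n in sequentially. real_of_int (f n) = (\<Sum>i\<le>c. A i n * real n ^ i)"
  proof eventually_elim
    case (elim n)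
    have "real_of_int (f n) = of_rat (of_int (f n))" by simp
    also have "\<dots> = (\<Sum>i\<le>c. A i n * real n ^ i)"
      unfolding elim A_def by (simp add: of_rat_sum of_rat_mult of_rat_power)
    finally show ?case .
  qed
  have fA1: "\<forall>\<^sub>F n in sequentially. real_of_int (f (n + 1)) = (\<Sum>i\<le>c. A i (n + 1) * real (n + 1) ^ i)"
    by (rule eventually_compose_filterlim [OF fA filterlim_add_const_nat_at_top])
  have fA2: "\<forall>\<^sub>F n in sequentially. real_of_int (f (n + 2)) = (\<Sum>i\<le>c. A i (n + 2) * real (n + 2) ^ i)"
    by (rule eventually_compose_filterlim [OF fA filterlim_add_const_nat_at_top])
  \<comment> \<open>On the residue class of \<open>n\<close> modulo \<open>g\<close> the second
    difference is this one polynomial, because the coefficient functions are periodic.\<close>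
  define Q where "Q n = (\<Sum>i\<le>c. smult (A i (n + 2)) ([:2, 1:] ^ i) + smult (A i n) ([:0, 1:] ^ i)
    - smult (2 * A i (n + 1)) ([:1, 1:] ^ i))" for n
  have dlin: "degree ([:t, 1:] ^ i :: real poly) \<le> c" if "i \<le> c" for t i
    using that by (simp add: degree_linear_power)
  have degQ: "degree (Q n) \<le> c" for n
    unfolding Q_def
    by (intro degree_sum_le degree_diff_le degree_add_le order_trans [OF degree_smult_le] dlin) auto
  have evQ: "\<forall>\<^sub>F k in sequentially. poly (Q n) (real (n + k * g)) * real (n + k * g) \<le> M * real (n + k * g) ^ (c - 1)" for n
  proof -
    have lim: "filterlim (\<lambda>k. n + k * g) at_top sequentially"
      using g by (intro filterlim_subseq strict_monoI) (simp add: mult_strict_right_mono)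
    have "\<forall>\<^sub>F m in sequentially. ((\<Sum>i\<le>c. A i (m + 2) * real (m + 2) ^ i) + (\<Sum>i\<le>c. A i m * real m ^ i)
        - 2 * (\<Sum>i\<le>c. A i (m + 1) * real (m + 1) ^ i)) * real m \<le> M * real m ^ (c - 1)"
      using le fA fA1 fA2 by eventually_elim simp
    from eventually_compose_filterlim [OF this lim] show ?thesis
    proof eventually_elim
      case (elim k)
      let ?x = "real (n + k * g)"
      have "poly (Q n) ?x = (\<Sum>i\<le>c. A i (n + 2) * (?x + 2) ^ i + A i n * ?x ^ i - 2 * A i (n + 1) * (?x + 1) ^ i)"
        by (simp add: Q_def poly_sum add.commute)
      also have "\<dots> = (\<Sum>i\<le>c. A i (n + k * g + 2) * real (n + k * g + 2) ^ i + A i (n + k * g) * ?x ^ i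
          - 2 * A i (n + k * g + 1) * real (n + k * g + 1) ^ i)"
      proof (rule sum.cong [OF refl])
        fix i assume "i \<in> {..c}"
        then have i: "i \<le> c" by simp
        show "A i (n + 2) * (?x + 2) ^ i + A i n * ?x ^ i - 2 * A i (n + 1) * (?x + 1) ^ i
          = A i (n + k * g + 2) * real (n + k * g + 2) ^ i + A i (n + k * g) * ?x ^ i
          - 2 * A i (n + k * g + 1) * real (n + k * g + 1) ^ i"
          using perk [OF i, of n k] perk [OF i, of "n + 1" k] perk [OF i, of "n + 2" k] by (simp add: ac_simps)
      qed
      also have "\<dots> = (\<Sum>i\<le>c. A i (n + k * g + 2) * real (n + k * g + 2) ^ i) + (\<Sum>i\<le>c. A i (n + k * g) * ?x ^ i)
          - 2 * (\<Sum>i\<le>c. A i (n + k * g + 1) * real (n + k * g + 1) ^ i)"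
        by (simp add: sum.distrib sum_subtractf sum_distrib_left mult.assoc)
      finally show ?case using elim by simp
    qed
  qed
  have lin: "coeff ([:t, 1:] ^ i :: real poly) k = of_nat (i choose k) * t ^ (i - k)" for t i k
  proof (cases "k \<le> i")
    case True
    then show ?thesis by (simp add: coeff_linear_poly_power)
  next
    case False
    then show ?thesis by (simp add: coeff_eq_0 degree_linear_power binomial_eq_0)
  qed
  have coeff: "coeff (Q n) k = (\<Sum>i\<le>c. of_nat (i choose k) *
      (A i (n + 2) * 2 ^ (i - k) + A i n * 0 ^ (i - k) - 2 * A i (n + 1)))" for n k
    by (simp add: Q_def coeff_sum lin algebra_simps)
  have cc: "coeff (Q n) c = A c (n + 2) + A c n - 2 * A c (n + 1)" for n
  proof -
    have "coeff (Q n) c = (\<Sum>i\<le>c. if i = c then A c (n + 2) + A c n - 2 * A c (n + 1) else 0)"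
      unfolding coeff by (rule sum.cong) auto
    then show ?thesis by simp
  qed
  \<comment> \<open>So far only \<open>c\<close> is known as a bound for the degree of
    \<open>Q n\<close>, so the hypothesis is weakened to this exponent.\<close>
  have "coeff (Q n) c \<le> 0" for n
  proof (rule coeff_nonpos_of_growth [OF degQ g])
    show "\<forall>\<^sub>F k in sequentially. poly (Q n) (real (n + k * g)) * real (n + k * g) \<le> \<bar>M\<bar> * real (n + k * g) ^ c"
      using evQ [of n] eventually_ge_at_top [of 1]
    proof eventually_elim
      case (elim k)
      have "1 \<le> k * g" using elim(2) g by (simp add: Suc_le_eq)
      then have x: "real (n + k * g) \<ge> 1" by linarith
      have "M * real (n + k * g) ^ (c - 1) \<le> \<bar>M\<bar> * real (n + k * g) ^ (c - 1)"
        by (rule mult_right_mono) auto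
      also have "\<dots> \<le> \<bar>M\<bar> * real (n + k * g) ^ c"
        by (intro mult_left_mono power_increasing x) auto
      finally show ?case using elim(1) by linarith
    qed
  qed
  then have Ac: "A c n = A c 0" for n
    by (intro periodic_concave_constant [OF g]) (use per cc in auto)
  have cc1: "coeff (Q n) (c - 1) = A (c - 1) (n + 2) + A (c - 1) n - 2 * A (c - 1) (n + 1)" for n
  proof -
    have "coeff (Q n) (c - 1) = (\<Sum>i\<le>c. if i = c - 1 then A (c - 1) (n + 2) + A (c - 1) n - 2 * A (c - 1) (n + 1) else 0)"
      unfolding coeff
    proof (rule sum.cong [OF refl])
      fix i assume "i \<in> {..c}"
      then consider "i < c - 1" | "i = c - 1" | "i = c" by force
      then show "of_nat (i choose (c - 1)) * (A i (n + 2) * 2 ^ (i - (c - 1)) + A i n * 0 ^ (i - (c - 1)) - 2 * A i (n + 1))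
        = (if i = c - 1 then A (c - 1) (n + 2) + A (c - 1) n - 2 * A (c - 1) (n + 1) else 0)"
      proof cases
        \<comment> \<open>The contribution of a_c in degree c - 1 is c (2 a_c(n + 2) - 2 a_c(n +
          1)); it vanishes because a_c is already known to be constant.\<close>
        case 3
        have "A c (n + 2) = A c 0" "A c (n + 1) = A c 0" "A c n = A c 0" by (rule Ac)+
        then show ?thesis using 3 c by simp
      qed simp_all
    qed
    then show ?thesis by simp
  qed
  \<comment> \<open>The top coefficient is gone, so the hypothesis applies with its own
    exponent.\<close>
  have "degree (Q n) \<le> c - 1" for n
  proof -
    have "coeff (Q n) c = 0" unfolding cc Ac [of n] Ac [of "n + 1"] Ac [of "n + 2"] by simp
    then have "degree (Q n) \<noteq> c" using c by (metis degree_0 leading_coeff_0_iff not_one_le_zero)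
    then show ?thesis using degQ [of n] by simp
  qed
  from coeff_nonpos_of_growth [OF this g evQ]
  have "coeff (Q n) (c - 1) \<le> 0" for n .
  then have "A (c - 1) n = A (c - 1) 0" for n
    by (intro periodic_concave_constant [OF g]) (use per cc1 in auto)
  then have "a (c - 1) n = a (c - 1) 0" for n by (simp add: A_def)
  then show ?thesis by blast
qed

text \<open>By periodicity the coefficients take finitely many values, indexed by the residues
  modulo \<open>g\<close>.\<close>

lemma quasi_poly_growth:
  assumes q: "quasi_poly_type f g c a"
  obtains C where "\<forall>\<^sub>F n in sequentially. \<bar>real_of_int (f n)\<bar> \<le> C * real n ^ c"
proof -
  have g: "g > 0" and per: "\<And>i n. i \<le> c \<Longrightarrow> a i (n + g) = a i n"
    using q by (auto simp: quasi_poly_type_def)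
  have mod: "a i n = a i (n mod g)" if "i \<le> c" for i n
  proof -
    have "a i (m + k * g) = a i m" for m k
    proof (induction k)
      case (Suc k)
      then show ?case using per [OF that, of "m + k * g"] by (simp add: ac_simps)
    qed simp
    from this [of "n mod g" "n div g"] show ?thesis by simp
  qed
  define C where "C = (\<Sum>i\<le>c. \<Sum>j<g. \<bar>a i j\<bar>)"
  have "\<forall>\<^sub>F n in sequentially. rat_of_int (f n) = (\<Sum>i\<le>c. a i n * of_nat n ^ i)"
    using q by (simp add: quasi_poly_type_def)
  with eventually_ge_at_top [of 1]
  have "\<forall>\<^sub>F n in sequentially. \<bar>real_of_int (f n)\<bar> \<le> of_rat C * real n ^ c"
  proof eventually_elim
    case (elim n)
    have "\<bar>rat_of_int (f n)\<bar> \<le> (\<Sum>i\<le>c. \<bar>a i n * of_nat n ^ i\<bar>)" unfolding elim(2) by (rule sum_abs)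
    also have "\<dots> \<le> (\<Sum>i\<le>c. (\<Sum>j<g. \<bar>a i j\<bar>) * of_nat n ^ c)"
    proof (rule sum_mono)
      fix i assume "i \<in> {..c}"
      then have i: "i \<le> c" by simp
      have "\<bar>a i (n mod g)\<bar> \<le> (\<Sum>j<g. \<bar>a i j\<bar>)" using g by (intro member_le_sum) auto
      then have "\<bar>a i n\<bar> \<le> (\<Sum>j<g. \<bar>a i j\<bar>)" using mod [OF i, of n] by simp
      moreover have "(of_nat n :: rat) ^ i \<le> of_nat n ^ c" using i elim(1) by (intro power_increasing) auto
      ultimately have "\<bar>a i n\<bar> * of_nat n ^ i \<le> (\<Sum>j<g. \<bar>a i j\<bar>) * of_nat n ^ c"
        by (intro mult_mono) (auto intro: sum_nonneg)
      then show "\<bar>a i n * of_nat n ^ i\<bar> \<le> (\<Sum>j<g. \<bar>a i j\<bar>) * of_nat n ^ c" by (simp add: abs_mult)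
    qed
    also have "\<dots> = C * of_nat n ^ c" by (simp add: C_def sum_distrib_right)
    finally have "of_rat \<bar>rat_of_int (f n)\<bar> \<le> (of_rat (C * of_nat n ^ c) :: real)" by (simp only: of_rat_less_eq)
    moreover have "(of_rat \<bar>rat_of_int (f n)\<bar> :: real) = \<bar>real_of_int (f n)\<bar>"
      by (metis of_int_abs of_rat_of_int_eq)
    moreover have "(of_rat (C * of_nat n ^ c) :: real) = of_rat C * real n ^ c" by (simp add: of_rat_mult of_rat_power)
    ultimately show ?case by simp
  qed
  then show ?thesis by (rule that)
qed

section \<open>Second differences of the multiplicity\<close>

lemma loc_tor_UNIV: "G \<noteq> {} \<Longrightarrow> finite G \<Longrightarrow> loc_tor G UNIV n = {}"
proof -
  assume G: "G \<noteq> {}" "finite G"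
  then obtain g where g: "g \<in> G" by blast
  have "u \<in> pw G UNIV n" for u
    by (rule pwI [of "\<lambda>h. if h = g then n else 0"]) (use g G in auto)
  then show ?thesis by (auto simp: loc_tor_def)
qed

text \<open>Either the count is eventually a polynomial, with finitely many zeros unless it is zero,
  or it grows. Because of this, the set of primes that enter the sum stabilises.\<close>

lemma loc_tor_sign:
  assumes G: "finite G" "G \<noteq> {}"
  shows "(\<forall>\<^sub>F n in sequentially. loc_tor G Z n = {}) \<or> (\<forall>\<^sub>F n in sequentially. loc_tor G Z n \<noteq> {})"
  using loc_tor_dichotomy [OF G, of Z]
proof
  assume "eventually_poly (\<lambda>n. card (loc_tor G Z n))"
  from eventually_poly_sign [OF this] show ?thesis
  proof
    assume "\<forall>\<^sub>F n in sequentially. card (loc_tor G Z n) = 0"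
    then have "\<forall>\<^sub>F n in sequentially. loc_tor G Z n = {}"
      by eventually_elim (use loc_tor_card(1) [OF G(1)] in simp)
    then show ?thesis ..
  next
    assume "\<forall>\<^sub>F n in sequentially. card (loc_tor G Z n) > 0"
    then have "\<forall>\<^sub>F n in sequentially. loc_tor G Z n \<noteq> {}"
      by eventually_elim auto
    then show ?thesis ..
  qed
next
  assume "\<exists>c>0. \<forall>\<^sub>F N in sequentially. c * real N ^ card (- Z) \<le> real (card (loc_tor G Z N))"
  then obtain c where c: "c > 0" "\<forall>\<^sub>F N in sequentially. c * real N ^ card (- Z) \<le> real (card (loc_tor G Z N))" by blast
  from c(2) eventually_ge_at_top [of 1] have "\<forall>\<^sub>F n in sequentially. loc_tor G Z n \<noteq> {}"
  proof eventually_elim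
    case (elim n)
    then have "0 < c * real n ^ card (- Z)" using c(1) by simp
    then have "0 < card (loc_tor G Z n)" using elim(1) by linarith
    then show ?case by auto
  qed
  then show ?thesis ..
qed

lemma relevant_eventually_constant:
  fixes G H :: "('n::finite \<Rightarrow> nat) set"
  assumes G: "finite G" "G \<noteq> {}"
  obtains R where "\<forall>\<^sub>F n in sequentially. relevant G H n = R"
proof -
  define R where "R = {Z \<in> admissible H. \<forall>\<^sub>F n in sequentially. loc_tor G Z n \<noteq> {}}"
  have "\<forall>\<^sub>F n in sequentially. loc_tor G Z n \<noteq> {} \<longleftrightarrow> (\<forall>\<^sub>F n in sequentially. loc_tor G Z n \<noteq> {})" for Z
  proof (cases "\<forall>\<^sub>F n in sequentially. loc_tor G Z n \<noteq> {}")
    case True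
    then show ?thesis by simp
  next
    case False
    then have "\<forall>\<^sub>F n in sequentially. loc_tor G Z n = {}" using loc_tor_sign [OF G, of Z] by blast
    then show ?thesis using False by simp
  qed
  then have "\<forall>\<^sub>F n in sequentially. \<forall>Z\<in>UNIV. loc_tor G Z n \<noteq> {} \<longleftrightarrow> (\<forall>\<^sub>F n in sequentially. loc_tor G Z n \<noteq> {})"
    by (intro eventually_ball_finite) auto
  then have "\<forall>\<^sub>F n in sequentially. relevant G H n = R"
    by eventually_elim (auto simp: relevant_def R_def)
  then show ?thesis by (rule that)
qed

text \<open>In the polynomial case \<open>le\<close> bounds the degree. In the other case it forces
  card (- Z) \<le> c, and the estimate from the cone is strong enough.\<close>

lemma loc_tor_second_difference_of_growth:
  fixes G :: "('n::finite \<Rightarrow> nat) set"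
  assumes G: "finite G" "G \<noteq> {}" and Z: "Z \<noteq> UNIV" and c: "c \<ge> 1"
    and le: "\<forall>\<^sub>F n in sequentially. real (card (loc_tor G Z n)) \<le> C * real n ^ c"
  shows "\<exists>M. \<forall>\<^sub>F n in sequentially.
    (real (card (loc_tor G Z (n + 2))) + real (card (loc_tor G Z n)) - 2 * real (card (loc_tor G Z (n + 1)))) * real n
      \<le> M * real n ^ (c - 1)"
  using loc_tor_dichotomy [OF G, of Z]
proof
  assume "eventually_poly (\<lambda>n. card (loc_tor G Z n))"
  then obtain M where "\<forall>\<^sub>F n in sequentially.
    \<bar>real (card (loc_tor G Z (n + 2))) + real (card (loc_tor G Z n)) - 2 * real (card (loc_tor G Z (n + 1)))\<bar> * real n
      \<le> M * real n ^ (c - 1)"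
    by (rule eventually_poly_second_difference [OF _ le c]) (rule that)
  then have "\<forall>\<^sub>F n in sequentially.
    (real (card (loc_tor G Z (n + 2))) + real (card (loc_tor G Z n)) - 2 * real (card (loc_tor G Z (n + 1)))) * real n
      \<le> M * real n ^ (c - 1)"
    by eventually_elim (rule order_trans [OF mult_right_mono [OF abs_ge_self]], auto)
  then show ?thesis ..
next
  assume "\<exists>k>0. \<forall>\<^sub>F N in sequentially. k * real N ^ card (- Z) \<le> real (card (loc_tor G Z N))"
  then obtain k where k: "k > 0" "\<forall>\<^sub>F N in sequentially. k * real N ^ card (- Z) \<le> real (card (loc_tor G Z N))" by blast
  have "\<forall>\<^sub>F n in sequentially. \<bar>poly (monom k (card (- Z))) (real n)\<bar> \<le> C * real n ^ c"
    using k(2) le by eventually_elim (use k(1) in \<open>simp add: poly_monom abs_mult\<close>)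
  then have "degree (monom k (card (- Z))) \<le> c" by (rule degree_le_of_growth)
  then have r: "card (- Z) \<le> c" using k(1) by (simp add: degree_monom_eq)
  obtain M where "\<forall>\<^sub>F n in sequentially.
    (real (card (loc_tor G Z (n + 2))) + real (card (loc_tor G Z n)) - 2 * real (card (loc_tor G Z (n + 1)))) * real n
      \<le> M * real n ^ (card (- Z) - 1)"
    by (rule loc_tor_second_difference [OF G Z]) (rule that)
  then have "\<forall>\<^sub>F n in sequentially.
    (real (card (loc_tor G Z (n + 2))) + real (card (loc_tor G Z n)) - 2 * real (card (loc_tor G Z (n + 1)))) * real n
      \<le> \<bar>M\<bar> * real n ^ (c - 1)"
    using eventually_ge_at_top [of 1]
  proof eventually_elim
    case (elim n)
    have "M * real n ^ (card (- Z) - 1) \<le> \<bar>M\<bar> * real n ^ (card (- Z) - 1)" by (rule mult_right_mono) auto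
    also have "\<dots> \<le> \<bar>M\<bar> * real n ^ (c - 1)"
      by (intro mult_left_mono power_increasing) (use r elim(2) in auto)
    finally show ?case using elim(1) by linarith
  qed
  then show ?thesis ..
qed

lemma sum_second_difference:
  fixes e :: "'a \<Rightarrow> nat \<Rightarrow> real"
  assumes "finite R" "\<And>Z. Z \<in> R \<Longrightarrow> \<exists>M. \<forall>\<^sub>F n in sequentially. (e Z (n + 2) + e Z n - 2 * e Z (n + 1)) * real n \<le> M * real n ^ k"
  shows "\<exists>M. \<forall>\<^sub>F n in sequentially.
    ((\<Sum>Z\<in>R. e Z (n + 2)) + (\<Sum>Z\<in>R. e Z n) - 2 * (\<Sum>Z\<in>R. e Z (n + 1))) * real n \<le> M * real n ^ k"
  using assms
proof (induction R rule: finite_induct)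
  case empty
  show ?case by (intro exI [of _ 0]) simp
next
  case (insert Z R)
  from insert.prems [of Z] obtain M where
    M: "\<forall>\<^sub>F n in sequentially. (e Z (n + 2) + e Z n - 2 * e Z (n + 1)) * real n \<le> M * real n ^ k" by auto
  from insert.IH insert.prems obtain M' where M': "\<forall>\<^sub>F n in sequentially.
    ((\<Sum>Z\<in>R. e Z (n + 2)) + (\<Sum>Z\<in>R. e Z n) - 2 * (\<Sum>Z\<in>R. e Z (n + 1))) * real n \<le> M' * real n ^ k" by auto
  from M M' have "\<forall>\<^sub>F n in sequentially.
    ((\<Sum>Z\<in>insert Z R. e Z (n + 2)) + (\<Sum>Z\<in>insert Z R. e Z n) - 2 * (\<Sum>Z\<in>insert Z R. e Z (n + 1))) * real n
      \<le> (M + M') * real n ^ k"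
    by eventually_elim (use insert.hyps in \<open>simp add: algebra_simps\<close>)
  then show ?case ..
qed

text \<open>Once the set of relevant primes is stable, \<open>f\<close> is a sum over a fixed finite
  set. The summands are nonnegative, so each inherits the growth bound of \<open>f\<close>.\<close>

theorem f_sym_second_difference:
  fixes G H :: "('n::finite \<Rightarrow> nat) set"
  defines "f \<equiv> f_sym (mi {u. \<exists>g\<in>G. \<forall>i. g i \<le> u i} :: ('n, 'k::field) mpoly set) (mi {u. \<exists>h\<in>H. \<forall>i. h i \<le> u i})"
  assumes G: "finite G" and H: "finite H" and c: "c \<ge> 1"
    and growth: "\<forall>\<^sub>F n in sequentially. \<bar>real_of_int (f n)\<bar> \<le> C * real n ^ c"
  shows "\<exists>M. \<forall>\<^sub>F n in sequentially. (of_int (f (n + 2)) + of_int (f n) - 2 * of_int (f (n + 1))) * real n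
      \<le> M * real n ^ (c - 1)"
proof (cases "G = {}")
  \<comment> \<open>The zero ideal: all positive powers vanish, so \<open>f\<close> is constant from
    n = 1 on.\<close>
  case True
  have "pw G Z n = {}" if "n \<ge> 1" for Z and n using that True by (auto simp: pw_def)
  then have lt: "loc_tor G Z n = loc_tor G Z 1" if "n \<ge> 1" for Z and n
    using that by (simp add: loc_tor_def sat_def)
  have const: "f n = f 1" if "n \<ge> 1" for n
    unfolding f_def f_sym_eq_sum_loc_tor [OF G H] relevant_def by (simp only: lt [OF that])
  have "(of_int (f (n + 2)) + of_int (f n) - 2 * of_int (f (n + 1))) * real n \<le> 0 * real n ^ (c - 1)"
    if "n \<ge> 1" for n
  proof -
    have "f (n + 2) = f 1" "f n = f 1" "f (n + 1) = f 1" by (rule const, use that in simp)+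
    then show ?thesis by simp
  qed
  then show ?thesis unfolding eventually_sequentially by blast
next
  case False
  obtain R where R: "\<forall>\<^sub>F n in sequentially. relevant G H n = R"
    by (rule relevant_eventually_constant [OF G False]) (rule that)
  let ?R = "{Z \<in> R. card Z = Max (card ` R)}"
  have f: "\<forall>\<^sub>F n in sequentially. real_of_int (f n) = (\<Sum>Z\<in>?R. real (card (loc_tor G Z n)))"
    using R by eventually_elim (simp add: f_def f_sym_eq_sum_loc_tor [OF G H])
  have f1: "\<forall>\<^sub>F n in sequentially. real_of_int (f (n + 1)) = (\<Sum>Z\<in>?R. real (card (loc_tor G Z (n + 1))))"
    by (rule eventually_compose_filterlim [OF f filterlim_add_const_nat_at_top])
  have f2: "\<forall>\<^sub>F n in sequentially. real_of_int (f (n + 2)) = (\<Sum>Z\<in>?R. real (card (loc_tor G Z (n + 2))))"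
    by (rule eventually_compose_filterlim [OF f filterlim_add_const_nat_at_top])
  have "\<exists>M. \<forall>\<^sub>F n in sequentially.
    ((\<Sum>Z\<in>?R. real (card (loc_tor G Z (n + 2)))) + (\<Sum>Z\<in>?R. real (card (loc_tor G Z n)))
      - 2 * (\<Sum>Z\<in>?R. real (card (loc_tor G Z (n + 1))))) * real n \<le> M * real n ^ (c - 1)"
  proof (rule sum_second_difference)
    show "finite ?R" by simp
    fix Z assume Z: "Z \<in> ?R"
    show "\<exists>M. \<forall>\<^sub>F n in sequentially.
      (real (card (loc_tor G Z (n + 2))) + real (card (loc_tor G Z n)) - 2 * real (card (loc_tor G Z (n + 1)))) * real n
      \<le> M * real n ^ (c - 1)"
    proof (rule loc_tor_second_difference_of_growth [OF G False _ c])
      from R obtain n where "relevant G H n = R" by (auto simp: eventually_sequentially)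
      then have "loc_tor G Z n \<noteq> {}" using Z by (auto simp: relevant_def)
      then show "Z \<noteq> UNIV" using loc_tor_UNIV [OF False G] by metis
      show "\<forall>\<^sub>F n in sequentially. real (card (loc_tor G Z n)) \<le> C * real n ^ c"
        using f growth
      proof eventually_elim
        case (elim n)
        have "real (card (loc_tor G Z n)) \<le> (\<Sum>Z\<in>?R. real (card (loc_tor G Z n)))"
          using Z by (intro member_le_sum) auto
        then show ?case using elim by linarith
      qed
    qed
  qed
  then obtain M where M: "\<forall>\<^sub>F n in sequentially.
    ((\<Sum>Z\<in>?R. real (card (loc_tor G Z (n + 2)))) + (\<Sum>Z\<in>?R. real (card (loc_tor G Z n)))
      - 2 * (\<Sum>Z\<in>?R. real (card (loc_tor G Z (n + 1))))) * real n \<le> M * real n ^ (c - 1)" ..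
  have "\<forall>\<^sub>F n in sequentially. (of_int (f (n + 2)) + of_int (f n) - 2 * of_int (f (n + 1))) * real n
      \<le> M * real n ^ (c - 1)"
    using M f f1 f2 by eventually_elim (simp only:)
  then show ?thesis ..
qed

theorem theorem1p2:
  fixes I J :: "('n::finite, 'k::field) mpoly set"
    and g c :: nat and a :: "nat \<Rightarrow> nat \<Rightarrow> rat"
  assumes "monomial_ideal I" and "monomial_ideal J"
    and "quasi_poly_type (f_sym I J) g c a"
    and "generated_in_one_degree I"
    and "height mpoly_ring I \<ge> 2"
  shows "c \<ge> 1 \<longrightarrow> (\<exists>r. \<forall>n. a (c - 1) n = r)"
proof
  assume c: "c \<ge> 1"
  obtain G where G: "finite G" "I = mi {u. \<exists>g\<in>G. \<forall>i. g i \<le> u i}"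
    by (rule monomial_ideal_finite [OF assms(1)]) (rule that)
  obtain H where H: "finite H" "J = mi {u. \<exists>g\<in>H. \<forall>i. g i \<le> u i}"
    by (rule monomial_ideal_finite [OF assms(2)]) (rule that)
  obtain C where "\<forall>\<^sub>F n in sequentially. \<bar>real_of_int (f_sym I J n)\<bar> \<le> C * real n ^ c"
    by (rule quasi_poly_growth [OF assms(3)]) (rule that)
  from f_sym_second_difference [OF G(1) H(1) c this [unfolded G(2) H(2)], folded G(2) H(2)]
  obtain M where "\<forall>\<^sub>F n in sequentially.
    (of_int (f_sym I J (n + 2)) + of_int (f_sym I J n) - 2 * of_int (f_sym I J (n + 1))) * real n
      \<le> M * real n ^ (c - 1)" ..
  then show "\<exists>r. \<forall>n. a (c - 1) n = r" by (rule quasi_poly_second_difference [OF assms(3) c])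
qed

end
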